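(* Let $M\times_\lambda N$ be the singly warped product of Riemannian manifolds $(M,g)$ and $(N,h)$ with smooth warping function $\lambda:M\to(0,+\infty)$. Suppose that $\psi:N\to N$ is a harmonic map and $f\in C^\infty(M\times_\lambda N)$ is a positive function. For the product map $\Psi=\mathrm{Id}_M\times\psi:M\times_\lambda N\to(M\times N,g\oplus h)$, $\Psi(x,y)=(x,\psi(y))$, we have $$\tau_{2,f}(\Psi)=\big(\tau_{2,f}(\bar\pi_1),\,0\big),$$ where $\bar\pi_1:M\times_\lambda N\to M$, $\bar\pi_1(x,y)=x$, is the projection.
   Context: $M\times_\lambda N$ is $M\times N$ with the metric $\bar g=g\oplus\lambda^2h$. Curvature convention $R(X,Y)Z=\nabla_X\nabla_YZ-\nabla_Y\nabla_XZ-\nabla_{[X,Y]}Z$. For a smooth map $\phi:(P,k)\to(Q,q)$ and positive smooth $f$ on $P$: $\tau(\phi)=\mathrm{Tr}_k\nabla d\phi$ is the tension field ($\phi$ is harmonic iff it vanishes), and the $f$-bi-tension field (Euler–Lagrange operator of the $f$-bi-energy $\frac12\int_\Omega f|\tau(\phi)|^2dv_k$) is $$\tau_{2,f}(\phi)=-\mathrm{Tr}_k(\nabla^\phi)^2(f\tau(\phi))-f\sum_iR^Q(\tau(\phi),d\phi(\epsilon_i))d\phi(\epsilon_i),$$ where $\nabla^\phi$ is the pull-back connection, $\{\epsilon_i\}$ is a local orthonormal frame of $P$, and $\mathrm{Tr}_k(\nabla^\phi)^2V=\sum_i(\nabla^\phi_{\epsilon_i}\nabla^\phi_{\epsilon_i}V-\nabla^\phi_{\nabla_{\epsilon_i}\epsilon_i}V)$.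 The tangent spaces of $M\times N$ are split as $T_xM\oplus T_yN$. *)

theory Defs
  imports "HOL-Analysis.Analysis"
begin

section \<open>Smooth maps between Euclidean spaces\<close>

text \<open>Meant for open \<open>S\<close>; in finite dimension this is the usual notion of class \<open>C\<^sup>k\<close>.\<close>

primrec Ck_on :: "nat \<Rightarrow> 'a::euclidean_space set \<Rightarrow> ('a \<Rightarrow> 'b::real_normed_vector) \<Rightarrow> bool" where
  "Ck_on 0 S f \<longleftrightarrow> continuous_on S f"
| "Ck_on (Suc k) S f \<longleftrightarrow>
     (\<forall>x\<in>S. f differentiable (at x)) \<and>
     (\<forall>v. Ck_on k S (\<lambda>x. frechet_derivative f (at x) v))"

definition smooth_on :: "'a::euclidean_space set \<Rightarrow> ('a \<Rightarrow> 'b::real_normed_vector) \<Rightarrow> bool" where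
  "smooth_on S f \<longleftrightarrow> (\<forall>k. Ck_on k S f)"

section \<open>Riemannian manifolds\<close>

text \<open>A manifold is a whole type \<open>'a\<close> with an atlas of charts indexed by \<open>'i\<close>, modelled on
  \<open>'e\<close>; the atlas need not be maximal, and an index may be left unused by giving it the empty
  domain. The metric is given by its components in each chart: \<open>metric P i x u v\<close> is the inner
  product at \<open>x\<close> of the tangent vectors whose coordinates in chart \<open>i\<close> are \<open>u\<close> and \<open>v\<close>.\<close>

record ('i, 'a, 'e) rmanifold =
  chart_dom :: "'i \<Rightarrow> 'a set"
  chart_map :: "'i \<Rightarrow> 'a \<Rightarrow> 'e"
  metric :: "'i \<Rightarrow> 'a \<Rightarrow> 'e \<Rightarrow> 'e \<Rightarrow> real"

definition chart_inv :: "('i, 'a, 'e) rmanifold \<Rightarrow> 'i \<Rightarrow> 'e \<Rightarrow> 'a" where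
  "chart_inv P i = inv_into (chart_dom P i) (chart_map P i)"

definition transition_deriv ::
  "('i, 'a, 'e::euclidean_space) rmanifold \<Rightarrow> 'i \<Rightarrow> 'i \<Rightarrow> 'a \<Rightarrow> 'e \<Rightarrow> 'e" where
  "transition_deriv P i j x =
     frechet_derivative (chart_map P j \<circ> chart_inv P i) (at (chart_map P i x))"

definition smooth_manifold ::
  "('i, 'a::{second_countable_topology, t2_space}, 'e::euclidean_space) rmanifold \<Rightarrow> bool" where
  "smooth_manifold P \<longleftrightarrow>
     (\<Union>i. chart_dom P i) = UNIV \<and>
     (\<forall>i. open (chart_dom P i) \<and> open (chart_map P i ` chart_dom P i) \<and>
          homeomorphism (chart_dom P i) (chart_map P i ` chart_dom P i)
            (chart_map P i) (chart_inv P i)) \<and>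
     (\<forall>i j. smooth_on (chart_map P i ` (chart_dom P i \<inter> chart_dom P j))
              (chart_map P j \<circ> chart_inv P i))"

definition riemannian_manifold ::
  "('i, 'a::{second_countable_topology, t2_space}, 'e::euclidean_space) rmanifold \<Rightarrow> bool" where
  "riemannian_manifold P \<longleftrightarrow>
     smooth_manifold P \<and>
     (\<forall>i. \<forall>x\<in>chart_dom P i.
        bilinear (metric P i x) \<and>
        (\<forall>u v. metric P i x u v = metric P i x v u) \<and>
        (\<forall>u. u \<noteq> 0 \<longrightarrow> 0 < metric P i x u u)) \<and>
     (\<forall>i j. \<forall>x\<in>chart_dom P i \<inter> chart_dom P j. \<forall>u v.
        metric P j x (transition_deriv P i j x u) (transition_deriv P i j x v)
          = metric P i x u v) \<and>
     (\<forall>i u v. smooth_on (chart_map P i ` chart_dom P i)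
        (\<lambda>z. metric P i (chart_inv P i z) u v))"

definition smooth_function ::
  "('i, 'a, 'e::euclidean_space) rmanifold \<Rightarrow> ('a \<Rightarrow> real) \<Rightarrow> bool" where
  "smooth_function P f \<longleftrightarrow>
     (\<forall>i. smooth_on (chart_map P i ` chart_dom P i) (f \<circ> chart_inv P i))"

definition smooth_map ::
  "('i, 'a::topological_space, 'e::euclidean_space) rmanifold \<Rightarrow>
   ('j, 'b::topological_space, 'd::euclidean_space) rmanifold \<Rightarrow> ('a \<Rightarrow> 'b) \<Rightarrow> bool" where
  "smooth_map P Q \<phi> \<longleftrightarrow>
     continuous_on UNIV \<phi> \<and>
     (\<forall>i j. smooth_on (chart_map P i ` (chart_dom P i \<inter> \<phi> -` chart_dom Q j))
              (chart_map Q j \<circ> \<phi> \<circ> chart_inv P i))"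

section \<open>Tangent vectors and vector fields\<close>

text \<open>A tangent vector at \<open>x\<close> is the family of its coordinates in the charts around \<open>x\<close>; the values
  at indices \<open>i\<close> with \<open>x \<notin> chart_dom P i\<close> are irrelevant. A vector field along a map
  \<open>\<phi> : P \<rightarrow> Q\<close> accordingly has type \<open>'a \<Rightarrow> 'j \<Rightarrow> 'd\<close>: it assigns to \<open>x\<close> a
  family indexed by the charts of \<open>Q\<close>, relevant at the charts around \<open>\<phi> x\<close>.\<close>

definition tangent_vector ::
  "('i, 'a, 'e::euclidean_space) rmanifold \<Rightarrow> 'a \<Rightarrow> ('i \<Rightarrow> 'e) \<Rightarrow> bool" where
  "tangent_vector P x v \<longleftrightarrow>
     (\<forall>i j. x \<in> chart_dom P i \<inter> chart_dom P j \<longrightarrow> v j = transition_deriv P i j x (v i))"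

definition smooth_vector_field ::
  "('i, 'a, 'e::euclidean_space) rmanifold \<Rightarrow> 'a set \<Rightarrow> ('a \<Rightarrow> 'i \<Rightarrow> 'e) \<Rightarrow> bool" where
  "smooth_vector_field P U X \<longleftrightarrow>
     (\<forall>x\<in>U. tangent_vector P x (X x)) \<and>
     (\<forall>i. smooth_on (chart_map P i ` (U \<inter> chart_dom P i)) (\<lambda>z. X (chart_inv P i z) i))"

text \<open>Local orthonormal frames; \<open>Basis\<close> only serves as an index set with \<open>dim P\<close> elements.\<close>

definition local_orthonormal_frame ::
  "('i, 'a::topological_space, 'e::euclidean_space) rmanifold \<Rightarrow> 'a set \<Rightarrow>
   ('e \<Rightarrow> 'a \<Rightarrow> 'i \<Rightarrow> 'e) \<Rightarrow> bool" where
  "local_orthonormal_frame P U \<epsilon> \<longleftrightarrow>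
     open U \<and>
     (\<forall>b\<in>Basis. smooth_vector_field P U (\<epsilon> b)) \<and>
     (\<forall>x\<in>U. \<forall>i. x \<in> chart_dom P i \<longrightarrow>
        (\<forall>b\<in>Basis. \<forall>b'\<in>Basis.
           metric P i x (\<epsilon> b x i) (\<epsilon> b' x i) = (if b = b' then 1 else 0)))"

text \<open>The traces formed below do not depend on which local orthonormal frame is chosen.\<close>

definition frame_at ::
  "('i, 'a::topological_space, 'e::euclidean_space) rmanifold \<Rightarrow> 'a \<Rightarrow> 'e \<Rightarrow> 'a \<Rightarrow> 'i \<Rightarrow> 'e" where
  "frame_at P x = (SOME \<epsilon>. \<exists>U. x \<in> U \<and> local_orthonormal_frame P U \<epsilon>)"

text \<open>Derivative at \<open>x\<close> of a vector-space-valued function \<open>F\<close> defined near \<open>x\<close>: in direction of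
  the vector with coordinates \<open>w\<close> in chart \<open>i\<close>, respectively along the tangent vector \<open>v\<close> (by the
  chain rule the chart chosen there is irrelevant).\<close>

definition chart_deriv ::
  "('i, 'a, 'e::euclidean_space) rmanifold \<Rightarrow> 'i \<Rightarrow> ('a \<Rightarrow> 'c::real_normed_vector) \<Rightarrow> 'a \<Rightarrow> 'e \<Rightarrow> 'c" where
  "chart_deriv P i F x w = frechet_derivative (F \<circ> chart_inv P i) (at (chart_map P i x)) w"

definition dir_deriv ::
  "('i, 'a, 'e::euclidean_space) rmanifold \<Rightarrow> ('a \<Rightarrow> 'c::real_normed_vector) \<Rightarrow> 'a \<Rightarrow> ('i \<Rightarrow> 'e) \<Rightarrow> 'c" where
  "dir_deriv P F x v = (let i = (SOME i. x \<in> chart_dom P i) in chart_deriv P i F x (v i))"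

definition differential ::
  "('i, 'a, 'e::euclidean_space) rmanifold \<Rightarrow> ('j, 'b, 'd::euclidean_space) rmanifold \<Rightarrow>
   ('a \<Rightarrow> 'b) \<Rightarrow> 'a \<Rightarrow> ('i \<Rightarrow> 'e) \<Rightarrow> 'j \<Rightarrow> 'd" where
  "differential P Q \<phi> x v j = dir_deriv P (chart_map Q j \<circ> \<phi>) x v"

section \<open>Levi-Civita connection and curvature\<close>

text \<open>\<open>christoffel P i x u v\<close> is the vector with components \<open>\<Gamma>\<^sup>c\<^sub>a\<^sub>b u\<^sup>a v\<^sup>b\<close>
  in chart \<open>i\<close>, characterised by lowering the index in
  \<open>\<Gamma>\<^sup>c\<^sub>a\<^sub>b = 1/2 g\<^sup>c\<^sup>d (\<partial>\<^sub>a g\<^sub>b\<^sub>d + \<partial>\<^sub>b g\<^sub>a\<^sub>d - \<partial>\<^sub>d g\<^sub>a\<^sub>b)\<close>.\<close>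

definition christoffel ::
  "('i, 'a, 'e::euclidean_space) rmanifold \<Rightarrow> 'i \<Rightarrow> 'a \<Rightarrow> 'e \<Rightarrow> 'e \<Rightarrow> 'e" where
  "christoffel P i x u v = (THE w. \<forall>z.
     2 * metric P i x w z =
       chart_deriv P i (\<lambda>y. metric P i y v z) x u +
       chart_deriv P i (\<lambda>y. metric P i y u z) x v -
       chart_deriv P i (\<lambda>y. metric P i y u v) x z)"

text \<open>The field \<open>\<nabla>\<^sub>X Y\<close>.\<close>

definition levi_civita ::
  "('i, 'a, 'e::euclidean_space) rmanifold \<Rightarrow> ('a \<Rightarrow> 'i \<Rightarrow> 'e) \<Rightarrow> ('a \<Rightarrow> 'i \<Rightarrow> 'e) \<Rightarrow> 'a \<Rightarrow> 'i \<Rightarrow> 'e" where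
  "levi_civita P X Y x i =
     chart_deriv P i (\<lambda>y. Y y i) x (X x i) + christoffel P i x (X x i) (Y x i)"

definition lie_bracket ::
  "('i, 'a, 'e::euclidean_space) rmanifold \<Rightarrow> ('a \<Rightarrow> 'i \<Rightarrow> 'e) \<Rightarrow> ('a \<Rightarrow> 'i \<Rightarrow> 'e) \<Rightarrow> 'a \<Rightarrow> 'i \<Rightarrow> 'e" where
  "lie_bracket P X Y x i =
     chart_deriv P i (\<lambda>y. Y y i) x (X x i) - chart_deriv P i (\<lambda>y. X y i) x (Y x i)"

definition curvature_field ::
  "('i, 'a, 'e::euclidean_space) rmanifold \<Rightarrow> ('a \<Rightarrow> 'i \<Rightarrow> 'e) \<Rightarrow> ('a \<Rightarrow> 'i \<Rightarrow> 'e) \<Rightarrow>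
   ('a \<Rightarrow> 'i \<Rightarrow> 'e) \<Rightarrow> 'a \<Rightarrow> 'i \<Rightarrow> 'e" where
  "curvature_field P X Y Z x i =
     levi_civita P X (levi_civita P Y Z) x i -
     levi_civita P Y (levi_civita P X Z) x i -
     levi_civita P (lie_bracket P X Y) Z x i"

text \<open>The vector field on \<open>chart_dom P i\<close> with constant coordinates \<open>u\<close> in chart \<open>i\<close>.\<close>

definition coordinate_field ::
  "('i, 'a, 'e::euclidean_space) rmanifold \<Rightarrow> 'i \<Rightarrow> 'e \<Rightarrow> 'a \<Rightarrow> 'i \<Rightarrow> 'e" where
  "coordinate_field P i u x k = transition_deriv P i k x u"

text \<open>The curvature is tensorial, so its value on tangent vectors at \<open>x\<close> is obtained by extending
  them to vector fields; the component in chart \<open>i\<close> is computed with the extensions that are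
  constant in that chart.\<close>

definition curvature ::
  "('i, 'a, 'e::euclidean_space) rmanifold \<Rightarrow> 'a \<Rightarrow> ('i \<Rightarrow> 'e) \<Rightarrow> ('i \<Rightarrow> 'e) \<Rightarrow> ('i \<Rightarrow> 'e) \<Rightarrow> 'i \<Rightarrow> 'e" where
  "curvature P x u v w i =
     curvature_field P (coordinate_field P i (u i)) (coordinate_field P i (v i))
       (coordinate_field P i (w i)) x i"

section \<open>Tension and f-bi-tension fields\<close>

text \<open>The field \<open>\<nabla>\<^sup>\<phi>\<^sub>X V\<close> along \<open>\<phi>\<close>, for \<open>X\<close> a vector field on \<open>P\<close> and
  \<open>V\<close> a vector field along \<open>\<phi>\<close>.\<close>

definition pullback_conn ::
  "('i, 'a, 'e::euclidean_space) rmanifold \<Rightarrow> ('j, 'b, 'd::euclidean_space) rmanifold \<Rightarrow>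
   ('a \<Rightarrow> 'b) \<Rightarrow> ('a \<Rightarrow> 'i \<Rightarrow> 'e) \<Rightarrow> ('a \<Rightarrow> 'j \<Rightarrow> 'd) \<Rightarrow> 'a \<Rightarrow> 'j \<Rightarrow> 'd" where
  "pullback_conn P Q \<phi> X V x j =
     dir_deriv P (\<lambda>y. V y j) x (X x) +
     christoffel Q j (\<phi> x) (differential P Q \<phi> x (X x) j) (V x j)"

text \<open>\<open>(\<nabla>d\<phi>)(X, Y)\<close>.\<close>

definition second_fundamental_form ::
  "('i, 'a, 'e::euclidean_space) rmanifold \<Rightarrow> ('j, 'b, 'd::euclidean_space) rmanifold \<Rightarrow>
   ('a \<Rightarrow> 'b) \<Rightarrow> ('a \<Rightarrow> 'i \<Rightarrow> 'e) \<Rightarrow> ('a \<Rightarrow> 'i \<Rightarrow> 'e) \<Rightarrow> 'a \<Rightarrow> 'j \<Rightarrow> 'd" where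
  "second_fundamental_form P Q \<phi> X Y x j =
     pullback_conn P Q \<phi> X (\<lambda>y. differential P Q \<phi> y (Y y)) x j -
     differential P Q \<phi> x (levi_civita P X Y x) j"

definition tension_field ::
  "('i, 'a::topological_space, 'e::euclidean_space) rmanifold \<Rightarrow>
   ('j, 'b, 'd::euclidean_space) rmanifold \<Rightarrow> ('a \<Rightarrow> 'b) \<Rightarrow> 'a \<Rightarrow> 'j \<Rightarrow> 'd" where
  "tension_field P Q \<phi> x j =
     (\<Sum>b\<in>Basis. second_fundamental_form P Q \<phi> (frame_at P x b) (frame_at P x b) x j)"

definition harmonic_map ::
  "('i, 'a::topological_space, 'e::euclidean_space) rmanifold \<Rightarrow>
   ('j, 'b::topological_space, 'd::euclidean_space) rmanifold \<Rightarrow> ('a \<Rightarrow> 'b) \<Rightarrow> bool" where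
  "harmonic_map P Q \<phi> \<longleftrightarrow>
     smooth_map P Q \<phi> \<and>
     (\<forall>x j. \<phi> x \<in> chart_dom Q j \<longrightarrow> tension_field P Q \<phi> x j = 0)"

text \<open>\<open>Tr (\<nabla>\<^sup>\<phi>)\<^sup>2 V\<close>.\<close>

definition rough_laplacian ::
  "('i, 'a::topological_space, 'e::euclidean_space) rmanifold \<Rightarrow>
   ('j, 'b, 'd::euclidean_space) rmanifold \<Rightarrow> ('a \<Rightarrow> 'b) \<Rightarrow> ('a \<Rightarrow> 'j \<Rightarrow> 'd) \<Rightarrow> 'a \<Rightarrow> 'j \<Rightarrow> 'd" where
  "rough_laplacian P Q \<phi> V x j =
     (let \<epsilon> = frame_at P x in
      \<Sum>b\<in>Basis.
        pullback_conn P Q \<phi> (\<epsilon> b) (pullback_conn P Q \<phi> (\<epsilon> b) V) x j -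
        pullback_conn P Q \<phi> (levi_civita P (\<epsilon> b) (\<epsilon> b)) V x j)"

definition f_bitension_field ::
  "('i, 'a::topological_space, 'e::euclidean_space) rmanifold \<Rightarrow>
   ('j, 'b, 'd::euclidean_space) rmanifold \<Rightarrow> ('a \<Rightarrow> real) \<Rightarrow> ('a \<Rightarrow> 'b) \<Rightarrow> 'a \<Rightarrow> 'j \<Rightarrow> 'd" where
  "f_bitension_field P Q f \<phi> x j =
     (let \<epsilon> = frame_at P x; \<tau> = tension_field P Q \<phi> in
      - rough_laplacian P Q \<phi> (\<lambda>y k. f y *\<^sub>R \<tau> y k) x j -
      f x *\<^sub>R (\<Sum>b\<in>Basis.
        curvature Q (\<phi> x) (\<tau> x) (differential P Q \<phi> x (\<epsilon> b x))
          (differential P Q \<phi> x (\<epsilon> b x)) j))"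

section \<open>Products\<close>

text \<open>The product carries the atlas of product charts, so in the chart \<open>(i, j)\<close> a tangent vector
  of the product is a pair \<open>(u, v)\<close> with \<open>u\<close> the coordinates in chart \<open>i\<close> of its component tangent
  to the first factor and \<open>v\<close> those in chart \<open>j\<close> of its component tangent to the second factor.\<close>

definition warped_product ::
  "('a \<Rightarrow> real) \<Rightarrow> ('i, 'a, 'e) rmanifold \<Rightarrow> ('j, 'b, 'd) rmanifold \<Rightarrow>
   ('i \<times> 'j, 'a \<times> 'b, 'e \<times> 'd) rmanifold" where
  "warped_product lam M N =
     \<lparr>chart_dom = (\<lambda>(i, j). chart_dom M i \<times> chart_dom N j),
      chart_map = (\<lambda>(i, j). map_prod (chart_map M i) (chart_map N j)),
      metric = (\<lambda>(i, j) (x, y) (u, v) (u', v').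
        metric M i x u u' + (lam x)\<^sup>2 * metric N j y v v')\<rparr>"

definition riemannian_product ::
  "('i, 'a, 'e) rmanifold \<Rightarrow> ('j, 'b, 'd) rmanifold \<Rightarrow>
   ('i \<times> 'j, 'a \<times> 'b, 'e \<times> 'd) rmanifold" where
  "riemannian_product M N =
     \<lparr>chart_dom = (\<lambda>(i, j). chart_dom M i \<times> chart_dom N j),
      chart_map = (\<lambda>(i, j). map_prod (chart_map M i) (chart_map N j)),
      metric = (\<lambda>(i, j) (x, y) (u, v) (u', v').
        metric M i x u u' + metric N j y v v')\<rparr>"

text \<open>The splitting of the tangent spaces of a product: the vector \<open>(u, v)\<close> with components \<open>u\<close> and
  \<open>v\<close> tangent to the factors; and equality of tangent vectors at \<open>q\<close>, which ignores the charts that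
  do not contain \<open>q\<close>.\<close>

definition tangent_pair :: "('i \<Rightarrow> 'e) \<Rightarrow> ('j \<Rightarrow> 'd) \<Rightarrow> 'i \<times> 'j \<Rightarrow> 'e \<times> 'd" where
  "tangent_pair u v = (\<lambda>(i, j). (u i, v j))"

definition tangent_eq :: "('i, 'a, 'e) rmanifold \<Rightarrow> 'a \<Rightarrow> ('i \<Rightarrow> 'e) \<Rightarrow> ('i \<Rightarrow> 'e) \<Rightarrow> bool" where
  "tangent_eq Q q u v \<longleftrightarrow> (\<forall>i. q \<in> chart_dom Q i \<longrightarrow> u i = v i)"

end

theory Submission
  imports Defs
begin

text \<open>The Christoffel symbols and the curvature of the product metric split. For the warped metric,
  \<open>\<nabla>\<^sub>X X\<close> is tangent to \<open>M\<close> for horizontal \<open>X\<close>, while the \<open>N\<close>-component of \<open>\<nabla>\<^sub>V V\<close> is that of \<open>N\<close>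
  for vertical \<open>V\<close>; mixed directions do not enter a trace over an adapted orthonormal frame. Hence
  \<open>\<tau>(\<Psi>) = (\<tau>(\<pi>\<^sub>1), lam\<^sup>-\<^sup>2 \<tau>(\<psi>)) = (\<tau>(\<pi>\<^sub>1), 0)\<close>. A field along \<open>\<Psi>\<close> whose \<open>N\<close>-part vanishes keeps
  this form under the pull-back connection, whose \<open>M\<close>-part is the connection along \<open>\<pi>\<^sub>1\<close>, and the
  curvature of \<open>N\<close> with vanishing first argument is zero, so both terms of the bi-tension split.

  Since \<open>frechet_derivative\<close>, \<open>THE\<close> and the frame chosen in \<open>frame_at\<close> carry junk values, every
  field that is differentiated has to be smooth: smooth local frames come from Gram-Schmidt, and the
  smoothness of \<open>\<tau>\<close>, which involves a different frame at every point, from the independence of the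
  trace of the frame.\<close>

section \<open>Smooth functions\<close>

text \<open>The same frame \<open>frame_at P p\<close> of the domain enters the fields of
  \<open>\<Psi>\<close> and those of \<open>fst\<close>, so the bi-tension fields are compared
  summand by summand in that frame. Only the tension of \<open>\<Psi>\<close> calls for an adapted
  basis: its \<open>N\<close>-part vanishes as a sum over the basis and not term by term. A less
  visible obstacle is \<open>dir_deriv\<close>, which evaluates in a chart picked by
  \<open>SOME\<close>. A formula in a prescribed chart holds only for directions that transform as
  tangent vectors, and the correction term of the rough Laplacian differentiates along
  \<open>\<nabla>\<^sub>\<epsilon> \<epsilon>\<close>. Tangency of this field rests on the
  transformation law of the Christoffel symbols, hence on the symmetry of the second derivatives of
  the transition maps. The target metric is treated as a warped product with warping function 1, so
  that one computation of Koszul forms serves domain and target.\<close>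

lemma Ck_on_cong:
  assumes "open S" "\<And>x. x \<in> S \<Longrightarrow> f x = g x"
  shows "Ck_on k S f \<longleftrightarrow> Ck_on k S g"
proof -
  have *: "Ck_on k S f \<Longrightarrow> Ck_on k S g" if "\<And>x. x \<in> S \<Longrightarrow> f x = g x" for f g :: "'a \<Rightarrow> 'b"
    using that
  proof (induction k arbitrary: f g)
    case 0
    then show ?case
      by (metis Ck_on.simps(1) continuous_on_cong)
  next
    case (Suc k)
    have diff: "g differentiable (at x)" if "x \<in> S" for x
      using Suc.prems that assms(1)
      by (meson Ck_on.simps(2) differentiable_def has_derivative_transform_within_open)
    have eq: "frechet_derivative f (at x) = frechet_derivative g (at x)" if "x \<in> S" for x
      using frechet_derivative_transform_within_open[of f x S g] Suc.prems that assms(1) by auto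
    have "Ck_on k S (\<lambda>x. frechet_derivative g (at x) v)" for v
      using Suc.prems(1) Suc.IH[of "\<lambda>x. frechet_derivative f (at x) v"] eq by auto
    then show ?case using diff by simp
  qed
  show ?thesis using *[of f g] *[of g f] assms(2) by metis
qed

text \<open>Uniqueness of the derivative admits any explicit formula \<open>f'\<close> in place of
  \<open>frechet_derivative\<close>; the closure lemmas below then reduce to the usual
  differentiation rules.\<close>

lemma Ck_on_SucI:
  assumes "open S" "\<And>x. x \<in> S \<Longrightarrow> (f has_derivative f' x) (at x)"
    and "\<And>v. Ck_on k S (\<lambda>x. f' x v)"
  shows "Ck_on (Suc k) S f"
proof -
  have "Ck_on k S (\<lambda>x. frechet_derivative f (at x) v)" for v
    using assms(3)[of v] frechet_derivative_at[OF assms(2)]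
    by (subst Ck_on_cong[OF assms(1), where g = "\<lambda>x. f' x v"]) auto
  then show ?thesis using assms(2) by (auto simp: differentiable_def)
qed

lemma Ck_on_SucD: "Ck_on (Suc k) S f \<Longrightarrow> Ck_on k S f"
proof (induction k arbitrary: f)
  case 0
  then show ?case
    by (auto intro!: continuous_at_imp_continuous_on differentiable_imp_continuous_within)
next
  case (Suc k)
  then show ?case by (metis Ck_on.simps(2))
qed

lemma Ck_on_has_derivative:
  "Ck_on (Suc k) S f \<Longrightarrow> x \<in> S \<Longrightarrow> (f has_derivative frechet_derivative f (at x)) (at x)"
  by (simp add: frechet_derivative_works[symmetric])

lemma Ck_on_subset: "Ck_on k S f \<Longrightarrow> T \<subseteq> S \<Longrightarrow> Ck_on k T f"
  by (induction k arbitrary: f) (auto intro: continuous_on_subset)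

lemma Ck_on_const: "Ck_on k S (\<lambda>_. c)"
  by (induction k arbitrary: c) auto

lemma Ck_on_linear:
  assumes S: "open S" and L: "bounded_linear L"
  shows "Ck_on k S f \<Longrightarrow> Ck_on k S (\<lambda>x. L (f x))"
proof (induction k arbitrary: f)
  case 0
  then show ?case using L by (auto intro: bounded_linear.continuous_on)
next
  case (Suc k)
  show ?case
    by (rule Ck_on_SucI[OF S bounded_linear.has_derivative[OF L Ck_on_has_derivative[OF Suc.prems]]])
       (use Suc in auto)
qed

lemma Ck_on_add:
  assumes S: "open S"
  shows "Ck_on k S f \<Longrightarrow> Ck_on k S g \<Longrightarrow> Ck_on k S (\<lambda>x. f x + g x)"
proof (induction k arbitrary: f g)
  case 0
  then show ?case by (auto intro: continuous_intros)
next
  case (Suc k)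
  show ?case
    by (rule Ck_on_SucI[OF S has_derivative_add[OF Ck_on_has_derivative Ck_on_has_derivative]])
       (use Suc in auto)
qed

text \<open>By the product rule the derivative is a sum of two products of the same kind, so the
  induction runs over all pairs \<open>f\<close>, \<open>g\<close> at once; the undifferentiated
  factor is lowered by one degree with \<open>Ck_on_SucD\<close>.\<close>

lemma Ck_on_bilinear:
  assumes S: "open S" and B: "bounded_bilinear B"
  shows "Ck_on k S f \<Longrightarrow> Ck_on k S g \<Longrightarrow> Ck_on k S (\<lambda>x. B (f x) (g x))"
proof (induction k arbitrary: f g)
  case 0
  then show ?case by (auto intro: bounded_bilinear.continuous_on[OF B])
next
  case (Suc k)
  show ?case
  proof (rule Ck_on_SucI[OF S])
    show "((\<lambda>x. B (f x) (g x)) has_derivative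
      (\<lambda>v. B (f x) (frechet_derivative g (at x) v) + B (frechet_derivative f (at x) v) (g x))) (at x)"
      if "x \<in> S" for x
      by (rule bounded_bilinear.FDERIV[OF B Ck_on_has_derivative Ck_on_has_derivative]) (use Suc that in auto)
    show "Ck_on k S (\<lambda>x. B (f x) (frechet_derivative g (at x) v) + B (frechet_derivative f (at x) v) (g x))" for v
      using Suc.prems by (intro Ck_on_add S Suc.IH) (auto simp del: Ck_on.simps intro: Ck_on_SucD simp: Ck_on.simps(2))
  qed
qed

lemma smooth_on_const [simp]: "smooth_on S (\<lambda>_. c)"
  by (simp add: smooth_on_def Ck_on_const)

lemma smooth_on_cong:
  assumes "open S" "\<And>x. x \<in> S \<Longrightarrow> f x = g x"
  shows "smooth_on S f \<longleftrightarrow> smooth_on S g"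
  using Ck_on_cong[OF assms] by (simp add: smooth_on_def)

lemma smooth_on_subset: "smooth_on S f \<Longrightarrow> T \<subseteq> S \<Longrightarrow> smooth_on T f"
  by (auto simp: smooth_on_def intro: Ck_on_subset)

lemma smooth_on_linear:
  "open S \<Longrightarrow> bounded_linear L \<Longrightarrow> smooth_on S f \<Longrightarrow> smooth_on S (\<lambda>x. L (f x))"
  by (simp add: smooth_on_def Ck_on_linear)

lemma smooth_on_add:
  "open S \<Longrightarrow> smooth_on S f \<Longrightarrow> smooth_on S g \<Longrightarrow> smooth_on S (\<lambda>x. f x + g x)"
  by (simp add: smooth_on_def Ck_on_add)

lemma smooth_on_bilinear:
  "open S \<Longrightarrow> bounded_bilinear B \<Longrightarrow> smooth_on S f \<Longrightarrow> smooth_on S g \<Longrightarrow> smooth_on S (\<lambda>x. B (f x) (g x))"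
  by (simp add: smooth_on_def Ck_on_bilinear)

lemma smooth_on_id [simp]: "open S \<Longrightarrow> smooth_on S (\<lambda>x. x)"
proof -
  assume S: "open S"
  have "Ck_on (Suc k) S (\<lambda>x. x)" for k
    by (rule Ck_on_SucI[OF S has_derivative_ident Ck_on_const])
  then show ?thesis unfolding smooth_on_def using Ck_on_SucD by blast
qed

lemma smooth_on_scaleR:
  "open S \<Longrightarrow> smooth_on S f \<Longrightarrow> smooth_on S g \<Longrightarrow> smooth_on S (\<lambda>x. f x *\<^sub>R g x)"
  by (rule smooth_on_bilinear[OF _ bounded_bilinear_scaleR])

lemma smooth_on_mult:
  fixes f g :: "_ \<Rightarrow> real"
  shows "open S \<Longrightarrow> smooth_on S f \<Longrightarrow> smooth_on S g \<Longrightarrow> smooth_on S (\<lambda>x. f x * g x)"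
  by (rule smooth_on_bilinear[OF _ bounded_bilinear_mult])

lemma smooth_on_inner_left: "open S \<Longrightarrow> smooth_on S f \<Longrightarrow> smooth_on S (\<lambda>x. f x \<bullet> c)"
  by (rule smooth_on_linear[OF _ bounded_linear_inner_left])

lemma smooth_on_minus: "open S \<Longrightarrow> smooth_on S f \<Longrightarrow> smooth_on S (\<lambda>x. - f x)"
  by (rule smooth_on_linear[OF _ bounded_linear_minus[OF bounded_linear_ident]])

lemma smooth_on_diff:
  "open S \<Longrightarrow> smooth_on S f \<Longrightarrow> smooth_on S g \<Longrightarrow> smooth_on S (\<lambda>x. f x - g x)"
  using smooth_on_add[of S f "\<lambda>x. - g x"] smooth_on_minus by auto

lemma smooth_on_sum:
  "open S \<Longrightarrow> (\<And>i. i \<in> I \<Longrightarrow> smooth_on S (f i)) \<Longrightarrow> smooth_on S (\<lambda>x. \<Sum>i\<in>I. f i x)"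
  by (induction I rule: infinite_finite_induct) (auto intro: smooth_on_add)

lemma smooth_on_Pair:
  fixes f :: "'a::euclidean_space \<Rightarrow> 'b::real_normed_vector" and g :: "'a \<Rightarrow> 'c::real_normed_vector"
  assumes "open S" "smooth_on S f" "smooth_on S g"
  shows "smooth_on S (\<lambda>x. (f x, g x))"
proof -
  have "smooth_on S (\<lambda>x. (f x, 0::'c) + (0::'b, g x))"
    using assms
    by (intro smooth_on_add smooth_on_linear[where L = "\<lambda>u. (u, 0::'c)"]
        smooth_on_linear[where L = "\<lambda>u. (0::'b, u)"] bounded_linear_Pair
        bounded_linear_ident bounded_linear_zero)
  then show ?thesis by simp
qed

lemma smooth_on_has_derivative:
  "smooth_on S f \<Longrightarrow> x \<in> S \<Longrightarrow> (f has_derivative frechet_derivative f (at x)) (at x)"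
  using Ck_on_has_derivative unfolding smooth_on_def by blast

lemma smooth_on_differentiable: "smooth_on S f \<Longrightarrow> x \<in> S \<Longrightarrow> f differentiable (at x)"
  using smooth_on_has_derivative differentiable_def by blast

lemma smooth_on_frechet: "smooth_on S f \<Longrightarrow> smooth_on S (\<lambda>x. frechet_derivative f (at x) v)"
  unfolding smooth_on_def by (metis Ck_on.simps(2))

lemma smooth_on_imp_continuous_on: "smooth_on S f \<Longrightarrow> continuous_on S f"
  unfolding smooth_on_def by (metis Ck_on.simps(1))

text \<open>Expanding \<open>a x\<close> in \<open>Basis\<close> leaves scalar coefficients times
  \<open>A x b\<close> with \<open>b\<close> fixed. Differentials and Koszul forms enter in this
  way, metrics and Christoffel symbols through the bilinear version: all are known to be smooth for
  fixed vectors but are evaluated on varying ones.\<close>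

lemma smooth_on_linear_family:
  fixes A :: "'a::euclidean_space \<Rightarrow> 'b::euclidean_space \<Rightarrow> 'c::real_normed_vector"
  assumes S: "open S" and lin: "\<And>x. x \<in> S \<Longrightarrow> linear (A x)"
    and sm: "\<And>v. smooth_on S (\<lambda>x. A x v)" and a: "smooth_on S a"
  shows "smooth_on S (\<lambda>x. A x (a x))"
proof -
  have "smooth_on S (\<lambda>x. \<Sum>b\<in>Basis. (a x \<bullet> b) *\<^sub>R A x b)"
    using assms by (intro smooth_on_sum smooth_on_scaleR smooth_on_inner_left)
  moreover have "A x (a x) = (\<Sum>b\<in>Basis. (a x \<bullet> b) *\<^sub>R A x b)" if "x \<in> S" for x
  proof -
    have "A x (a x) = A x (\<Sum>b\<in>Basis. (a x \<bullet> b) *\<^sub>R b)" by (simp add: euclidean_representation)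
    also have "\<dots> = (\<Sum>b\<in>Basis. (a x \<bullet> b) *\<^sub>R A x b)"
      using lin[OF that] by (simp add: linear_sum linear_scale)
    finally show ?thesis .
  qed
  ultimately show ?thesis using smooth_on_cong[OF S] by (metis (no_types, lifting))
qed

lemma smooth_on_bilinear_family:
  fixes A :: "'a::euclidean_space \<Rightarrow> 'b::euclidean_space \<Rightarrow> 'd::euclidean_space \<Rightarrow> 'c::real_normed_vector"
  assumes S: "open S" and lin: "\<And>x. x \<in> S \<Longrightarrow> bilinear (A x)"
    and sm: "\<And>u v. smooth_on S (\<lambda>x. A x u v)" and a: "smooth_on S a" "smooth_on S b"
  shows "smooth_on S (\<lambda>x. A x (a x) (b x))"
proof (rule smooth_on_linear_family[OF S _ _ a(2)])
  show "linear (A x (a x))" if "x \<in> S" for x using lin[OF that] by (auto simp: bilinear_def)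
  show "smooth_on S (\<lambda>x. A x (a x) v)" for v
    by (rule smooth_on_linear_family[OF S _ sm a(1)]) (use lin in \<open>auto simp: bilinear_def\<close>)
qed

lemma smooth_on_frechet_field:
  assumes "open S" "smooth_on S f" "smooth_on S a"
  shows "smooth_on S (\<lambda>x. frechet_derivative f (at x) (a x))"
  by (rule smooth_on_linear_family[where A = "\<lambda>x. frechet_derivative f (at x)"])
     (use assms in \<open>auto intro: smooth_on_frechet linear_frechet_derivative smooth_on_differentiable\<close>)

text \<open>Induction on the degree with \<open>g\<close> varying and \<open>f\<close> smooth to all
  orders: written in \<open>Basis\<close>, the chain rule exhibits the derivative as a sum of scalar
  functions times directional derivatives of \<open>g\<close> composed with \<open>f\<close>, to
  which the induction hypothesis applies.\<close>

lemma smooth_on_compose: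
  fixes f :: "'a::euclidean_space \<Rightarrow> 'b::euclidean_space" and g :: "'b \<Rightarrow> 'c::real_normed_vector"
  assumes S: "open S" and T: "open T" and f: "smooth_on S f" and g: "smooth_on T g" and fST: "f ` S \<subseteq> T"
  shows "smooth_on S (\<lambda>x. g (f x))"
proof -
  have "Ck_on k S (\<lambda>x. g (f x))" for k
    using g
  proof (induction k arbitrary: g)
    case 0
    then show ?case
      using continuous_on_compose2[OF smooth_on_imp_continuous_on[OF 0]
          smooth_on_imp_continuous_on[OF f] fST] by simp
  next
    case (Suc k)
    show ?case
    proof (rule Ck_on_SucI[OF S])
      show "((\<lambda>x. g (f x)) has_derivative
          (\<lambda>v. \<Sum>b\<in>Basis. (frechet_derivative f (at x) v \<bullet> b) *\<^sub>R frechet_derivative g (at (f x)) b)) (at x)"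
        if "x \<in> S" for x
      proof -
        have fx: "f x \<in> T" using that fST by auto
        have lin: "linear (frechet_derivative g (at (f x)))"
          by (rule linear_frechet_derivative[OF smooth_on_differentiable[OF Suc.prems fx]])
        have "((\<lambda>x. g (f x)) has_derivative
            (\<lambda>v. frechet_derivative g (at (f x)) (frechet_derivative f (at x) v))) (at x)"
          using has_derivative_compose[OF smooth_on_has_derivative[OF f that]
              smooth_on_has_derivative[OF Suc.prems fx]] .
        moreover have "frechet_derivative g (at (f x)) (frechet_derivative f (at x) v) =
          (\<Sum>b\<in>Basis. (frechet_derivative f (at x) v \<bullet> b) *\<^sub>R frechet_derivative g (at (f x)) b)" for v
          using lin by (subst euclidean_representation[symmetric, of "frechet_derivative f (at x) v"])
            (simp only: linear_sum linear_scale)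
        ultimately show ?thesis by simp
      qed
      have sc: "Ck_on k S (\<lambda>x. a x *\<^sub>R h x)" if "Ck_on k S a" "Ck_on k S h" for a and h :: "'a \<Rightarrow> 'c"
        by (rule Ck_on_bilinear[OF S bounded_bilinear_scaleR that])
      have sum: "Ck_on k S (\<lambda>x. \<Sum>i\<in>I. h i x)" if "\<And>i. i \<in> I \<Longrightarrow> Ck_on k S (h i)"
        for I and h :: "'b \<Rightarrow> 'a \<Rightarrow> 'c"
        using that by (induction I rule: infinite_finite_induct) (auto intro: Ck_on_add S Ck_on_const)
      show "Ck_on k S (\<lambda>x. \<Sum>b\<in>Basis. (frechet_derivative f (at x) v \<bullet> b) *\<^sub>R frechet_derivative g (at (f x)) b)" for v
        using smooth_on_inner_left[OF S smooth_on_frechet[OF f]] Suc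
        by (intro sum sc Suc.IH smooth_on_frechet) (auto simp: smooth_on_def)
    qed
  qed
  then show ?thesis by (simp add: smooth_on_def)
qed

text \<open>With \<open>r\<close> for \<open>1 / sqrt f\<close>, the derivative is
  \<open>- 1/2 r^3 Df\<close>, a product of copies of \<open>r\<close> with a smooth function, so
  the induction closes on \<open>r\<close> itself. The lemma serves the normalisation in
  Gram-Schmidt.\<close>

lemma smooth_on_rsqrt:
  fixes f :: "'a::euclidean_space \<Rightarrow> real"
  assumes S: "open S" and f: "smooth_on S f" and pos: "\<And>x. x \<in> S \<Longrightarrow> 0 < f x"
  shows "smooth_on S (\<lambda>x. 1 / sqrt (f x))"
proof -
  have "Ck_on k S (\<lambda>x. 1 / sqrt (f x))" for k
  proof (induction k)
    case 0
    have "sqrt (f x) \<noteq> 0" if "x \<in> S" for x using pos[OF that] by simp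
    then show ?case using smooth_on_imp_continuous_on[OF f]
      by (auto intro!: continuous_intros)
  next
    case (Suc k)
    show ?case
    proof (rule Ck_on_SucI[OF S])
      show "((\<lambda>x. 1 / sqrt (f x)) has_derivative (\<lambda>v. (- 1 / 2) * ((1 / sqrt (f x)) *
          ((1 / sqrt (f x)) * ((1 / sqrt (f x)) * frechet_derivative f (at x) v))))) (at x)"
        if "x \<in> S" for x
        using pos[OF that]
        by (auto intro!: derivative_eq_intros smooth_on_has_derivative[OF f that] simp: field_simps)
      have m: "Ck_on k S (\<lambda>x. a x * h x)" if "Ck_on k S a" "Ck_on k S h" for a h :: "'a \<Rightarrow> real"
        by (rule Ck_on_bilinear[OF S bounded_bilinear_mult that])
      show "Ck_on k S (\<lambda>x. (- 1 / 2) * ((1 / sqrt (f x)) *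
          ((1 / sqrt (f x)) * ((1 / sqrt (f x)) * frechet_derivative f (at x) v))))" for v
        using Suc smooth_on_frechet[OF f, of v]
        by (intro m Ck_on_const) (auto simp: smooth_on_def)
    qed
  qed
  then show ?thesis by (simp add: smooth_on_def)
qed

text \<open>Two applications of the mean value theorem to the second difference, whose value does not
  depend on the order of the two increments.\<close>

lemma second_derivative_difference_quotient:
  fixes F :: "'a::euclidean_space \<Rightarrow> real"
  assumes S: "open S" and F: "smooth_on S F" and x: "x \<in> S"
  defines "D \<equiv> \<lambda>v u y. frechet_derivative (\<lambda>z. frechet_derivative F (at z) u) (at y) v"
  shows "((\<lambda>t. (F (x + t *\<^sub>R u + t *\<^sub>R v) - F (x + t *\<^sub>R u) - F (x + t *\<^sub>R v) + F x) / t\<^sup>2)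
           \<longlongrightarrow> D v u x) (at_right 0)"
proof (rule tendstoI)
  fix e :: real assume e: "0 < e"
  have "continuous_on S (D v u)"
    unfolding D_def by (intro smooth_on_imp_continuous_on smooth_on_frechet F)
  then have "isCont (D v u) x" using S x continuous_on_eq_continuous_at by blast
  then obtain d0 where d0: "0 < d0" "\<And>y. dist y x < d0 \<Longrightarrow> dist (D v u y) (D v u x) < e"
    using e unfolding continuous_at_eps_delta by blast
  obtain d1 where d1: "0 < d1" "ball x d1 \<subseteq> S" using S x openE by blast
  \<comment> \<open>For \<open>a\<close> and \<open>b\<close> in \<open>[0, d)\<close> the point
    \<open>x + a *\<^sub>R u + b *\<^sub>R v\<close> stays within \<open>min d0 d1\<close> of
    \<open>x\<close>, hence inside \<open>S\<close> and where \<open>D v u\<close> differs from its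
    value at \<open>x\<close> by less than \<open>e\<close>. The summand 1 excludes a zero
    denominator.\<close>
  define d where "d = min d0 d1 / (norm u + norm v + 1)"
  have npos: "0 < norm u + norm v + 1" by (smt (verit) norm_ge_zero)
  have d: "0 < d" using d0(1) d1(1) npos by (simp add: d_def)
  have small: "dist (x + a *\<^sub>R u + b *\<^sub>R v) x < min d0 d1"
    if ab: "0 \<le> a" "a < d" "0 \<le> b" "b < d" for a b
  proof -
    have "dist (x + a *\<^sub>R u + b *\<^sub>R v) x \<le> a * norm u + b * norm v"
      using norm_triangle_ineq[of "a *\<^sub>R u" "b *\<^sub>R v"] ab by (simp add: dist_norm add.assoc)
    also have "\<dots> \<le> d * norm u + d * norm v"
      using ab by (intro add_mono mult_right_mono) auto
    also have "\<dots> < d * (norm u + norm v + 1)" using d by (simp add: algebra_simps)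
    also have "\<dots> = min d0 d1" using npos by (simp add: d_def)
    finally show ?thesis .
  qed
  then have inS: "x + a *\<^sub>R u + b *\<^sub>R v \<in> S"
    if "0 \<le> a" "a < d" "0 \<le> b" "b < d" for a b
    using that d1(2) by (auto simp: dist_commute intro!: subsetD[OF d1(2)])
  have "dist ((F (x + t *\<^sub>R u + t *\<^sub>R v) - F (x + t *\<^sub>R u) - F (x + t *\<^sub>R v) + F x) / t\<^sup>2) (D v u x) < e"
    if t: "0 < t" "t < d" for t
  proof -
    let ?G = "\<lambda>s. F (x + s *\<^sub>R u + t *\<^sub>R v) - F (x + s *\<^sub>R u + 0 *\<^sub>R v)"
    let ?g = "\<lambda>s b. frechet_derivative F (at (x + s *\<^sub>R u + b *\<^sub>R v)) u"
    have line: "((\<lambda>s. F (x + s *\<^sub>R u + b *\<^sub>R v)) has_real_derivative ?g s b) (at s)"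
      if "0 \<le> s" "s \<le> t" "0 \<le> b" "b \<le> t" for s b
    proof -
      have lin: "linear (frechet_derivative F (at (x + s *\<^sub>R u + b *\<^sub>R v)))"
        using inS[of s b] that t by (intro linear_frechet_derivative smooth_on_differentiable[OF F]) auto
      have "((\<lambda>s. F (x + s *\<^sub>R u + b *\<^sub>R v)) has_derivative
          (\<lambda>h. frechet_derivative F (at (x + s *\<^sub>R u + b *\<^sub>R v)) (h *\<^sub>R u))) (at s)"
        using inS[of s b] that t
        by (intro has_derivative_compose[of "\<lambda>s. x + s *\<^sub>R u + b *\<^sub>R v", OF _ smooth_on_has_derivative[OF F]])
          (auto intro!: derivative_eq_intros)
      then show ?thesis using lin
        by (simp add: has_field_derivative_def linear_scale mult_commute_abs)
    qed
    \<comment> \<open>Mean value step along \<open>u\<close>, applied to the difference of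
      \<open>F\<close> between the offsets \<open>t\<close> and 0 in direction \<open>v\<close>; the
      second step below moves along \<open>v\<close>.\<close>
    have "\<exists>s. 0 < s \<and> s < t \<and> ?G t - ?G 0 = (t - 0) * (?g s t - ?g s 0)"
      using t by (intro MVT2 DERIV_diff line) auto
    then obtain s where s: "0 < s" "s < t" "?G t - ?G 0 = t * (?g s t - ?g s 0)" by auto
    have dline: "(?g s has_real_derivative D v u (x + s *\<^sub>R u + b *\<^sub>R v)) (at b)" if "0 \<le> b" "b \<le> t" for b
    proof -
      have sm: "smooth_on S (\<lambda>z. frechet_derivative F (at z) u)" by (rule smooth_on_frechet[OF F])
      have lin: "linear (frechet_derivative (\<lambda>z. frechet_derivative F (at z) u) (at (x + s *\<^sub>R u + b *\<^sub>R v)))"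
        using inS[of s b] that t s by (intro linear_frechet_derivative smooth_on_differentiable[OF sm]) auto
      have "(?g s has_derivative
          (\<lambda>h. frechet_derivative (\<lambda>z. frechet_derivative F (at z) u) (at (x + s *\<^sub>R u + b *\<^sub>R v)) (h *\<^sub>R v))) (at b)"
        using inS[of s b] that t s
        by (intro has_derivative_compose[of "\<lambda>b. x + s *\<^sub>R u + b *\<^sub>R v", OF _ smooth_on_has_derivative[OF sm]])
          (auto intro!: derivative_eq_intros)
      then show ?thesis using lin
        by (simp add: has_field_derivative_def linear_scale mult_commute_abs D_def)
    qed
    have "\<exists>b. 0 < b \<and> b < t \<and> ?g s t - ?g s 0 = (t - 0) * D v u (x + s *\<^sub>R u + b *\<^sub>R v)"
      using t by (intro MVT2 dline) auto
    then obtain b where b: "0 < b" "b < t" "?g s t - ?g s 0 = t * D v u (x + s *\<^sub>R u + b *\<^sub>R v)" by auto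
    have "F (x + t *\<^sub>R u + t *\<^sub>R v) - F (x + t *\<^sub>R u) - F (x + t *\<^sub>R v) + F x = t * (t * D v u (x + s *\<^sub>R u + b *\<^sub>R v))"
      using s(3) b(3) by simp
    then have "(F (x + t *\<^sub>R u + t *\<^sub>R v) - F (x + t *\<^sub>R u) - F (x + t *\<^sub>R v) + F x) / t\<^sup>2
        = D v u (x + s *\<^sub>R u + b *\<^sub>R v)"
      using t by (simp add: power2_eq_square)
    then show ?thesis
      using d0(2) small[of s b] s b t by auto
  qed
  then show "\<forall>\<^sub>F t in at_right 0. dist ((F (x + t *\<^sub>R u + t *\<^sub>R v) - F (x + t *\<^sub>R u) - F (x + t *\<^sub>R v) + F x) / t\<^sup>2) (D v u x) < e"
    using d by (auto simp: eventually_at_right_field)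
qed

section \<open>Second derivatives and their symmetry\<close>

definition hess :: "('a::euclidean_space \<Rightarrow> 'b::real_normed_vector) \<Rightarrow> 'a \<Rightarrow> 'a \<Rightarrow> 'a \<Rightarrow> 'b" where
  "hess F x u v = frechet_derivative (\<lambda>z. frechet_derivative F (at z) v) (at x) u"

lemma frechet_linear_comp:
  "bounded_linear L \<Longrightarrow> f differentiable (at x) \<Longrightarrow>
    frechet_derivative (\<lambda>z. L (f z)) (at x) v = L (frechet_derivative f (at x) v)"
  using frechet_derivative_at[OF bounded_linear.has_derivative] frechet_derivative_works by metis

text \<open>Swapping \<open>u\<close> and \<open>v\<close> leaves the second difference unchanged,
  so its two limits coincide. The mean value theorem behind those limits is one for real functions,
  hence the passage to the coordinates of \<open>F\<close>.\<close>

lemma hess_sym: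
  fixes F :: "'a::euclidean_space \<Rightarrow> 'b::euclidean_space"
  assumes S: "open S" and F: "smooth_on S F" and x: "x \<in> S"
  shows "hess F x u v = hess F x v u"
proof (rule euclidean_eqI)
  fix b :: 'b assume "b \<in> Basis"
  let ?f = "\<lambda>z. F z \<bullet> b"
  have f: "smooth_on S ?f" by (rule smooth_on_inner_left[OF S F])
  have real: "hess ?f x u v = hess ?f x v u"
  proof -
    note lims = second_derivative_difference_quotient[OF S f x]
    have "((\<lambda>t. (?f (x + t *\<^sub>R u + t *\<^sub>R v) - ?f (x + t *\<^sub>R u) - ?f (x + t *\<^sub>R v) + ?f x) / t\<^sup>2)
        \<longlongrightarrow> hess ?f x u v) (at_right 0)"
      using lims[of v u] unfolding hess_def by (simp add: algebra_simps)
    moreover note lims[of u v, folded hess_def]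
    ultimately show ?thesis using tendsto_unique[OF trivial_limit_at_right_real] by blast
  qed
  have "hess ?f x u v = hess F x u v \<bullet> b" for u v
  proof -
    have "frechet_derivative ?f (at z) v = frechet_derivative F (at z) v \<bullet> b" if "z \<in> S" for z
      using frechet_linear_comp[OF bounded_linear_inner_left smooth_on_differentiable[OF F that]] .
    then have "frechet_derivative (\<lambda>z. frechet_derivative ?f (at z) v) (at x)
      = frechet_derivative (\<lambda>z. frechet_derivative F (at z) v \<bullet> b) (at x)"
      by (intro frechet_derivative_transform_within_open[OF _ S x]
          smooth_on_differentiable[OF _ x] smooth_on_frechet f)
    then show ?thesis
      unfolding hess_def
      using frechet_linear_comp[OF bounded_linear_inner_left smooth_on_differentiable[OF smooth_on_frechet[OF F] x]]
      by simp
  qed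
  then show "hess F x u v \<bullet> b = hess F x v u \<bullet> b" using real by simp
qed

section \<open>Calculus on product spaces\<close>

lemma smooth_on_fst: "open S \<Longrightarrow> smooth_on S fst"
  using smooth_on_linear[OF _ bounded_linear_fst smooth_on_id] .

lemma smooth_on_snd: "open S \<Longrightarrow> smooth_on S snd"
  using smooth_on_linear[OF _ bounded_linear_snd smooth_on_id] .

lemma smooth_on_compose_fst:
  "open S \<Longrightarrow> open T \<Longrightarrow> smooth_on T g \<Longrightarrow> fst ` S \<subseteq> T \<Longrightarrow> smooth_on S (\<lambda>z. g (fst z))"
  using smooth_on_compose[OF _ _ smooth_on_fst] .

lemma smooth_on_compose_snd:
  "open S \<Longrightarrow> open T \<Longrightarrow> smooth_on T g \<Longrightarrow> snd ` S \<subseteq> T \<Longrightarrow> smooth_on S (\<lambda>z. g (snd z))"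
  using smooth_on_compose[OF _ _ smooth_on_snd] .

lemma frechet_derivative_Pair:
  assumes "f differentiable (at x)" "g differentiable (at x)"
  shows "frechet_derivative (\<lambda>z. (f z, g z)) (at x) v = (frechet_derivative f (at x) v, frechet_derivative g (at x) v)"
  using frechet_derivative_at[OF has_derivative_Pair[OF assms[unfolded frechet_derivative_works]]] by metis

lemma frechet_derivative_compose_fst:
  assumes "g differentiable (at (fst z))"
  shows "frechet_derivative (\<lambda>z. g (fst z)) (at z) v = frechet_derivative g (at (fst z)) (fst v)"
  using frechet_derivative_at[OF has_derivative_compose[OF has_derivative_fst[OF has_derivative_ident]
        assms[unfolded frechet_derivative_works]]] by metis

lemma frechet_derivative_compose_snd:
  assumes "g differentiable (at (snd z))"
  shows "frechet_derivative (\<lambda>z. g (snd z)) (at z) v = frechet_derivative g (at (snd z)) (snd v)"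
  using frechet_derivative_at[OF has_derivative_compose[OF has_derivative_snd[OF has_derivative_ident]
        assms[unfolded frechet_derivative_works]]] by metis

lemma frechet_derivative_cong_open:
  assumes "open S" "x \<in> S" "f differentiable (at x)" "\<And>z. z \<in> S \<Longrightarrow> f z = g z"
  shows "frechet_derivative f (at x) v = frechet_derivative g (at x) v"
  using frechet_derivative_transform_within_open[of f x S g] assms by simp

lemma frechet_derivative_zero: "f differentiable (at x) \<Longrightarrow> frechet_derivative f (at x) 0 = 0"
  by (simp add: linear_0 linear_frechet_derivative)

lemma hess_cong_open:
  assumes S: "open S" "x \<in> S" and F: "smooth_on S F" and eq: "\<And>z. z \<in> S \<Longrightarrow> F z = H z"
  shows "hess F x u v = hess H x u v"
  unfolding hess_def
proof (rule frechet_derivative_cong_open[OF S])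
  show "(\<lambda>z. frechet_derivative F (at z) v) differentiable at x"
    by (rule smooth_on_differentiable[OF smooth_on_frechet[OF F] S(2)])
  show "frechet_derivative F (at z) v = frechet_derivative H (at z) v" if "z \<in> S" for z
    by (rule frechet_derivative_cong_open[OF S(1) that smooth_on_differentiable[OF F that] eq])
qed

lemma hess_Pair:
  assumes S: "open S" "x \<in> S" and f: "smooth_on S f" and g: "smooth_on S g"
  shows "hess (\<lambda>z. (f z, g z)) x u v = (hess f x u v, hess g x u v)"
proof -
  note df = smooth_on_frechet[OF f, of v] and dg = smooth_on_frechet[OF g, of v]
  have "frechet_derivative (\<lambda>z. (frechet_derivative f (at z) v, frechet_derivative g (at z) v)) (at x) u =
      hess (\<lambda>z. (f z, g z)) x u v"
    unfolding hess_def
    by (rule frechet_derivative_cong_open[OF S smooth_on_differentiable[OF smooth_on_Pair[OF S(1) df dg] S(2)]])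
      (simp add: frechet_derivative_Pair smooth_on_differentiable[OF f] smooth_on_differentiable[OF g])
  then show ?thesis
    using S(2) by (simp add: frechet_derivative_Pair smooth_on_differentiable[OF df] smooth_on_differentiable[OF dg] hess_def)
qed

lemma hess_compose_snd:
  fixes z :: "'a::euclidean_space \<times> 'b::euclidean_space"
  assumes T: "open T" "snd z \<in> T" and g: "smooth_on T g"
  shows "hess (\<lambda>z. g (snd z)) z u v = hess g (snd z) (snd u) (snd v)"
proof -
  let ?S = "UNIV \<times> T :: ('a \<times> 'b) set"
  have S: "open ?S" "z \<in> ?S" using T by (auto intro: open_Times simp: mem_Times_iff)
  note dg = smooth_on_frechet[OF g, of "snd v"]
  have "smooth_on ?S (\<lambda>z. frechet_derivative g (at (snd z)) (snd v))"
    by (rule smooth_on_compose_snd[OF S(1) T(1) dg]) auto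
  from smooth_on_differentiable[OF this S(2)]
  have "frechet_derivative (\<lambda>z. frechet_derivative g (at (snd z)) (snd v)) (at z) u = hess (\<lambda>z. g (snd z)) z u v"
    unfolding hess_def
    by (rule frechet_derivative_cong_open[OF S])
      (auto simp: frechet_derivative_compose_snd smooth_on_differentiable[OF g])
  then show ?thesis
    using frechet_derivative_compose_snd[OF smooth_on_differentiable[OF dg T(2)]] by (simp add: hess_def)
qed

text \<open>The expansion of \<open>a y\<close> in \<open>Basis\<close> turns the evaluation into a
  finite sum of scalar multiples, each covered by the ordinary product rule.\<close>

lemma has_derivative_linear_family:
  fixes A :: "'a::euclidean_space \<Rightarrow> 'b::euclidean_space \<Rightarrow> 'c::real_normed_vector"
  assumes S: "open S" "x \<in> S" and lin: "\<And>y. y \<in> S \<Longrightarrow> linear (A y)"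
    and A: "\<And>v. ((\<lambda>y. A y v) has_derivative A' v) (at x)"
    and a: "(a has_derivative a') (at x)"
  shows "((\<lambda>y. A y (a y)) has_derivative (\<lambda>h. A' (a x) h + A x (a' h))) (at x)"
proof -
  have expand: "f w = (\<Sum>b\<in>Basis. (w \<bullet> b) *\<^sub>R f b)" if "linear f" for f :: "'b \<Rightarrow> 'c" and w
    by (subst (1) euclidean_representation[symmetric, of w]) (simp only: linear_sum[OF that] linear_scale[OF that])
  \<comment> \<open>Linearity of \<open>A' v h\<close> in \<open>v\<close> is inherited from that of
    \<open>A y\<close> near \<open>x\<close>, through uniqueness of derivatives.\<close>
  have A'_lin: "linear (\<lambda>v. A' v h)" for h
  proof (rule linearI)
    fix v w :: 'b and r :: real
    have "((\<lambda>y. A y (v + w)) has_derivative (\<lambda>h. A' v h + A' w h)) (at x)"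
      by (rule has_derivative_transform_within_open[OF has_derivative_add[OF A A] S])
        (simp add: linear_add[OF lin])
    then show "A' (v + w) h = A' v h + A' w h"
      using has_derivative_unique[OF A] by metis
    have "((\<lambda>y. A y (r *\<^sub>R v)) has_derivative (\<lambda>h. r *\<^sub>R A' v h)) (at x)"
      by (rule has_derivative_transform_within_open[OF has_derivative_scaleR_right[OF A] S])
        (simp add: linear_scale[OF lin])
    then show "A' (r *\<^sub>R v) h = r *\<^sub>R A' v h"
      using has_derivative_unique[OF A] by metis
  qed
  have "((\<lambda>y. \<Sum>b\<in>Basis. (a y \<bullet> b) *\<^sub>R A y b) has_derivative
      (\<lambda>h. \<Sum>b\<in>Basis. (a x \<bullet> b) *\<^sub>R A' b h + (a' h \<bullet> b) *\<^sub>R A x b)) (at x)"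
    by (rule has_derivative_sum, rule has_derivative_scaleR[OF has_derivative_inner_left[OF a] A])
  moreover have "(\<Sum>b\<in>Basis. (a x \<bullet> b) *\<^sub>R A' b h + (a' h \<bullet> b) *\<^sub>R A x b) = A' (a x) h + A x (a' h)" for h
    using expand[OF A'_lin, of "a x" h] expand[OF lin[OF S(2)], of "a' h"] by (simp add: sum.distrib)
  ultimately have "((\<lambda>y. \<Sum>b\<in>Basis. (a y \<bullet> b) *\<^sub>R A y b) has_derivative
      (\<lambda>h. A' (a x) h + A x (a' h))) (at x)" by simp
  then show ?thesis
    by (rule has_derivative_transform_within_open[OF _ S]) (simp only: expand[OF lin, symmetric])
qed

text \<open>The \<open>hess\<close> term comes from the moving base point, the other from the moving
  vector. Both the change of chart for \<open>levi_civita\<close> and the coordinate form of the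
  second fundamental form rest on this rule.\<close>

lemma smooth_frechet_field_derivative:
  fixes F :: "'a::euclidean_space \<Rightarrow> 'b::euclidean_space"
  assumes S: "open S" "x \<in> S" and F: "smooth_on S F" and a: "(a has_derivative a') (at x)"
  shows "((\<lambda>z. frechet_derivative F (at z) (a z)) has_derivative
    (\<lambda>h. hess F x h (a x) + frechet_derivative F (at x) (a' h))) (at x)"
proof (rule has_derivative_linear_family[OF S _ _ a])
  show "linear (frechet_derivative F (at y))" if "y \<in> S" for y
    by (rule linear_frechet_derivative[OF smooth_on_differentiable[OF F that]])
  show "((\<lambda>y. frechet_derivative F (at y) v) has_derivative (\<lambda>h. hess F x h v)) (at x)" for v
    unfolding hess_def by (rule smooth_on_has_derivative[OF smooth_on_frechet[OF F] S(2)])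
qed

text \<open>Linearity in the first slot is that of a derivative; the second slot follows by
  symmetry.\<close>

lemma bilinear_hess:
  fixes F :: "'a::euclidean_space \<Rightarrow> 'b::euclidean_space"
  assumes S: "open S" "x \<in> S" and F: "smooth_on S F"
  shows "bilinear (hess F x)"
proof -
  have lin: "linear (\<lambda>u. hess F x u v)" for v
    unfolding hess_def
    by (rule linear_frechet_derivative[OF smooth_on_differentiable[OF smooth_on_frechet[OF F] S(2)]])
  have "hess F x u = (\<lambda>v. hess F x v u)" for u
    using hess_sym[OF S(1) F S(2)] by blast
  then show ?thesis unfolding bilinear_def using lin by metis
qed

section \<open>Orthonormal bases\<close>

definition inner_form :: "('e::euclidean_space \<Rightarrow> 'e \<Rightarrow> real) \<Rightarrow> bool" where
  "inner_form g \<longleftrightarrow> bilinear g \<and> (\<forall>u v. g u v = g v u) \<and> (\<forall>u. u \<noteq> 0 \<longrightarrow> 0 < g u u)"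

definition orthonormal_basis :: "('e::euclidean_space \<Rightarrow> 'e \<Rightarrow> real) \<Rightarrow> ('e \<Rightarrow> 'e) \<Rightarrow> bool" where
  "orthonormal_basis g E \<longleftrightarrow> (\<forall>b\<in>Basis. \<forall>b'\<in>Basis. g (E b) (E b') = (if b = b' then 1 else 0))"

lemma inner_formD:
  assumes "inner_form g"
  shows "bilinear g" "g u v = g v u" "u \<noteq> 0 \<Longrightarrow> 0 < g u u"
  using assms unfolding inner_form_def by blast+

lemma bilinear_sum_left: "bilinear h \<Longrightarrow> h (\<Sum>i\<in>I. f i) v = (\<Sum>i\<in>I. h (f i) v)"
  using linear_sum[of "\<lambda>x. h x v" f I] by (simp add: bilinear_def)

lemma bilinear_sum_right: "bilinear h \<Longrightarrow> h u (\<Sum>i\<in>I. f i) = (\<Sum>i\<in>I. h u (f i))"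
  by (simp add: bilinear_def linear_sum)

lemma inner_form_eqI:
  assumes "inner_form g" "\<And>z. g v z = g w z"
  shows "v = w"
proof -
  have "g (v - w) (v - w) = 0"
    using assms inner_formD(1)[OF assms(1)] by (simp add: bilinear_lsub)
  then show ?thesis using inner_formD(3)[OF assms(1), of "v - w"] by fastforce
qed

text \<open>Orthonormality recovers the coefficients of a combination (\<open>comb\<close>), which
  gives independence; a dimension count then makes the vectors span.\<close>

lemma orthonormal_basis_expand:
  assumes g: "inner_form g" and E: "orthonormal_basis g E"
  shows "(\<Sum>b\<in>Basis. g v (E b) *\<^sub>R E b) = v"
proof -
  note bil = inner_formD(1)[OF g]
  have comb: "g (\<Sum>b\<in>Basis. c b *\<^sub>R E b) (E b') = c b'" if "b' \<in> Basis" for c b'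
  proof -
    have "g (\<Sum>b\<in>Basis. c b *\<^sub>R E b) (E b') = (\<Sum>b\<in>Basis. if b = b' then c b else 0)"
      unfolding bilinear_sum_left[OF bil] bilinear_lmul[OF bil]
      using E that by (intro sum.cong) (auto simp: orthonormal_basis_def)
    then show ?thesis using that by simp
  qed
  \<comment> \<open>The dimension count needs as many vectors as indices, so the indexed family must
    have no repetitions.\<close>
  have inj: "inj_on E Basis"
  proof (rule inj_onI)
    fix b b' assume b: "b \<in> Basis" "b' \<in> Basis" "E b = E b'"
    have "g (E b) (E b) = 1" "g (E b) (E b') = (if b = b' then 1 else 0)"
      using b(1,2) E unfolding orthonormal_basis_def by auto
    then show "b = b'" using b(3) by (simp split: if_splits)
  qed
  have "independent (E ` Basis)"
  proof (rule independent_if_scalars_zero)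
    fix f x assume *: "(\<Sum>x\<in>E ` Basis. f x *\<^sub>R x) = 0" "x \<in> E ` Basis"
    then obtain b where b: "b \<in> Basis" "x = E b" by auto
    have "(\<Sum>b\<in>Basis. f (E b) *\<^sub>R E b) = 0" using *(1) by (simp add: sum.reindex[OF inj])
    then show "f x = 0" using comb[of b "\<lambda>b. f (E b)"] b bilinear_lzero[OF bil] by simp
  qed simp
  then have "UNIV \<subseteq> span (E ` Basis)"
    by (intro card_ge_dim_independent) (auto simp: card_image[OF inj])
  then have "v \<in> span (E ` Basis)" by auto
  then obtain c where "v = (\<Sum>x\<in>E ` Basis. c x *\<^sub>R x)" by (auto simp: span_finite)
  then have v: "v = (\<Sum>b\<in>Basis. c (E b) *\<^sub>R E b)" by (simp add: sum.reindex[OF inj])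
  have "g v (E b) = c (E b)" if "b \<in> Basis" for b
    by (subst v, rule comb[OF that])
  then show ?thesis by (subst (2) v) simp
qed

text \<open>The coefficients \<open>g (E b) (F c)\<close> form an orthogonal matrix. Expanding each
  \<open>E b\<close> in \<open>F\<close> gives a triple sum; \<open>delta\<close>, the orthogonality
  of the columns, sums out \<open>b\<close> and leaves the diagonal.\<close>

lemma trace_orthonormal_basis:
  assumes g: "inner_form g" and E: "orthonormal_basis g E" and F: "orthonormal_basis g F"
    and h: "bilinear h"
  shows "(\<Sum>b\<in>Basis. h (E b) (E b)) = (\<Sum>b\<in>Basis. h (F b) (F b))"
proof -
  note bil = inner_formD(1)[OF g]
  have delta: "(\<Sum>b\<in>Basis. g (E b) (F c) * g (E b) (F d)) = g (F c) (F d)" for c d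
  proof -
    have sy: "g (E b) (F c) = g (F c) (E b)" for b by (rule inner_formD(2)[OF g])
    have "g (F c) (F d) = g (\<Sum>b\<in>Basis. g (F c) (E b) *\<^sub>R E b) (F d)"
      by (simp only: orthonormal_basis_expand[OF g E])
    also have "\<dots> = (\<Sum>b\<in>Basis. g (F c) (E b) * g (E b) (F d))"
      by (simp add: bilinear_sum_left[OF bil] bilinear_lmul[OF bil])
    finally show ?thesis by (simp only: sy)
  qed
  have "(\<Sum>b\<in>Basis. h (E b) (E b)) =
      (\<Sum>b\<in>Basis. h (\<Sum>c\<in>Basis. g (E b) (F c) *\<^sub>R F c) (\<Sum>c\<in>Basis. g (E b) (F c) *\<^sub>R F c))"
    by (simp only: orthonormal_basis_expand[OF g F])
  also have "\<dots> = (\<Sum>b\<in>Basis. \<Sum>c\<in>Basis. \<Sum>d\<in>Basis. (g (E b) (F c) * g (E b) (F d)) *\<^sub>R h (F c) (F d))"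
    unfolding bilinear_sum_left[OF h] bilinear_lmul[OF h]
    unfolding bilinear_sum_right[OF h] bilinear_rmul[OF h] scaleR_sum_right scaleR_scaleR ..
  also have "\<dots> = (\<Sum>c\<in>Basis. \<Sum>d\<in>Basis. \<Sum>b\<in>Basis. (g (E b) (F c) * g (E b) (F d)) *\<^sub>R h (F c) (F d))"
    by (subst sum.swap, rule sum.cong[OF refl], rule sum.swap)
  also have "\<dots> = (\<Sum>c\<in>Basis. \<Sum>d\<in>Basis. g (F c) (F d) *\<^sub>R h (F c) (F d))"
    by (simp only: scaleR_sum_left[symmetric] delta)
  also have "\<dots> = (\<Sum>c\<in>Basis. \<Sum>d\<in>Basis. if c = d then h (F c) (F d) else 0)"
    using F by (intro sum.cong) (auto simp: orthonormal_basis_def)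
  finally show ?thesis by simp
qed

text \<open>Gram-Schmidt on the standard basis, carried out at all \<open>z\<close> simultaneously
  so that smoothness is preserved. The invariant \<open>E b z \<in> span B\<close> is part of the
  induction because it keeps the next remainder away from zero.\<close>

lemma smooth_gram_schmidt:
  fixes G :: "'a::euclidean_space \<Rightarrow> 'e::euclidean_space \<Rightarrow> 'e \<Rightarrow> real"
  assumes S: "open S" and G: "\<And>z. z \<in> S \<Longrightarrow> inner_form (G z)"
    and sm: "\<And>u v. smooth_on S (\<lambda>z. G z u v)"
  obtains E where "\<And>b. b \<in> Basis \<Longrightarrow> smooth_on S (E b)"
    and "\<And>z. z \<in> S \<Longrightarrow> orthonormal_basis (G z) (\<lambda>b. E b z)"
proof -
  have bil: "bilinear (G z)" if "z \<in> S" for z using inner_formD(1)[OF G[OF that]] .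
  have "\<exists>E. \<forall>b\<in>B. smooth_on S (E b) \<and> (\<forall>z\<in>S. E b z \<in> span B \<and>
      (\<forall>b'\<in>B. G z (E b z) (E b' z) = (if b = b' then 1 else 0)))" if "finite B" "B \<subseteq> Basis" for B :: "'e set"
    using that
  proof (induction B)
    case (insert a B)
    then have "\<exists>E. \<forall>b\<in>B. smooth_on S (E b) \<and> (\<forall>z\<in>S. E b z \<in> span B \<and>
        (\<forall>b'\<in>B. G z (E b z) (E b' z) = (if b = b' then 1 else 0)))" by simp
    then obtain E where "\<forall>b\<in>B. smooth_on S (E b) \<and> (\<forall>z\<in>S. E b z \<in> span B \<and>
        (\<forall>b'\<in>B. G z (E b z) (E b' z) = (if b = b' then 1 else 0)))" ..
    then have E: "\<And>b. b \<in> B \<Longrightarrow> smooth_on S (E b)"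
      "\<And>b z. b \<in> B \<Longrightarrow> z \<in> S \<Longrightarrow> E b z \<in> span B"
      "\<And>b b' z. b \<in> B \<Longrightarrow> b' \<in> B \<Longrightarrow> z \<in> S \<Longrightarrow> G z (E b z) (E b' z) = (if b = b' then 1 else 0)"
      by blast+
    \<comment> \<open>Remainder of \<open>a\<close> after projection to the vectors built so far; it
      could vanish only if \<open>a\<close> lay in \<open>span B\<close>, which independence of
      \<open>Basis\<close> excludes.\<close>
    define w where "w z = a - (\<Sum>b\<in>B. G z a (E b z) *\<^sub>R E b z)" for z
    define n where "n z = G z (w z) (w z)" for z
    have sw: "smooth_on S w"
      unfolding w_def
      by (intro smooth_on_diff smooth_on_sum smooth_on_scaleR smooth_on_const S E(1)
          smooth_on_bilinear_family[OF S bil sm])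
    have sn: "smooth_on S n"
      unfolding n_def by (intro smooth_on_bilinear_family[OF S bil sm] sw)
    have w_orth: "G z (w z) (E b z) = 0" if "z \<in> S" "b \<in> B" for z b
    proof -
      have "(\<Sum>c\<in>B. G z a (E c z) * G z (E c z) (E b z)) = (\<Sum>c\<in>B. if c = b then G z a (E c z) else 0)"
        using that E(3) by (intro sum.cong) auto
      then show ?thesis
        using that insert.hyps(1) unfolding w_def
        by (simp add: bilinear_lsub[OF bil] bilinear_sum_left[OF bil] bilinear_lmul[OF bil])
    qed
    have w_span: "w z \<in> span (insert a B)" if "z \<in> S" for z
      unfolding w_def using E(2)[OF _ that]
      by (intro span_diff span_sum span_scale span_base[of a])
        (auto intro: span_mono[THEN subsetD, of B "insert a B"])
    have w_nz: "w z \<noteq> 0" if "z \<in> S" for z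
    proof
      assume "w z = 0"
      then have "a = (\<Sum>b\<in>B. G z a (E b z) *\<^sub>R E b z)" by (simp add: w_def)
      also have "\<dots> \<in> span B" by (intro span_sum span_scale E(2) that)
      finally have "a \<in> span B" .
      moreover have "independent (insert a B)"
        using insert.prems independent_mono independent_Basis by blast
      ultimately show False using insert.hyps(2) by (simp add: independent_insert)
    qed
    have n_pos: "0 < n z" if "z \<in> S" for z
      unfolding n_def using inner_formD(3)[OF G[OF that] w_nz[OF that]] .
    let ?F = "E(a := \<lambda>z. (1 / sqrt (n z)) *\<^sub>R w z)"
    have sa: "smooth_on S (\<lambda>z. (1 / sqrt (n z)) *\<^sub>R w z)"
      using n_pos by (intro smooth_on_scaleR S smooth_on_rsqrt sn sw) auto
    have "G z (?F b z) (?F b' z) = (if b = b' then 1 else 0)"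
      if z: "z \<in> S" and b: "b \<in> insert a B" "b' \<in> insert a B" for z b b'
    proof -
      have aa: "G z ((1 / sqrt (n z)) *\<^sub>R w z) ((1 / sqrt (n z)) *\<^sub>R w z) = 1"
        using n_pos[OF z]
        by (simp add: bilinear_lmul[OF bil[OF z]] bilinear_rmul[OF bil[OF z]] n_def[symmetric])
      have ab: "G z ((1 / sqrt (n z)) *\<^sub>R w z) (E b z) = 0" if "b \<in> B" for b
        using w_orth[OF z that] by (simp add: bilinear_lmul[OF bil[OF z]])
      have ba: "G z (E b z) ((1 / sqrt (n z)) *\<^sub>R w z) = 0" if "b \<in> B" for b
        using ab[OF that] inner_formD(2)[OF G[OF z]] by metis
      show ?thesis using aa ab ba E(3)[OF _ _ z] b insert.hyps(2) by auto
    qed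
    moreover have "?F b z \<in> span (insert a B)" if "b \<in> insert a B" "z \<in> S" for b z
      using w_span[OF that(2)] E(2)[OF _ that(2)] that(1) span_mono[of B "insert a B"]
      by (auto intro: span_scale)
    moreover have "smooth_on S (?F b)" if "b \<in> insert a B" for b
      using that sa E(1) by auto
    ultimately show ?case by blast
  qed simp
  from this[OF finite_Basis order_refl] obtain E :: "'e \<Rightarrow> 'a \<Rightarrow> 'e" where
      "\<forall>b\<in>Basis. smooth_on S (E b) \<and>
      (\<forall>z\<in>S. E b z \<in> span Basis \<and>
        (\<forall>b'\<in>Basis. G z (E b z) (E b' z) = (if b = b' then 1 else 0)))" ..
  then show ?thesis by (intro that[of E]) (simp_all add: orthonormal_basis_def)
qed

section \<open>Charts\<close>

lemma smooth_manifoldD: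
  assumes "smooth_manifold P"
  shows chart_dom_cover: "\<exists>i. x \<in> chart_dom P i"
    and open_chart_dom: "open (chart_dom P i)"
    and open_chart_image: "open (chart_map P i ` chart_dom P i)"
    and homeomorphism_chart: "homeomorphism (chart_dom P i) (chart_map P i ` chart_dom P i)
            (chart_map P i) (chart_inv P i)"
    and smooth_transition: "smooth_on (chart_map P i ` (chart_dom P i \<inter> chart_dom P j))
              (chart_map P j \<circ> chart_inv P i)"
  using assms unfolding smooth_manifold_def by blast+

lemma chart_inv_chart_map:
  "smooth_manifold P \<Longrightarrow> x \<in> chart_dom P i \<Longrightarrow> chart_inv P i (chart_map P i x) = x"
  using homeomorphism_chart homeomorphism_apply1 by metis

lemma open_chart_map_image:
  assumes P: "smooth_manifold P" and W: "open W" "W \<subseteq> chart_dom P i"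
  shows "open (chart_map P i ` W)"
proof -
  have "openin (top_of_set (chart_dom P i)) W" by (rule open_subset[OF W(2,1)])
  then have "openin (top_of_set (chart_map P i ` chart_dom P i)) (chart_map P i ` W)"
    using homeomorphism_imp_open_map[OF homeomorphism_chart[OF P]] by blast
  then show ?thesis using open_chart_image[OF P] openin_open_trans by blast
qed

lemma open_chart_overlap:
  "smooth_manifold P \<Longrightarrow> open (chart_map P i ` (chart_dom P i \<inter> chart_dom P j))"
  by (intro open_chart_map_image open_Int open_chart_dom) auto

lemma transition_has_derivative:
  assumes P: "smooth_manifold P" and x: "x \<in> chart_dom P i" "x \<in> chart_dom P j"
  shows "(chart_map P j \<circ> chart_inv P i has_derivative transition_deriv P i j x) (at (chart_map P i x))"
  unfolding transition_deriv_def
  by (rule smooth_on_has_derivative[OF smooth_transition[OF P]]) (use x in auto)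

lemma linear_transition_deriv:
  "smooth_manifold P \<Longrightarrow> x \<in> chart_dom P i \<Longrightarrow> x \<in> chart_dom P j \<Longrightarrow> linear (transition_deriv P i j x)"
  by (rule has_derivative_linear[OF transition_has_derivative])

text \<open>Chain rule with the transition map. Composing \<open>F \<circ> chart_inv P j\<close>
  with it agrees with \<open>F \<circ> chart_inv P i\<close> only over the chart overlap, so the
  derivative is transferred on the open image of the overlap.\<close>

lemma has_derivative_change_chart:
  assumes P: "smooth_manifold P" and x: "x \<in> chart_dom P i" "x \<in> chart_dom P j"
    and F: "(F \<circ> chart_inv P j has_derivative D) (at (chart_map P j x))"
  shows "(F \<circ> chart_inv P i has_derivative (\<lambda>u. D (transition_deriv P i j x u))) (at (chart_map P i x))"
proof -
  let ?T = "chart_map P j \<circ> chart_inv P i"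
  have Tx: "?T (chart_map P i x) = chart_map P j x" using chart_inv_chart_map[OF P x(1)] by simp
  have "((\<lambda>z. (F \<circ> chart_inv P j) (?T z)) has_derivative (\<lambda>u. D (transition_deriv P i j x u))) (at (chart_map P i x))"
    by (rule has_derivative_compose[OF transition_has_derivative[OF P x]]) (simp only: Tx F)
  then show ?thesis
    by (rule has_derivative_transform_within_open[OF _ open_chart_overlap[OF P, of i j]])
       (use x in \<open>auto simp: chart_inv_chart_map[OF P]\<close>)
qed

lemma transition_deriv_same:
  assumes P: "smooth_manifold P" and x: "x \<in> chart_dom P i"
  shows "transition_deriv P i i x u = u"
proof -
  have "(chart_map P i \<circ> chart_inv P i has_derivative (\<lambda>u. u)) (at (chart_map P i x))"
    by (rule has_derivative_transform_within_open[OF has_derivative_ident open_chart_image[OF P, of i]])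
       (use x in \<open>auto simp: chart_inv_chart_map[OF P]\<close>)
  then show ?thesis using has_derivative_unique[OF transition_has_derivative[OF P x x]] by metis
qed

lemma transition_deriv_trans:
  assumes P: "smooth_manifold P" and x: "x \<in> chart_dom P i" "x \<in> chart_dom P j" "x \<in> chart_dom P k"
  shows "transition_deriv P j k x (transition_deriv P i j x u) = transition_deriv P i k x u"
  using has_derivative_unique[OF has_derivative_change_chart[OF P x(1,2) transition_has_derivative[OF P x(2,3)]]
      transition_has_derivative[OF P x(1,3)]] by metis

lemma tangent_vectorD:
  "tangent_vector P x v \<Longrightarrow> x \<in> chart_dom P i \<Longrightarrow> x \<in> chart_dom P j \<Longrightarrow> v j = transition_deriv P i j x (v i)"
  unfolding tangent_vector_def by blast

text \<open>The chart hidden in the \<open>SOME\<close> of \<open>dir_deriv\<close> is exchanged for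
  a given one: the differential of \<open>F\<close> and the coordinates of \<open>v\<close> change
  by the same transition differential. Tangency of directions is tracked throughout for the sake of
  this exchange.\<close>

lemma dir_deriv_eq_chart_deriv:
  assumes P: "smooth_manifold P" and x: "x \<in> chart_dom P i" and v: "tangent_vector P x v"
    and F: "F \<circ> chart_inv P i differentiable (at (chart_map P i x))"
  shows "dir_deriv P F x v = chart_deriv P i F x (v i)"
proof -
  define j where "j = (SOME i. x \<in> chart_dom P i)"
  have j: "x \<in> chart_dom P j" unfolding j_def using x by (rule someI)
  have "chart_deriv P j F x (v j) = chart_deriv P i F x (v i)"
    using frechet_derivative_at[OF has_derivative_change_chart[OF P j x F[unfolded frechet_derivative_works]]]
      tangent_vectorD[OF v j x] unfolding chart_deriv_def by metis
  then show ?thesis unfolding dir_deriv_def j_def[symmetric] by (simp add: Let_def)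
qed

section \<open>Orthonormal frames\<close>

lemma riemannian_manifoldD:
  assumes "riemannian_manifold P"
  shows riemannian_smooth_manifold: "smooth_manifold P"
    and metric_inner_form: "x \<in> chart_dom P i \<Longrightarrow> inner_form (metric P i x)"
    and metric_transition: "x \<in> chart_dom P i \<Longrightarrow> x \<in> chart_dom P j \<Longrightarrow>
      metric P j x (transition_deriv P i j x u) (transition_deriv P i j x v) = metric P i x u v"
    and smooth_metric: "smooth_on (chart_map P i ` chart_dom P i) (\<lambda>z. metric P i (chart_inv P i z) u v)"
  using assms unfolding riemannian_manifold_def inner_form_def by blast+

lemma smooth_orthonormal_basis:
  assumes P: "riemannian_manifold P"
  obtains E where "\<And>b. b \<in> Basis \<Longrightarrow> smooth_on (chart_map P i ` chart_dom P i) (E b)"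
    and "\<And>x. x \<in> chart_dom P i \<Longrightarrow> orthonormal_basis (metric P i x) (\<lambda>b. E b (chart_map P i x))"
proof -
  note sm = riemannian_smooth_manifold[OF P]
  have inn: "inner_form (metric P i (chart_inv P i z))" if "z \<in> chart_map P i ` chart_dom P i" for z
    using that metric_inner_form[OF P] by (auto simp: chart_inv_chart_map[OF sm])
  obtain E where E: "\<And>b. b \<in> Basis \<Longrightarrow> smooth_on (chart_map P i ` chart_dom P i) (E b)"
    "\<And>z. z \<in> chart_map P i ` chart_dom P i \<Longrightarrow> orthonormal_basis (metric P i (chart_inv P i z)) (\<lambda>b. E b z)"
    by (rule smooth_gram_schmidt[OF open_chart_image[OF sm, of i], where G = "\<lambda>z. metric P i (chart_inv P i z)"])
      (use inn smooth_metric[OF P] in blast)+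
  have "orthonormal_basis (metric P i x) (\<lambda>b. E b (chart_map P i x))" if "x \<in> chart_dom P i" for x
    using E(2)[of "chart_map P i x"] that by (simp add: chart_inv_chart_map[OF sm])
  then show ?thesis using that E(1) by blast
qed

text \<open>A smooth orthonormal basis in one chart \<open>c\<close> around \<open>x\<close> becomes
  a frame on all of \<open>chart_dom P c\<close> once it is carried to the other charts.\<close>

lemma local_orthonormal_frame_exists:
  assumes P: "riemannian_manifold P"
  shows "\<exists>\<epsilon> U. x \<in> U \<and> local_orthonormal_frame P U \<epsilon>"
proof -
  note sm = riemannian_smooth_manifold[OF P]
  obtain c where c: "x \<in> chart_dom P c" using chart_dom_cover[OF sm] by blast
  obtain E where E: "\<And>b. b \<in> Basis \<Longrightarrow> smooth_on (chart_map P c ` chart_dom P c) (E b)"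
    "\<And>y. y \<in> chart_dom P c \<Longrightarrow> orthonormal_basis (metric P c y) (\<lambda>b. E b (chart_map P c y))"
    by (rule smooth_orthonormal_basis[OF P]) blast
  \<comment> \<open>The cocycle rule for transition differentials makes this tangent, and invariance
    of the metric makes it orthonormal in every chart.\<close>
  define \<epsilon> where "\<epsilon> b y k = transition_deriv P c k y (E b (chart_map P c y))" for b y k
  have "local_orthonormal_frame P (chart_dom P c) \<epsilon>"
    unfolding local_orthonormal_frame_def smooth_vector_field_def
  proof (intro conjI ballI allI impI)
    show "open (chart_dom P c)" by (rule open_chart_dom[OF sm])
    show "tangent_vector P y (\<epsilon> b y)" if "y \<in> chart_dom P c" for b y
      unfolding tangent_vector_def \<epsilon>_def using transition_deriv_trans[OF sm that] by auto
    show "metric P i y (\<epsilon> b y i) (\<epsilon> b' y i) = (if b = b' then 1 else 0)"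
      if "b \<in> Basis" "b' \<in> Basis" "y \<in> chart_dom P c" "y \<in> chart_dom P i" for b b' y i
      using E(2) that metric_transition[OF P that(3,4)] unfolding \<epsilon>_def orthonormal_basis_def by simp
    show "smooth_on (chart_map P i ` (chart_dom P c \<inter> chart_dom P i)) (\<lambda>z. \<epsilon> b (chart_inv P i z) i)"
      if b: "b \<in> Basis" for b i
    proof -
      let ?S = "chart_map P i ` (chart_dom P i \<inter> chart_dom P c)"
      let ?T = "chart_map P c ` (chart_dom P c \<inter> chart_dom P i)"
      have S: "open ?S" and T: "open ?T" by (rule open_chart_overlap[OF sm])+
      have sub: "?T \<subseteq> chart_map P c ` chart_dom P c" by auto
      \<comment> \<open>Smoothness in chart \<open>i\<close> is shown over chart \<open>c\<close>,
        where \<open>E b\<close> lives, and then pulled back along the transition from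
        \<open>i\<close> to \<open>c\<close>.\<close>
      have "smooth_on ?T (\<lambda>w. frechet_derivative (chart_map P i \<circ> chart_inv P c) (at w) (E b w))"
        by (rule smooth_on_frechet_field[OF T smooth_transition[OF sm] smooth_on_subset[OF E(1)[OF b] sub]])
      moreover have "(chart_map P c \<circ> chart_inv P i) ` ?S \<subseteq> ?T"
        by (auto simp: chart_inv_chart_map[OF sm])
      ultimately have "smooth_on ?S (\<lambda>z. frechet_derivative (chart_map P i \<circ> chart_inv P c)
          (at ((chart_map P c \<circ> chart_inv P i) z)) (E b ((chart_map P c \<circ> chart_inv P i) z)))"
        by (rule smooth_on_compose[OF S T smooth_transition[OF sm]])
      then show ?thesis unfolding \<epsilon>_def transition_deriv_def by (simp add: Int_commute)
    qed
  qed
  then show ?thesis using c by blast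
qed

lemma frame_at_frame:
  assumes P: "riemannian_manifold P"
  obtains U where "x \<in> U" "local_orthonormal_frame P U (frame_at P x)"
  using someI_ex[OF local_orthonormal_frame_exists[OF P, of x]] unfolding frame_at_def by blast

lemma local_orthonormal_frameD:
  assumes "local_orthonormal_frame P U \<epsilon>"
  shows "open U" "b \<in> Basis \<Longrightarrow> smooth_vector_field P U (\<epsilon> b)"
    "x \<in> U \<Longrightarrow> x \<in> chart_dom P i \<Longrightarrow> orthonormal_basis (metric P i x) (\<lambda>b. \<epsilon> b x i)"
  using assms unfolding local_orthonormal_frame_def orthonormal_basis_def by blast+

lemma smooth_vector_fieldD:
  assumes "smooth_vector_field P U X"
  shows "x \<in> U \<Longrightarrow> tangent_vector P x (X x)"
    "smooth_on (chart_map P i ` (U \<inter> chart_dom P i)) (\<lambda>z. X (chart_inv P i z) i)"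
  using assms unfolding smooth_vector_field_def by blast+

section \<open>Christoffel symbols\<close>

definition metric_deriv ::
  "('i, 'a, 'e::euclidean_space) rmanifold \<Rightarrow> 'i \<Rightarrow> 'a \<Rightarrow> 'e \<Rightarrow> 'e \<Rightarrow> 'e \<Rightarrow> real" where
  "metric_deriv P i x w u v = chart_deriv P i (\<lambda>y. metric P i y u v) x w"

text \<open>Right-hand side of the Koszul formula for \<open>2 g(\<nabla>\<^sub>u v, z)\<close> on constant coordinate fields.\<close>

definition koszul ::
  "('i, 'a, 'e::euclidean_space) rmanifold \<Rightarrow> 'i \<Rightarrow> 'a \<Rightarrow> 'e \<Rightarrow> 'e \<Rightarrow> 'e \<Rightarrow> real" where
  "koszul P i x u v z = metric_deriv P i x u v z + metric_deriv P i x v u z - metric_deriv P i x z u v"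

lemma christoffel_koszul:
  "christoffel P i x u v = (THE w. \<forall>z. 2 * metric P i x w z = koszul P i x u v z)"
  unfolding christoffel_def koszul_def metric_deriv_def ..

lemma metric_has_derivative:
  assumes P: "riemannian_manifold P" and x: "x \<in> chart_dom P i"
  shows "((\<lambda>z. metric P i (chart_inv P i z) u v) has_derivative
    (\<lambda>w. metric_deriv P i x w u v)) (at (chart_map P i x))"
  using smooth_on_has_derivative[OF smooth_metric[OF P]] x
  unfolding metric_deriv_def chart_deriv_def o_def by blast

text \<open>In the direction \<open>w\<close> this is linearity of a derivative. In \<open>u\<close>
  and \<open>v\<close> the bilinearity of the metric over the whole chart passes to the derivatives
  by their uniqueness.\<close>

lemma metric_deriv_linear:
  assumes P: "riemannian_manifold P" and x: "x \<in> chart_dom P i"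
  shows "linear (\<lambda>w. metric_deriv P i x w u v)" "linear (\<lambda>u. metric_deriv P i x w u v)"
    "linear (\<lambda>v. metric_deriv P i x w u v)"
proof -
  note sm = riemannian_smooth_manifold[OF P]
  note der = metric_has_derivative[OF P x]
  have bil: "bilinear (metric P i (chart_inv P i z))" if "z \<in> chart_map P i ` chart_dom P i" for z
    using that inner_formD(1)[OF metric_inner_form[OF P]] by (auto simp: chart_inv_chart_map[OF sm])
  have S: "open (chart_map P i ` chart_dom P i)" "chart_map P i x \<in> chart_map P i ` chart_dom P i"
    using open_chart_image[OF sm] x by auto
  note tr = has_derivative_transform_within_open[OF _ S]
  show "linear (\<lambda>w. metric_deriv P i x w u v)" by (rule has_derivative_linear[OF der])
  show "linear (\<lambda>u. metric_deriv P i x w u v)"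
  proof (rule linearI)
    fix a b :: 'c and r :: real
    show "metric_deriv P i x w (a + b) v = metric_deriv P i x w a v + metric_deriv P i x w b v"
      using has_derivative_unique[OF der tr[OF has_derivative_add[OF der der]]]
      by (metis (no_types, lifting) bilinear_ladd bil)
    show "metric_deriv P i x w (r *\<^sub>R a) v = r *\<^sub>R metric_deriv P i x w a v"
      using has_derivative_unique[OF der tr[OF has_derivative_scaleR_right[OF der]]]
      by (metis (no_types, lifting) bilinear_lmul bil)
  qed
  show "linear (\<lambda>v. metric_deriv P i x w u v)"
  proof (rule linearI)
    fix a b :: 'c and r :: real
    show "metric_deriv P i x w u (a + b) = metric_deriv P i x w u a + metric_deriv P i x w u b"
      using has_derivative_unique[OF der tr[OF has_derivative_add[OF der der]]]
      by (metis (no_types, lifting) bilinear_radd bil)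
    show "metric_deriv P i x w u (r *\<^sub>R a) = r *\<^sub>R metric_deriv P i x w u a"
      using has_derivative_unique[OF der tr[OF has_derivative_scaleR_right[OF der]]]
      by (metis (no_types, lifting) bilinear_rmul bil)
  qed
qed

lemma koszul_linear:
  assumes P: "riemannian_manifold P" and x: "x \<in> chart_dom P i"
  shows "linear (\<lambda>u. koszul P i x u v z)" "linear (\<lambda>v. koszul P i x u v z)"
    "linear (koszul P i x u v)"
  unfolding koszul_def[abs_def]
  by (intro linear_compose_add linear_compose_sub metric_deriv_linear[OF P x])+

text \<open>A \<open>THE\<close> has content only after existence and uniqueness. Uniqueness is
  nondegeneracy of the metric; existence is the expansion whose coefficients are half the Koszul
  form on an orthonormal basis, which raises the index without inverting a matrix.\<close>

lemma christoffel_metric_expand: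
  assumes P: "riemannian_manifold P" and x: "x \<in> chart_dom P i"
  shows christoffel_metric: "2 * metric P i x (christoffel P i x u v) z = koszul P i x u v z"
    and christoffel_unique: "(\<And>z. 2 * metric P i x w z = koszul P i x u v z) \<Longrightarrow> christoffel P i x u v = w"
    and christoffel_expand: "orthonormal_basis (metric P i x) E \<Longrightarrow>
      christoffel P i x u v = (\<Sum>b\<in>Basis. (koszul P i x u v (E b) / 2) *\<^sub>R E b)"
proof -
  note inn = metric_inner_form[OF P x]
  note bil = inner_formD(1)[OF inn]
  have sol: "2 * metric P i x (\<Sum>b\<in>Basis. (koszul P i x u v (E b) / 2) *\<^sub>R E b) z = koszul P i x u v z"
    if E: "orthonormal_basis (metric P i x) E" for E z
  proof -
    have "2 * metric P i x (\<Sum>b\<in>Basis. (koszul P i x u v (E b) / 2) *\<^sub>R E b) z =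
        (\<Sum>b\<in>Basis. metric P i x (E b) z * koszul P i x u v (E b))"
      by (simp add: bilinear_sum_left[OF bil] bilinear_lmul[OF bil] sum_distrib_left mult.commute)
    also have "\<dots> = (\<Sum>b\<in>Basis. metric P i x z (E b) * koszul P i x u v (E b))"
      by (simp only: inner_formD(2)[OF inn, of z])
    also have "\<dots> = koszul P i x u v (\<Sum>b\<in>Basis. metric P i x z (E b) *\<^sub>R E b)"
      by (simp add: linear_sum[OF koszul_linear(3)[OF P x]] linear_scale[OF koszul_linear(3)[OF P x]])
    finally show ?thesis by (simp only: orthonormal_basis_expand[OF inn E])
  qed
  have uniq: "w = w'" if "\<And>z. 2 * metric P i x w z = koszul P i x u v z"
    "\<And>z. 2 * metric P i x w' z = koszul P i x u v z" for w w'
    by (rule inner_form_eqI[OF inn]) (use that in \<open>metis mult_left_cancel zero_neq_numeral\<close>)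
  have the: "christoffel P i x u v = w" if "\<And>z. 2 * metric P i x w z = koszul P i x u v z" for w
    unfolding christoffel_koszul by (rule the_equality) (use uniq that in blast)+
  then show "(\<And>z. 2 * metric P i x w z = koszul P i x u v z) \<Longrightarrow> christoffel P i x u v = w" .
  show ex: "christoffel P i x u v = (\<Sum>b\<in>Basis. (koszul P i x u v (E b) / 2) *\<^sub>R E b)"
    if "orthonormal_basis (metric P i x) E" for E
    by (rule the) (rule sol[OF that])
  obtain E where "orthonormal_basis (metric P i x) (\<lambda>b. E b (chart_map P i x))"
    using smooth_orthonormal_basis[OF P] x by metis
  from ex[OF this] sol[OF this] show "2 * metric P i x (christoffel P i x u v) z = koszul P i x u v z"
    by simp
qed

text \<open>Each combination of Christoffel vectors solves the Koszul equation of the combined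
  arguments, and the solution is unique.\<close>

lemma bilinear_christoffel:
  assumes P: "riemannian_manifold P" and x: "x \<in> chart_dom P i"
  shows "bilinear (christoffel P i x)"
proof -
  note bil = inner_formD(1)[OF metric_inner_form[OF P x]]
  note uniq = christoffel_unique[OF P x]
  note chr = christoffel_metric[OF P x]
  show ?thesis
    unfolding bilinear_def
  proof (intro allI conjI linearI)
    fix u v w :: 'c and r :: real
    show "christoffel P i x u (v + w) = christoffel P i x u v + christoffel P i x u w"
      by (rule uniq) (simp add: bilinear_ladd[OF bil] ring_distribs chr linear_add[OF koszul_linear(2)[OF P x]])
    show "christoffel P i x (v + w) u = christoffel P i x v u + christoffel P i x w u"
      by (rule uniq) (simp add: bilinear_ladd[OF bil] ring_distribs chr linear_add[OF koszul_linear(1)[OF P x]])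
    show "christoffel P i x u (r *\<^sub>R v) = r *\<^sub>R christoffel P i x u v"
      by (rule uniq) (simp add: bilinear_lmul[OF bil] mult.left_commute[of 2] chr linear_scale[OF koszul_linear(2)[OF P x]])
    show "christoffel P i x (r *\<^sub>R v) u = r *\<^sub>R christoffel P i x v u"
      by (rule uniq) (simp add: bilinear_lmul[OF bil] mult.left_commute[of 2] chr linear_scale[OF koszul_linear(1)[OF P x]])
  qed
qed

text \<open>The expansion in the Gram-Schmidt basis of the chart displays the Christoffel symbols as
  sums and products of smooth functions.\<close>

lemma smooth_christoffel:
  assumes P: "riemannian_manifold P"
  shows "smooth_on (chart_map P i ` chart_dom P i) (\<lambda>z. christoffel P i (chart_inv P i z) u v)"
proof -
  note sm = riemannian_smooth_manifold[OF P]
  let ?S = "chart_map P i ` chart_dom P i"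
  have S: "open ?S" by (rule open_chart_image[OF sm])
  have inS: "chart_inv P i z \<in> chart_dom P i" "chart_map P i (chart_inv P i z) = z" if "z \<in> ?S" for z
    using that by (auto simp: chart_inv_chart_map[OF sm])
  have dm: "smooth_on ?S (\<lambda>z. metric_deriv P i (chart_inv P i z) w u v)" for u v w
    using smooth_on_frechet[OF smooth_metric[OF P, of i u v], of w]
    by (subst smooth_on_cong[OF S, where
          g = "\<lambda>z. frechet_derivative (\<lambda>z. metric P i (chart_inv P i z) u v) (at z) w"])
      (simp_all add: metric_deriv_def chart_deriv_def o_def inS)
  have ko: "smooth_on ?S (\<lambda>z. koszul P i (chart_inv P i z) u v w)" for w
    unfolding koszul_def by (intro smooth_on_add smooth_on_diff S dm)
  obtain E where E: "\<And>b. b \<in> Basis \<Longrightarrow> smooth_on ?S (E b)"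
    "\<And>x. x \<in> chart_dom P i \<Longrightarrow> orthonormal_basis (metric P i x) (\<lambda>b. E b (chart_map P i x))"
    by (rule smooth_orthonormal_basis[OF P]) blast
  have "smooth_on ?S (\<lambda>z. \<Sum>b\<in>Basis. (1 / 2 * koszul P i (chart_inv P i z) u v (E b z)) *\<^sub>R E b z)"
  proof (intro smooth_on_sum S smooth_on_scaleR smooth_on_mult smooth_on_const E(1))
    show "smooth_on ?S (\<lambda>z. koszul P i (chart_inv P i z) u v (E b z))" if "b \<in> Basis" for b
      by (rule smooth_on_linear_family[OF S koszul_linear(3)[OF P inS(1)] ko E(1)[OF that]])
  qed
  moreover have "christoffel P i (chart_inv P i z) u v =
      (\<Sum>b\<in>Basis. (1 / 2 * koszul P i (chart_inv P i z) u v (E b z)) *\<^sub>R E b z)" if "z \<in> ?S" for z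
    using christoffel_expand[OF P inS(1)[OF that] E(2)[OF inS(1)[OF that]], of u v] inS(2)[OF that] by simp
  ultimately show ?thesis using smooth_on_cong[OF S] by (metis (no_types, lifting))
qed

text \<open>Differentiation of the invariance
  \<open>g\<^sub>i(u, v) = g\<^sub>j(DT u, DT v)\<close>: the three terms come from the base point
  and from the two occurrences of \<open>DT\<close>.\<close>

lemma metric_deriv_transition:
  assumes P: "riemannian_manifold P" and x: "x \<in> chart_dom P i" "x \<in> chart_dom P j"
  defines "T \<equiv> chart_map P j \<circ> chart_inv P i" and "\<theta> \<equiv> transition_deriv P i j x"
  shows "metric_deriv P i x w u v = metric_deriv P j x (\<theta> w) (\<theta> u) (\<theta> v) +
    metric P j x (hess T (chart_map P i x) w u) (\<theta> v) + metric P j x (\<theta> u) (hess T (chart_map P i x) w v)"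
proof -
  note sm = riemannian_smooth_manifold[OF P]
  let ?S = "chart_map P i ` (chart_dom P i \<inter> chart_dom P j)"
  have S: "open ?S" "chart_map P i x \<in> ?S" using open_chart_overlap[OF sm] x by auto
  have T: "smooth_on ?S T" unfolding T_def by (rule smooth_transition[OF sm])
  let ?m = "\<lambda>z. metric P j (chart_inv P i z)"
  have bil: "bilinear (?m z)" if "z \<in> ?S" for z
    using that inner_formD(1)[OF metric_inner_form[OF P]] by (auto simp: chart_inv_chart_map[OF sm])
  have m: "((\<lambda>z. ?m z a b) has_derivative (\<lambda>w. metric_deriv P j x (\<theta> w) a b)) (at (chart_map P i x))" for a b
    using has_derivative_change_chart[OF sm x, of "\<lambda>y. metric P j y a b"] metric_has_derivative[OF P x(2)]
    unfolding \<theta>_def o_def by blast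
  have DT: "((\<lambda>z. frechet_derivative T (at z) a) has_derivative (\<lambda>w. hess T (chart_map P i x) w a)) (at (chart_map P i x))" for a
    unfolding hess_def by (rule smooth_on_has_derivative[OF smooth_on_frechet[OF T] S(2)])
  have Tx: "frechet_derivative T (at (chart_map P i x)) = \<theta>"
    unfolding \<theta>_def T_def transition_deriv_def ..
  \<comment> \<open>Base point and first slot vary here; a second application of the same product
    rule lets the other slot vary as well.\<close>
  have inner: "((\<lambda>z. ?m z (frechet_derivative T (at z) u) b) has_derivative
      (\<lambda>w. metric_deriv P j x (\<theta> w) (\<theta> u) b + metric P j x (hess T (chart_map P i x) w u) b)) (at (chart_map P i x))" for b
    using has_derivative_linear_family[OF S, of "\<lambda>z a. ?m z a b", OF _ m DT[of u]] bil
    unfolding bilinear_def by (simp add: Tx chart_inv_chart_map[OF sm x(1)])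
  have "((\<lambda>z. ?m z (frechet_derivative T (at z) u) (frechet_derivative T (at z) v)) has_derivative
      (\<lambda>w. metric_deriv P j x (\<theta> w) (\<theta> u) (\<theta> v) + metric P j x (hess T (chart_map P i x) w u) (\<theta> v)
        + metric P j x (\<theta> u) (hess T (chart_map P i x) w v))) (at (chart_map P i x))"
    using has_derivative_linear_family[OF S, of "\<lambda>z b. ?m z (frechet_derivative T (at z) u) b", OF _ inner DT[of v]] bil
    unfolding bilinear_def by (simp add: Tx chart_inv_chart_map[OF sm x(1)])
  then have "((\<lambda>z. metric P i (chart_inv P i z) u v) has_derivative
      (\<lambda>w. metric_deriv P j x (\<theta> w) (\<theta> u) (\<theta> v) + metric P j x (hess T (chart_map P i x) w u) (\<theta> v)
        + metric P j x (\<theta> u) (hess T (chart_map P i x) w v))) (at (chart_map P i x))"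
    by (rule has_derivative_transform_within_open[OF _ S])
      (auto simp: chart_inv_chart_map[OF sm] metric_transition[OF P, unfolded transition_deriv_def] T_def)
  from has_derivative_unique[OF metric_has_derivative[OF P x(1)] this] show ?thesis by metis
qed

text \<open>In the difference of the two Koszul forms the second derivatives of the transition map cancel
  except for one pair, because they are symmetric.\<close>

lemma christoffel_transition:
  assumes P: "riemannian_manifold P" and x: "x \<in> chart_dom P i" "x \<in> chart_dom P j"
  defines "T \<equiv> chart_map P j \<circ> chart_inv P i" and "\<theta> \<equiv> transition_deriv P i j x"
  shows "\<theta> (christoffel P i x u v) = hess T (chart_map P i x) u v + christoffel P j x (\<theta> u) (\<theta> v)"
proof (rule inner_form_eqI)
  note sm = riemannian_smooth_manifold[OF P]
  show inn: "inner_form (metric P j x)" by (rule metric_inner_form[OF P x(2)])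
  fix z
  define h where "h = hess T (chart_map P i x)"
  have hsym: "h a b = h b a" for a b
    unfolding h_def T_def
    by (rule hess_sym[OF open_chart_overlap[OF sm] smooth_transition[OF sm]]) (use x in auto)
  \<comment> \<open>The test vector is written as an image under \<open>\<theta>\<close>, since
    invariance of the metric concerns such images.\<close>
  define w where "w = transition_deriv P j i x z"
  have z: "z = \<theta> w"
    unfolding w_def \<theta>_def using transition_deriv_trans[OF sm x(2,1,2)] transition_deriv_same[OF sm x(2)] by simp
  have "2 * metric P j x (\<theta> (christoffel P i x u v)) (\<theta> w) = koszul P i x u v w"
    unfolding \<theta>_def by (simp add: metric_transition[OF P x] christoffel_metric[OF P x(1)])
  also have "\<dots> = koszul P j x (\<theta> u) (\<theta> v) (\<theta> w) + 2 * metric P j x (h u v) (\<theta> w)"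
    unfolding koszul_def metric_deriv_transition[OF P x, folded T_def \<theta>_def h_def]
    by (simp add: hsym[of v u] hsym[of w] inner_formD(2)[OF inn, of "\<theta> v"] inner_formD(2)[OF inn, of "\<theta> u"])
  also have "\<dots> = 2 * metric P j x (h u v + christoffel P j x (\<theta> u) (\<theta> v)) (\<theta> w)"
    by (simp add: bilinear_ladd[OF inner_formD(1)[OF inn]] christoffel_metric[OF P x(2), symmetric])
  finally show "metric P j x (\<theta> (christoffel P i x u v)) z =
      metric P j x (hess T (chart_map P i x) u v + christoffel P j x (\<theta> u) (\<theta> v)) z"
    by (simp add: z h_def)
qed

text \<open>Differentiating \<open>Y\<^sub>j = DT Y\<^sub>i\<close> produces a second derivative of
  the transition map, and the Christoffel law produces the same term; the two balance. The result is
  used where \<open>\<nabla>\<^sub>X Y\<close> is itself the direction of a derivative.\<close>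

lemma levi_civita_tangent:
  assumes P: "riemannian_manifold P" and U: "open U" "x \<in> U"
    and X: "smooth_vector_field P U X" and Y: "smooth_vector_field P U Y"
  shows "tangent_vector P x (levi_civita P X Y x)"
  unfolding tangent_vector_def
proof (intro allI impI, elim IntE)
  fix i j assume x: "x \<in> chart_dom P i" "x \<in> chart_dom P j"
  note sm = riemannian_smooth_manifold[OF P]
  define T where "T = chart_map P j \<circ> chart_inv P i"
  define \<theta> where "\<theta> = transition_deriv P i j x"
  have field_deriv: "((\<lambda>y. Y y k) \<circ> chart_inv P k has_derivative chart_deriv P k (\<lambda>y. Y y k) x) (at (chart_map P k x))"
    if "x \<in> chart_dom P k" for k
    using smooth_on_has_derivative[OF smooth_vector_fieldD(2)[OF Y, of k], of "chart_map P k x"] that U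
    unfolding chart_deriv_def o_def by auto
  let ?S = "chart_map P i ` (chart_dom P i \<inter> chart_dom P j)"
  let ?S' = "chart_map P i ` (U \<inter> chart_dom P i \<inter> chart_dom P j)"
  have S: "open ?S" "chart_map P i x \<in> ?S" using open_chart_overlap[OF sm] x by auto
  have S': "open ?S'" "chart_map P i x \<in> ?S'"
    using U x by (auto intro!: open_chart_map_image[OF sm] open_Int open_chart_dom[OF sm])
  have T: "smooth_on ?S T" unfolding T_def by (rule smooth_transition[OF sm])
  have Tx: "frechet_derivative T (at (chart_map P i x)) = \<theta>"
    unfolding \<theta>_def T_def transition_deriv_def ..
  have "((\<lambda>z. frechet_derivative T (at z) (((\<lambda>y. Y y i) \<circ> chart_inv P i) z)) has_derivative
      (\<lambda>h. hess T (chart_map P i x) h (Y x i) + \<theta> (chart_deriv P i (\<lambda>y. Y y i) x h))) (at (chart_map P i x))"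
    using smooth_frechet_field_derivative[OF S T field_deriv[OF x(1)]]
    by (simp add: Tx chart_inv_chart_map[OF sm x(1)])
  then have "((\<lambda>y. Y y j) \<circ> chart_inv P i has_derivative
      (\<lambda>h. hess T (chart_map P i x) h (Y x i) + \<theta> (chart_deriv P i (\<lambda>y. Y y i) x h))) (at (chart_map P i x))"
  proof (rule has_derivative_transform_within_open[OF _ S'])
    fix z assume "z \<in> ?S'"
    then obtain y where y: "y \<in> U" "y \<in> chart_dom P i" "y \<in> chart_dom P j" "z = chart_map P i y" by auto
    show "frechet_derivative T (at z) (((\<lambda>y. Y y i) \<circ> chart_inv P i) z) = ((\<lambda>y. Y y j) \<circ> chart_inv P i) z"
      using tangent_vectorD[OF smooth_vector_fieldD(1)[OF Y y(1)] y(2,3)] y(4)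
      by (simp add: T_def transition_deriv_def chart_inv_chart_map[OF sm y(2)])
  qed
  from has_derivative_unique[OF this has_derivative_change_chart[OF sm x field_deriv[OF x(2)]]]
  have eq: "chart_deriv P j (\<lambda>y. Y y j) x (\<theta> h) =
      hess T (chart_map P i x) h (Y x i) + \<theta> (chart_deriv P i (\<lambda>y. Y y i) x h)" for h
    unfolding \<theta>_def by metis
  have vec: "X x j = \<theta> (X x i)" "Y x j = \<theta> (Y x i)"
    unfolding \<theta>_def using tangent_vectorD[OF smooth_vector_fieldD(1)[OF _ U(2)] x] X Y by blast+
  show "levi_civita P X Y x j = transition_deriv P i j x (levi_civita P X Y x i)"
    unfolding levi_civita_def vec eq
    using christoffel_transition[OF P x, of "X x i" "Y x i"] linear_add[OF linear_transition_deriv[OF sm x]]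
    by (simp add: \<theta>_def T_def)
qed

section \<open>Tension field in coordinates\<close>

lemma smooth_mapD:
  assumes "smooth_map P Q \<phi>"
  shows smooth_map_continuous: "continuous_on UNIV \<phi>"
    and smooth_map_coord: "smooth_on (chart_map P i ` (chart_dom P i \<inter> \<phi> -` chart_dom Q j))
              (chart_map Q j \<circ> \<phi> \<circ> chart_inv P i)"
  using assms unfolding smooth_map_def by blast+

lemma open_smooth_map_overlap:
  assumes P: "smooth_manifold P" and Q: "smooth_manifold Q" and \<phi>: "smooth_map P Q \<phi>"
  shows "open (chart_dom P i \<inter> \<phi> -` chart_dom Q j)"
    "open (chart_map P i ` (chart_dom P i \<inter> \<phi> -` chart_dom Q j))"
proof -
  show *: "open (chart_dom P i \<inter> \<phi> -` chart_dom Q j)"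
    by (rule open_Int[OF open_chart_dom[OF P] open_vimage[OF open_chart_dom[OF Q] smooth_map_continuous[OF \<phi>]]])
  show "open (chart_map P i ` (chart_dom P i \<inter> \<phi> -` chart_dom Q j))"
    by (rule open_chart_map_image[OF P *]) auto
qed

definition coord_map ::
  "('i, 'a, 'e::euclidean_space) rmanifold \<Rightarrow> ('j, 'b, 'd::euclidean_space) rmanifold \<Rightarrow>
   ('a \<Rightarrow> 'b) \<Rightarrow> 'i \<Rightarrow> 'j \<Rightarrow> 'e \<Rightarrow> 'd" where
  "coord_map P Q \<phi> i j = chart_map Q j \<circ> \<phi> \<circ> chart_inv P i"

text \<open>The classical coordinate expression of \<open>\<nabla>d\<phi>\<close>, taken on vectors
  at one point instead of fields: tensoriality is built in, so it can be traced over any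
  basis.\<close>

definition coord_second_fundamental_form ::
  "('i, 'a, 'e::euclidean_space) rmanifold \<Rightarrow> ('j, 'b, 'd::euclidean_space) rmanifold \<Rightarrow>
   ('a \<Rightarrow> 'b) \<Rightarrow> 'i \<Rightarrow> 'j \<Rightarrow> 'a \<Rightarrow> 'e \<Rightarrow> 'e \<Rightarrow> 'd" where
  "coord_second_fundamental_form P Q \<phi> i j x u v =
     hess (coord_map P Q \<phi> i j) (chart_map P i x) u v +
     christoffel Q j (\<phi> x) (frechet_derivative (coord_map P Q \<phi> i j) (at (chart_map P i x)) u)
       (frechet_derivative (coord_map P Q \<phi> i j) (at (chart_map P i x)) v) -
     frechet_derivative (coord_map P Q \<phi> i j) (at (chart_map P i x)) (christoffel P i x u v)"

lemma dir_deriv_coord: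
  assumes P: "smooth_manifold P" and W: "open W" "W \<subseteq> chart_dom P i" "x \<in> W"
    and v: "tangent_vector P x v" and G: "G differentiable (at (chart_map P i x))"
    and eq: "\<And>y. y \<in> W \<Longrightarrow> F y = G (chart_map P i y)"
  shows "dir_deriv P F x v = frechet_derivative G (at (chart_map P i x)) (v i)"
proof -
  have x: "x \<in> chart_dom P i" using W by auto
  have *: "(F \<circ> chart_inv P i has_derivative frechet_derivative G (at (chart_map P i x))) (at (chart_map P i x))"
    by (rule has_derivative_transform_within_open[OF G[unfolded frechet_derivative_works]
          open_chart_map_image[OF P W(1,2)]])
      (use W eq in \<open>auto simp: chart_inv_chart_map[OF P]\<close>)
  then show ?thesis
    using dir_deriv_eq_chart_deriv[OF P x v] frechet_derivative_at[OF *]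
    unfolding chart_deriv_def differentiable_def by metis
qed

lemma differential_coord:
  assumes P: "smooth_manifold P" and Q: "smooth_manifold Q" and \<phi>: "smooth_map P Q \<phi>"
    and x: "x \<in> chart_dom P i" "\<phi> x \<in> chart_dom Q j" and v: "tangent_vector P x v"
  shows "differential P Q \<phi> x v j =
    frechet_derivative (coord_map P Q \<phi> i j) (at (chart_map P i x)) (v i)"
  unfolding differential_def
  by (rule dir_deriv_coord[OF P open_smooth_map_overlap(1)[OF P Q \<phi>, of i j] _ _ v])
    (use x smooth_on_differentiable[OF smooth_map_coord[OF \<phi>, folded coord_map_def]] in
      \<open>auto simp: coord_map_def chart_inv_chart_map[OF P]\<close>)

lemma pullback_conn_coord:
  assumes P: "smooth_manifold P" and Q: "smooth_manifold Q" and \<phi>: "smooth_map P Q \<phi>"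
    and W: "open W" "W \<subseteq> chart_dom P i \<inter> \<phi> -` chart_dom Q j" "x \<in> W"
    and v: "tangent_vector P x (X x)"
    and V: "smooth_on (chart_map P i ` W) (\<lambda>z. V (chart_inv P i z) j)"
  shows "pullback_conn P Q \<phi> X V x j =
    frechet_derivative (\<lambda>z. V (chart_inv P i z) j) (at (chart_map P i x)) (X x i) +
    christoffel Q j (\<phi> x) (frechet_derivative (coord_map P Q \<phi> i j) (at (chart_map P i x)) (X x i)) (V x j)"
proof -
  have x: "x \<in> chart_dom P i" "\<phi> x \<in> chart_dom Q j" "W \<subseteq> chart_dom P i" using W by auto
  have "dir_deriv P (\<lambda>y. V y j) x (X x) =
      frechet_derivative (\<lambda>z. V (chart_inv P i z) j) (at (chart_map P i x)) (X x i)"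
    by (rule dir_deriv_coord[OF P W(1) x(3) W(3) v smooth_on_differentiable[OF V]])
      (use W(2,3) in \<open>auto simp: chart_inv_chart_map[OF P]\<close>)
  then show ?thesis
    unfolding pullback_conn_def differential_coord[OF P Q \<phi> x(1,2) v] by simp
qed

text \<open>The derivative of the components of \<open>Y\<close> occurs both in the connection
  applied to \<open>d\<phi>(Y)\<close> and in \<open>d\<phi>(\<nabla>\<^sub>X Y)\<close>; it cancels
  and leaves an expression in the values at \<open>x\<close> alone.\<close>

lemma second_fundamental_form_coord:
  assumes P: "riemannian_manifold P" and Q: "riemannian_manifold Q" and \<phi>: "smooth_map P Q \<phi>"
    and x: "x \<in> chart_dom P i" "\<phi> x \<in> chart_dom Q j"
    and U: "open U" "x \<in> U" and X: "smooth_vector_field P U X" and Y: "smooth_vector_field P U Y"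
  shows "second_fundamental_form P Q \<phi> X Y x j =
    coord_second_fundamental_form P Q \<phi> i j x (X x i) (Y x i)"
proof -
  note sP = riemannian_smooth_manifold[OF P] and sQ = riemannian_smooth_manifold[OF Q]
  let ?W = "chart_dom P i \<inter> \<phi> -` chart_dom Q j"
  let ?S = "chart_map P i ` ?W"
  have S: "open ?S" "chart_map P i x \<in> ?S" using open_smooth_map_overlap[OF sP sQ \<phi>] x by auto
  let ?F = "coord_map P Q \<phi> i j"
  have F: "smooth_on ?S ?F" unfolding coord_map_def by (rule smooth_map_coord[OF \<phi>])
  have tX: "tangent_vector P x (X x)" by (rule smooth_vector_fieldD(1)[OF X U(2)])
  have tY: "tangent_vector P y (Y y)" if "y \<in> U" for y by (rule smooth_vector_fieldD(1)[OF Y that])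
  have Yd: "((\<lambda>z. Y (chart_inv P i z) i) has_derivative chart_deriv P i (\<lambda>y. Y y i) x) (at (chart_map P i x))"
    using smooth_on_has_derivative[OF smooth_vector_fieldD(2)[OF Y, of i], of "chart_map P i x"] x(1) U
    unfolding chart_deriv_def o_def by auto
  note der = smooth_frechet_field_derivative[OF S F Yd]
  have "dir_deriv P (\<lambda>y. differential P Q \<phi> y (Y y) j) x (X x) =
      frechet_derivative (\<lambda>z. frechet_derivative ?F (at z) (Y (chart_inv P i z) i)) (at (chart_map P i x)) (X x i)"
  proof (rule dir_deriv_coord[OF sP _ _ _ tX])
    show "open (U \<inter> ?W)" using U open_smooth_map_overlap(1)[OF sP sQ \<phi>] by auto
    show "(\<lambda>z. frechet_derivative ?F (at z) (Y (chart_inv P i z) i)) differentiable at (chart_map P i x)"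
      using der differentiable_def by blast
    show "differential P Q \<phi> y (Y y) j =
        frechet_derivative ?F (at (chart_map P i y)) (Y (chart_inv P i (chart_map P i y)) i)"
      if "y \<in> U \<inter> ?W" for y
      using that differential_coord[OF sP sQ \<phi>, of y i j] tY by (simp add: chart_inv_chart_map[OF sP])
  qed (use x U in auto)
  also have "\<dots> = hess ?F (chart_map P i x) (X x i) (Y x i) +
      frechet_derivative ?F (at (chart_map P i x)) (chart_deriv P i (\<lambda>y. Y y i) x (X x i))"
    by (simp add: frechet_derivative_at[OF der, symmetric] chart_inv_chart_map[OF sP x(1)])
  finally have dd: "dir_deriv P (\<lambda>y. differential P Q \<phi> y (Y y) j) x (X x) = \<dots>" .
  have lin: "linear (frechet_derivative ?F (at (chart_map P i x)))"
    by (rule linear_frechet_derivative[OF smooth_on_differentiable[OF F S(2)]])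
  show ?thesis
    unfolding second_fundamental_form_def pullback_conn_def dd coord_second_fundamental_form_def
      differential_coord[OF sP sQ \<phi> x tX] differential_coord[OF sP sQ \<phi> x tY[OF U(2)]]
      differential_coord[OF sP sQ \<phi> x levi_civita_tangent[OF P U X Y]]
    by (simp add: levi_civita_def linear_add[OF lin])
qed

lemma bilinear_compose_linear:
  assumes "bilinear h" "linear f" shows "bilinear (\<lambda>u v. h (f u) (f v))"
  using assms unfolding bilinear_def by (auto intro: linear_compose[unfolded o_def])

lemma bilinear_coord_second_fundamental_form:
  assumes P: "riemannian_manifold P" and Q: "riemannian_manifold Q" and \<phi>: "smooth_map P Q \<phi>"
    and x: "x \<in> chart_dom P i" "\<phi> x \<in> chart_dom Q j"
  shows "bilinear (coord_second_fundamental_form P Q \<phi> i j x)"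
proof -
  note sP = riemannian_smooth_manifold[OF P] and sQ = riemannian_smooth_manifold[OF Q]
  let ?S = "chart_map P i ` (chart_dom P i \<inter> \<phi> -` chart_dom Q j)"
  have S: "open ?S" "chart_map P i x \<in> ?S" using open_smooth_map_overlap[OF sP sQ \<phi>] x by auto
  let ?F = "coord_map P Q \<phi> i j"
  have F: "smooth_on ?S ?F" unfolding coord_map_def by (rule smooth_map_coord[OF \<phi>])
  have lin: "linear (frechet_derivative ?F (at (chart_map P i x)))"
    by (rule linear_frechet_derivative[OF smooth_on_differentiable[OF F S(2)]])
  note h = bilinear_hess[OF S F]
    and q = bilinear_compose_linear[OF bilinear_christoffel[OF Q x(2)] lin]
    and p = bilinear_christoffel[OF P x(1)]
  have comp: "linear (\<lambda>u. frechet_derivative ?F (at (chart_map P i x)) (f u))" if "linear f" for f :: "'c \<Rightarrow> 'c"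
    using linear_compose[OF that lin] by (simp add: o_def)
  show ?thesis
    using h q p
    unfolding bilinear_def coord_second_fundamental_form_def[abs_def]
    by (auto intro!: linear_compose_add linear_compose_sub comp)
qed

text \<open>For a bilinear form at \<open>x\<close> the chosen frame may be replaced by an
  orthonormal basis at that single point. A smooth basis over a chart then yields smoothness of the
  tension, an adapted basis its value on a warped product.\<close>

lemma tension_field_coord:
  assumes P: "riemannian_manifold P" and Q: "riemannian_manifold Q" and \<phi>: "smooth_map P Q \<phi>"
    and x: "x \<in> chart_dom P i" "\<phi> x \<in> chart_dom Q j" and E: "orthonormal_basis (metric P i x) E"
  shows "tension_field P Q \<phi> x j = (\<Sum>b\<in>Basis. coord_second_fundamental_form P Q \<phi> i j x (E b) (E b))"
proof -
  obtain U where U: "x \<in> U" "local_orthonormal_frame P U (frame_at P x)"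
    by (rule frame_at_frame[OF P])
  note fr = local_orthonormal_frameD[OF U(2)]
  have "tension_field P Q \<phi> x j =
      (\<Sum>b\<in>Basis. coord_second_fundamental_form P Q \<phi> i j x (frame_at P x b x i) (frame_at P x b x i))"
    unfolding tension_field_def
    by (intro sum.cong refl second_fundamental_form_coord[OF P Q \<phi> x fr(1) U(1)] fr(2))
  also have "\<dots> = (\<Sum>b\<in>Basis. coord_second_fundamental_form P Q \<phi> i j x (E b) (E b))"
    by (rule trace_orthonormal_basis[OF metric_inner_form[OF P x(1)] fr(3)[OF U(1) x(1)] E
          bilinear_coord_second_fundamental_form[OF P Q \<phi> x]])
  finally show ?thesis .
qed

section \<open>Smoothness of the connection and of the tension along a map\<close>

text \<open>Smoothness of \<open>christoffel Q j\<close> is known in the chart of \<open>Q\<close>,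
  so it is composed with the coordinate form of \<open>\<phi>\<close>; bilinearity then admits
  varying arguments.\<close>

lemma smooth_christoffel_along:
  assumes P: "smooth_manifold P" and Q: "riemannian_manifold Q" and \<phi>: "smooth_map P Q \<phi>"
    and W: "open W" "W \<subseteq> chart_dom P i \<inter> \<phi> -` chart_dom Q j"
    and a: "smooth_on (chart_map P i ` W) a" and b: "smooth_on (chart_map P i ` W) b"
  shows "smooth_on (chart_map P i ` W) (\<lambda>z. christoffel Q j (\<phi> (chart_inv P i z)) (a z) (b z))"
proof (rule smooth_on_bilinear_family[OF _ _ _ a b])
  note sQ = riemannian_smooth_manifold[OF Q]
  show S: "open (chart_map P i ` W)" using W by (intro open_chart_map_image[OF P]) auto
  show "bilinear (christoffel Q j (\<phi> (chart_inv P i z)))" if "z \<in> chart_map P i ` W" for z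
    using that W(2) by (auto intro!: bilinear_christoffel[OF Q] simp: chart_inv_chart_map[OF P subsetD])
  fix u v
  have "smooth_on (chart_map P i ` W)
      (\<lambda>z. christoffel Q j (chart_inv Q j (coord_map P Q \<phi> i j z)) u v)"
  proof (rule smooth_on_compose[OF S open_chart_image[OF sQ] _ smooth_christoffel[OF Q]])
    show "smooth_on (chart_map P i ` W) (coord_map P Q \<phi> i j)"
      unfolding coord_map_def by (rule smooth_on_subset[OF smooth_map_coord[OF \<phi>]]) (use W(2) in auto)
    show "coord_map P Q \<phi> i j ` chart_map P i ` W \<subseteq> chart_map Q j ` chart_dom Q j"
      using W(2) by (auto simp: coord_map_def chart_inv_chart_map[OF P subsetD])
  qed
  moreover have "chart_inv Q j (coord_map P Q \<phi> i j z) = \<phi> (chart_inv P i z)" if "z \<in> chart_map P i ` W" for z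
  proof -
    obtain y where y: "y \<in> chart_dom P i" "\<phi> y \<in> chart_dom Q j" "z = chart_map P i y"
      using \<open>z \<in> _\<close> W(2) by blast
    then show ?thesis by (simp add: coord_map_def chart_inv_chart_map[OF P] chart_inv_chart_map[OF sQ])
  qed
  ultimately show "smooth_on (chart_map P i ` W) (\<lambda>z. christoffel Q j (\<phi> (chart_inv P i z)) u v)"
    by (subst (asm) smooth_on_cong[OF S]) auto
qed

text \<open>Along the identity, \<open>smooth_christoffel_along\<close> also covers the Christoffel
  symbols of the domain.\<close>

lemma smooth_map_id: "smooth_manifold P \<Longrightarrow> smooth_map P P (\<lambda>x. x)"
  using smooth_transition[of P] unfolding smooth_map_def by (simp add: o_def)

text \<open>The rough Laplacian applies the connection twice, and \<open>pullback_conn_coord\<close>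
  asks for a smooth field each time; the first derivative therefore has to be smooth on an open
  set.\<close>

lemma smooth_pullback_conn:
  assumes P: "smooth_manifold P" and Q: "riemannian_manifold Q" and \<phi>: "smooth_map P Q \<phi>"
    and W: "open W" "W \<subseteq> U" "W \<subseteq> chart_dom P i \<inter> \<phi> -` chart_dom Q j"
    and X: "smooth_vector_field P U X"
    and V: "smooth_on (chart_map P i ` W) (\<lambda>z. V (chart_inv P i z) j)"
  shows "smooth_on (chart_map P i ` W) (\<lambda>z. pullback_conn P Q \<phi> X V (chart_inv P i z) j)"
proof -
  note sQ = riemannian_smooth_manifold[OF Q]
  have S: "open (chart_map P i ` W)" using W by (intro open_chart_map_image[OF P]) auto
  have inW: "chart_inv P i z \<in> W" "chart_map P i (chart_inv P i z) = z" if "z \<in> chart_map P i ` W" for z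
    using that W(3) by (auto simp: chart_inv_chart_map[OF P subsetD])
  have X': "smooth_on (chart_map P i ` W) (\<lambda>z. X (chart_inv P i z) i)"
    by (rule smooth_on_subset[OF smooth_vector_fieldD(2)[OF X]]) (use W in auto)
  have F: "smooth_on (chart_map P i ` W) (coord_map P Q \<phi> i j)"
    unfolding coord_map_def by (rule smooth_on_subset[OF smooth_map_coord[OF \<phi>]]) (use W in auto)
  have "smooth_on (chart_map P i ` W)
    (\<lambda>z. frechet_derivative (\<lambda>z. V (chart_inv P i z) j) (at z) (X (chart_inv P i z) i) +
      christoffel Q j (\<phi> (chart_inv P i z))
        (frechet_derivative (coord_map P Q \<phi> i j) (at z) (X (chart_inv P i z) i)) (V (chart_inv P i z) j))"
    by (intro smooth_on_add[OF S] smooth_on_frechet_field[OF S _ X'] V F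
        smooth_christoffel_along[OF P Q \<phi> W(1,3)])
  moreover have "pullback_conn P Q \<phi> X V (chart_inv P i z) j =
      frechet_derivative (\<lambda>z. V (chart_inv P i z) j) (at z) (X (chart_inv P i z) i) +
      christoffel Q j (\<phi> (chart_inv P i z))
        (frechet_derivative (coord_map P Q \<phi> i j) (at z) (X (chart_inv P i z) i)) (V (chart_inv P i z) j)"
    if "z \<in> chart_map P i ` W" for z
    using pullback_conn_coord[OF P sQ \<phi> W(1,3) inW(1)[OF that], of X V] inW(1)[OF that] W(2) V
      smooth_vector_fieldD(1)[OF X] inW(2)[OF that] by auto
  ultimately show ?thesis using smooth_on_cong[OF S] by (metis (no_types, lifting))
qed

text \<open>The Gram-Schmidt basis of chart \<open>i\<close> serves all points of the chart at once,
  so the tension is given there by a single coordinate formula.\<close>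

lemma smooth_tension_field:
  assumes P: "riemannian_manifold P" and Q: "riemannian_manifold Q" and \<phi>: "smooth_map P Q \<phi>"
  shows "smooth_on (chart_map P i ` (chart_dom P i \<inter> \<phi> -` chart_dom Q j))
    (\<lambda>z. tension_field P Q \<phi> (chart_inv P i z) j)"
proof -
  note sP = riemannian_smooth_manifold[OF P] and sQ = riemannian_smooth_manifold[OF Q]
  let ?W = "chart_dom P i \<inter> \<phi> -` chart_dom Q j"
  let ?S = "chart_map P i ` ?W"
  let ?F = "coord_map P Q \<phi> i j"
  have W: "open ?W" and S: "open ?S" by (rule open_smooth_map_overlap[OF sP sQ \<phi>])+
  have F: "smooth_on ?S ?F" unfolding coord_map_def by (rule smooth_map_coord[OF \<phi>])
  have inW: "chart_inv P i z \<in> ?W" "chart_map P i (chart_inv P i z) = z" if "z \<in> ?S" for z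
    using that by (auto simp: chart_inv_chart_map[OF sP])
  obtain E where E: "\<And>b. b \<in> Basis \<Longrightarrow> smooth_on (chart_map P i ` chart_dom P i) (E b)"
    "\<And>y. y \<in> chart_dom P i \<Longrightarrow> orthonormal_basis (metric P i y) (\<lambda>b. E b (chart_map P i y))"
    by (rule smooth_orthonormal_basis[OF P]) blast
  have E': "smooth_on ?S (E b)" if "b \<in> Basis" for b
    by (rule smooth_on_subset[OF E(1)[OF that]]) auto
  have Gam: "smooth_on ?S (\<lambda>z. christoffel P i (chart_inv P i z) (E b z) (E b z))" if "b \<in> Basis" for b
    using smooth_christoffel_along[OF sP P smooth_map_id[OF sP] W, of i] E'[OF that] by auto
  have hs: "smooth_on ?S (\<lambda>z. hess ?F z (E b z) (E b z))" if "b \<in> Basis" for b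
    by (rule smooth_on_bilinear_family[OF S bilinear_hess[OF S _ F] _ E'[OF that] E'[OF that]])
      (auto simp: hess_def intro!: smooth_on_frechet F)
  have "smooth_on ?S (\<lambda>z. \<Sum>b\<in>Basis. hess ?F z (E b z) (E b z) +
      christoffel Q j (\<phi> (chart_inv P i z)) (frechet_derivative ?F (at z) (E b z)) (frechet_derivative ?F (at z) (E b z)) -
      frechet_derivative ?F (at z) (christoffel P i (chart_inv P i z) (E b z) (E b z)))"
    by (intro smooth_on_sum[OF S] smooth_on_diff[OF S] smooth_on_add[OF S] hs
        smooth_christoffel_along[OF sP Q \<phi> W] smooth_on_frechet_field[OF S F] E' Gam) auto
  moreover have "tension_field P Q \<phi> (chart_inv P i z) j = (\<Sum>b\<in>Basis. hess ?F z (E b z) (E b z) +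
      christoffel Q j (\<phi> (chart_inv P i z)) (frechet_derivative ?F (at z) (E b z)) (frechet_derivative ?F (at z) (E b z)) -
      frechet_derivative ?F (at z) (christoffel P i (chart_inv P i z) (E b z) (E b z)))" if "z \<in> ?S" for z
    using tension_field_coord[OF P Q \<phi> _ _ E(2)[of "chart_inv P i z"], of j] inW[OF that]
    by (simp add: coord_second_fundamental_form_def)
  ultimately show ?thesis using smooth_on_cong[OF S] by (metis (no_types, lifting))
qed

section \<open>Warped products\<close>

lemma riemannian_product_warped: "riemannian_product M N = warped_product (\<lambda>_. 1) M N"
  unfolding riemannian_product_def warped_product_def by simp

lemma warped_product_simps [simp]:
  "chart_dom (warped_product lam M N) (i, j) = chart_dom M i \<times> chart_dom N j"
  "chart_map (warped_product lam M N) (i, j) = map_prod (chart_map M i) (chart_map N j)"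
  "metric (warped_product lam M N) (i, j) (x, y) (u, v) (u', v') =
     metric M i x u u' + (lam x)\<^sup>2 * metric N j y v v'"
  by (simp_all add: warped_product_def)

lemma riemannian_product_simps [simp]:
  "chart_dom (riemannian_product M N) (i, j) = chart_dom M i \<times> chart_dom N j"
  "chart_map (riemannian_product M N) (i, j) = map_prod (chart_map M i) (chart_map N j)"
  by (simp_all add: riemannian_product_def)

text \<open>\<open>chart_inv\<close> is an \<open>inv_into\<close>, arbitrary off the image of the
  chart, so the splitting is confined to that image. Later comparisons of derivatives are for this
  reason made on open sets inside it.\<close>

lemma chart_inv_warped_product:
  assumes "smooth_manifold M" "smooth_manifold N"
    and "a \<in> chart_map M i ` chart_dom M i" "b \<in> chart_map N j ` chart_dom N j"
  shows "chart_inv (warped_product lam M N) (i, j) (a, b) = (chart_inv M i a, chart_inv N j b)"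
proof -
  have "inj_on (chart_map M i) (chart_dom M i)" "inj_on (chart_map N j) (chart_dom N j)"
    by (auto intro!: inj_on_inverseI chart_inv_chart_map assms)
  then have inj: "inj_on (map_prod (chart_map M i) (chart_map N j)) (chart_dom M i \<times> chart_dom N j)"
    by (rule map_prod_inj_on)
  obtain x y where xy: "x \<in> chart_dom M i" "a = chart_map M i x" "y \<in> chart_dom N j" "b = chart_map N j y"
    using assms(3,4) by auto
  have "inv_into (chart_dom M i \<times> chart_dom N j) (map_prod (chart_map M i) (chart_map N j))
      (map_prod (chart_map M i) (chart_map N j) (x, y)) = (x, y)"
    using inj xy by (intro inv_into_f_f) auto
  then show ?thesis
    using xy assms(1,2) by (simp add: chart_inv_def[of "warped_product lam M N"] chart_inv_chart_map)
qed

lemma chart_inv_warped_product_chart_map: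
  assumes "smooth_manifold M" "smooth_manifold N" "x \<in> chart_dom M i" "y \<in> chart_dom N j"
  shows "chart_inv (warped_product lam M N) (i, j) (chart_map M i x, chart_map N j y) = (x, y)"
  using assms by (simp add: chart_inv_warped_product chart_inv_chart_map)

lemma smooth_manifold_warped_product:
  assumes M: "smooth_manifold M" and N: "smooth_manifold N"
  shows "smooth_manifold (warped_product lam M N)"
proof -
  let ?P = "warped_product lam M N"
  note inv = chart_inv_warped_product[OF M N]
  have img: "chart_map ?P (i, j) ` (A \<times> B) = (chart_map M i ` A) \<times> (chart_map N j ` B)" for i j A B
    by (simp add: map_prod_image)
  have "\<exists>k. p \<in> chart_dom ?P k" for p
    using chart_dom_cover[OF M, of "fst p"] chart_dom_cover[OF N, of "snd p"]
    by (metis warped_product_simps(1) mem_Times_iff)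
  then have "(\<Union>k. chart_dom ?P k) = UNIV" by blast
  moreover have "open (chart_dom ?P k)" for k
    by (cases k) (simp add: open_Times open_chart_dom M N)
  moreover have "open (chart_map ?P k ` chart_dom ?P k)" for k
    by (cases k) (simp add: map_prod_image open_Times open_chart_image M N)
  moreover have "homeomorphism (chart_dom ?P k) (chart_map ?P k ` chart_dom ?P k) (chart_map ?P k) (chart_inv ?P k)" for k
  proof (cases k)
    case (Pair i j)
    note hM = homeomorphism_chart[OF M, of i] and hN = homeomorphism_chart[OF N, of j]
    let ?S = "chart_map M i ` chart_dom M i \<times> chart_map N j ` chart_dom N j"
    have "continuous_on (chart_dom M i \<times> chart_dom N j) (\<lambda>p. (chart_map M i (fst p), chart_map N j (snd p)))"
      by (intro continuous_on_Pair continuous_on_compose2[OF homeomorphism_cont1[OF hM]]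
          continuous_on_compose2[OF homeomorphism_cont1[OF hN]] continuous_intros) auto
    then have c1: "continuous_on (chart_dom ?P k) (chart_map ?P k)"
      by (simp add: Pair map_prod_def case_prod_unfold)
    have "continuous_on ?S (\<lambda>p. (chart_inv M i (fst p), chart_inv N j (snd p)))"
      by (intro continuous_on_Pair continuous_on_compose2[OF homeomorphism_cont2[OF hM]]
          continuous_on_compose2[OF homeomorphism_cont2[OF hN]] continuous_intros) auto
    moreover have "(chart_inv M i (fst p), chart_inv N j (snd p)) = chart_inv ?P k p" if "p \<in> ?S" for p
      using that inv[of "fst p" i "snd p" j] by (auto simp: Pair)
    ultimately have c2: "continuous_on ?S (chart_inv ?P k)"
      by (rule continuous_on_eq)
    show ?thesis
      using c1 c2 unfolding homeomorphism_def Pair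
      by (auto simp: map_prod_image chart_inv_warped_product_chart_map[OF M N] intro!: image_eqI)
  qed
  moreover have "smooth_on (chart_map ?P k ` (chart_dom ?P k \<inter> chart_dom ?P l)) (chart_map ?P l \<circ> chart_inv ?P k)" for k l
  proof (cases k, cases l)
    fix i j i' j' assume k: "k = (i, j)" and l: "l = (i', j')"
    let ?A = "chart_map M i ` (chart_dom M i \<inter> chart_dom M i')"
    let ?B = "chart_map N j ` (chart_dom N j \<inter> chart_dom N j')"
    have A: "open ?A" and B: "open ?B" by (intro open_chart_overlap M N)+
    have S: "chart_map ?P k ` (chart_dom ?P k \<inter> chart_dom ?P l) = ?A \<times> ?B"
      by (simp add: k l Times_Int_Times map_prod_image)
    have "smooth_on (?A \<times> ?B) (\<lambda>z. ((chart_map M i' \<circ> chart_inv M i) (fst z), (chart_map N j' \<circ> chart_inv N j) (snd z)))"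
      using A B
      by (intro smooth_on_Pair smooth_on_compose_fst[OF _ A smooth_transition[OF M]]
          smooth_on_compose_snd[OF _ B smooth_transition[OF N]] open_Times) auto
    moreover have "((chart_map M i' \<circ> chart_inv M i) (fst z), (chart_map N j' \<circ> chart_inv N j) (snd z)) =
        (chart_map ?P l \<circ> chart_inv ?P k) z" if "z \<in> ?A \<times> ?B" for z
      using that inv[of "fst z" i "snd z" j] by (auto simp: k l)
    ultimately show ?thesis unfolding S
      using smooth_on_cong[OF open_Times[OF A B]] by (metis (no_types, lifting))
  qed
  ultimately show ?thesis unfolding smooth_manifold_def by blast
qed

lemma transition_deriv_warped_product:
  assumes M: "smooth_manifold M" and N: "smooth_manifold N"
    and x: "x \<in> chart_dom M i" "x \<in> chart_dom M i'" and y: "y \<in> chart_dom N j" "y \<in> chart_dom N j'"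
  shows "transition_deriv (warped_product lam M N) (i, j) (i', j') (x, y) (u, v) =
    (transition_deriv M i i' x u, transition_deriv N j j' y v)"
proof -
  let ?P = "warped_product lam M N"
  let ?A = "chart_map M i ` (chart_dom M i \<inter> chart_dom M i')"
  let ?B = "chart_map N j ` (chart_dom N j \<inter> chart_dom N j')"
  let ?z = "(chart_map M i x, chart_map N j y)"
  have AB: "open (?A \<times> ?B)" "?z \<in> ?A \<times> ?B"
    using x y by (auto intro!: open_Times open_chart_overlap M N)
  have "((\<lambda>z. ((chart_map M i' \<circ> chart_inv M i) (fst z), (chart_map N j' \<circ> chart_inv N j) (snd z))) has_derivative
      (\<lambda>w. (transition_deriv M i i' x (fst w), transition_deriv N j j' y (snd w)))) (at ?z)"
    by (intro has_derivative_Pair has_derivative_compose[OF has_derivative_fst[OF has_derivative_ident]]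
        has_derivative_compose[OF has_derivative_snd[OF has_derivative_ident]])
      (simp_all add: transition_has_derivative[OF M x, unfolded o_def] transition_has_derivative[OF N y, unfolded o_def])
  then have d1: "(chart_map ?P (i', j') \<circ> chart_inv ?P (i, j) has_derivative
      (\<lambda>w. (transition_deriv M i i' x (fst w), transition_deriv N j j' y (snd w)))) (at ?z)"
    by (rule has_derivative_transform_within_open[OF _ AB])
      (auto simp: chart_inv_warped_product[OF M N])
  have d2: "(chart_map ?P (i', j') \<circ> chart_inv ?P (i, j) has_derivative
      transition_deriv ?P (i, j) (i', j') (x, y)) (at ?z)"
    using transition_has_derivative[OF smooth_manifold_warped_product[OF M N, of lam], of "(x, y)" "(i, j)" "(i', j')"] x y
    by simp
  from fun_cong[OF has_derivative_unique[OF d2 d1], of "(u, v)"] show ?thesis by simp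
qed

section \<open>Koszul form and connection of the warped metric\<close>

context
  fixes M :: "('i, 'a::{second_countable_topology, t2_space}, 'e::euclidean_space) rmanifold"
    and N :: "('j, 'b::{second_countable_topology, t2_space}, 'd::euclidean_space) rmanifold"
    and lam :: "'a \<Rightarrow> real"
  assumes M: "riemannian_manifold M" and N: "riemannian_manifold N"
    and lam: "smooth_function M lam" and lam_pos: "\<And>x. 0 < lam x"
begin

private abbreviation (input) "WP \<equiv> warped_product lam M N"

private lemmas M_smooth = riemannian_smooth_manifold[OF M]
private lemmas N_smooth = riemannian_smooth_manifold[OF N]

lemma inner_form_warped_product:
  assumes "x \<in> chart_dom M i" "y \<in> chart_dom N j"
  shows "inner_form (metric WP (i, j) (x, y))"
proof -
  note g = metric_inner_form[OF M assms(1)] and h = metric_inner_form[OF N assms(2)]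
  note bg = inner_formD(1)[OF g] and bh = inner_formD(1)[OF h]
  have "0 < metric M i x u u + (lam x)\<^sup>2 * metric N j y v v" if "(u, v) \<noteq> 0" for u v
  proof -
    have "0 \<le> metric M i x u u" "0 \<le> (lam x)\<^sup>2 * metric N j y v v"
      using inner_formD(3)[OF g, of u] inner_formD(3)[OF h, of v] bilinear_lzero[OF bg] bilinear_lzero[OF bh]
      by (cases "u = 0"; cases "v = 0"; fastforce intro: less_imp_le mult_nonneg_nonneg)+
    moreover have "0 < metric M i x u u \<or> 0 < (lam x)\<^sup>2 * metric N j y v v"
      using that inner_formD(3)[OF g, of u] inner_formD(3)[OF h, of v] lam_pos[of x]
      by (auto simp: zero_prod_def intro: mult_pos_pos)
    ultimately show ?thesis by linarith
  qed
  moreover have "metric M i x u u' = metric M i x u' u" "metric N j y v v' = metric N j y v' v" for u u' v v'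
    using inner_formD(2) g h by blast+
  ultimately show ?thesis
    unfolding inner_form_def bilinear_def
    by (auto intro!: linearI simp: bilinear_ladd[OF bg] bilinear_radd[OF bg] bilinear_lmul[OF bg] bilinear_rmul[OF bg]
        bilinear_ladd[OF bh] bilinear_radd[OF bh] bilinear_lmul[OF bh] bilinear_rmul[OF bh] algebra_simps)
qed

lemma riemannian_manifold_warped_product: "riemannian_manifold WP"
proof -
  have 1: "inner_form (metric WP k p)" if "p \<in> chart_dom WP k" for p k
    using that inner_form_warped_product by (cases k, cases p) simp
  have 2: "metric WP l p (transition_deriv WP k l p w) (transition_deriv WP k l p w') = metric WP k p w w'"
    if "p \<in> chart_dom WP k \<inter> chart_dom WP l" for p k l w w'
    using that
    by (cases k; cases l; cases p; cases w; cases w')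
      (auto simp: transition_deriv_warped_product[OF M_smooth N_smooth] metric_transition[OF M] metric_transition[OF N])
  have 3: "smooth_on (chart_map WP k ` chart_dom WP k) (\<lambda>z. metric WP k (chart_inv WP k z) w w')" for k w w'
  proof -
    obtain i j u v u' v' where k: "k = (i, j)" and w: "w = (u, v)" "w' = (u', v')" by (cases k, cases w, cases w')
    let ?A = "chart_map M i ` chart_dom M i"
    let ?B = "chart_map N j ` chart_dom N j"
    have A: "open ?A" and B: "open ?B" by (intro open_chart_image M_smooth N_smooth)+
    have S: "chart_map WP k ` chart_dom WP k = ?A \<times> ?B" by (simp add: k map_prod_image)
    have l: "smooth_on ?A (\<lambda>z. lam (chart_inv M i z))"
      using lam unfolding smooth_function_def by (simp add: o_def)
    have "smooth_on (?A \<times> ?B) (\<lambda>z. metric M i (chart_inv M i (fst z)) u u' +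
        (lam (chart_inv M i (fst z)) * lam (chart_inv M i (fst z))) * metric N j (chart_inv N j (snd z)) v v')"
      by (intro smooth_on_add smooth_on_mult open_Times A B smooth_on_compose_fst[OF _ A smooth_metric[OF M]]
          smooth_on_compose_snd[OF _ B smooth_metric[OF N]] smooth_on_compose_fst[OF _ A l]) auto
    moreover have "metric M i (chart_inv M i (fst z)) u u' +
        (lam (chart_inv M i (fst z)) * lam (chart_inv M i (fst z))) * metric N j (chart_inv N j (snd z)) v v' =
        metric WP k (chart_inv WP k z) w w'" if "z \<in> ?A \<times> ?B" for z
      using that chart_inv_warped_product[OF M_smooth N_smooth, of "fst z" i "snd z" j]
      by (auto simp: k w power2_eq_square)
    ultimately show ?thesis unfolding S
      using smooth_on_cong[OF open_Times[OF A B]] by (metis (no_types, lifting))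
  qed
  show ?thesis
    unfolding riemannian_manifold_def
    using smooth_manifold_warped_product[OF M_smooth N_smooth] 1[unfolded inner_form_def] 2 3 by blast
qed

text \<open>The last term, the derivative of \<open>lam\<^sup>2\<close> along the
  \<open>M\<close>-component of the direction, is the only one that couples the factors.\<close>

lemma metric_deriv_warped_product:
  assumes x: "x \<in> chart_dom M i" and y: "y \<in> chart_dom N j"
  shows "metric_deriv WP (i, j) (x, y) (w, w') (u, v) (u', v') =
    metric_deriv M i x w u u' + (lam x)\<^sup>2 * metric_deriv N j y w' v v' +
    frechet_derivative (\<lambda>z. (lam (chart_inv M i z))\<^sup>2) (at (chart_map M i x)) w * metric N j y v v'"
proof -
  let ?A = "chart_map M i ` chart_dom M i"
  let ?B = "chart_map N j ` chart_dom N j"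
  have A: "open ?A" and B: "open ?B" by (intro open_chart_image M_smooth N_smooth)+
  let ?z = "(chart_map M i x, chart_map N j y)"
  have z: "?z \<in> ?A \<times> ?B" using x y by auto
  have l: "smooth_on ?A (\<lambda>z. lam (chart_inv M i z))"
    using lam unfolding smooth_function_def by (simp add: o_def)
  have "smooth_on ?A (\<lambda>z. (lam (chart_inv M i z))\<^sup>2)"
    unfolding power2_eq_square by (intro smooth_on_mult A l)
  from smooth_on_has_derivative[OF this] x
  have dl: "((\<lambda>z. (lam (chart_inv M i z))\<^sup>2) has_derivative
      frechet_derivative (\<lambda>z. (lam (chart_inv M i z))\<^sup>2) (at (chart_map M i x))) (at (chart_map M i x))" by blast
  note fstd = has_derivative_compose[OF has_derivative_fst[OF has_derivative_ident]]
  note sndd = has_derivative_compose[OF has_derivative_snd[OF has_derivative_ident]]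
  have "((\<lambda>z. metric M i (chart_inv M i (fst z)) u u' +
        (lam (chart_inv M i (fst z)))\<^sup>2 * metric N j (chart_inv N j (snd z)) v v') has_derivative
      (\<lambda>w. metric_deriv M i x (fst w) u u' +
        ((lam (chart_inv M i (fst ?z)))\<^sup>2 * metric_deriv N j y (snd w) v v' +
        frechet_derivative (\<lambda>z. (lam (chart_inv M i z))\<^sup>2) (at (chart_map M i x)) (fst w) * metric N j (chart_inv N j (snd ?z)) v v')))
      (at ?z)"
    by (intro has_derivative_add has_derivative_mult
        fstd[where g = "\<lambda>z. metric M i (chart_inv M i z) u u'"]
        fstd[where g = "\<lambda>z. (lam (chart_inv M i z))\<^sup>2"]
        sndd[where g = "\<lambda>z. metric N j (chart_inv N j z) v v'"])
      (use metric_has_derivative[OF M x] metric_has_derivative[OF N y] dl in simp_all)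
  then have "((\<lambda>z. metric WP (i, j) (chart_inv WP (i, j) z) (u, v) (u', v')) has_derivative
      (\<lambda>w. metric_deriv M i x (fst w) u u' +
        ((lam (chart_inv M i (fst ?z)))\<^sup>2 * metric_deriv N j y (snd w) v v' +
        frechet_derivative (\<lambda>z. (lam (chart_inv M i z))\<^sup>2) (at (chart_map M i x)) (fst w) * metric N j (chart_inv N j (snd ?z)) v v')))
      (at ?z)"
    by (rule has_derivative_transform_within_open[OF _ open_Times[OF A B] z])
      (auto simp: chart_inv_warped_product[OF M_smooth N_smooth] chart_inv_chart_map[OF M_smooth] chart_inv_chart_map[OF N_smooth])
  from has_derivative_unique[OF _ this]
    metric_has_derivative[OF riemannian_manifold_warped_product, of "(x, y)" "(i, j)" "(u, v)" "(u', v')"] x y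
  have "(\<lambda>w. metric_deriv WP (i, j) (x, y) w (u, v) (u', v')) =
      (\<lambda>w. metric_deriv M i x (fst w) u u' +
        ((lam (chart_inv M i (fst ?z)))\<^sup>2 * metric_deriv N j y (snd w) v v' +
        frechet_derivative (\<lambda>z. (lam (chart_inv M i z))\<^sup>2) (at (chart_map M i x)) (fst w) * metric N j (chart_inv N j (snd ?z)) v v'))"
    by simp
  from fun_cong[OF this, of "(w, w')"] show ?thesis
    by (simp add: chart_inv_chart_map[OF M_smooth x] chart_inv_chart_map[OF N_smooth y])
qed

lemma frechet_warping_linear:
  assumes x: "x \<in> chart_dom M i"
  shows "linear (frechet_derivative (\<lambda>z. (lam (chart_inv M i z))\<^sup>2) (at (chart_map M i x)))"
proof -
  have A: "open (chart_map M i ` chart_dom M i)" by (rule open_chart_image[OF M_smooth])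
  have "smooth_on (chart_map M i ` chart_dom M i) (\<lambda>z. lam (chart_inv M i z))"
    using lam unfolding smooth_function_def by (simp add: o_def)
  then have "smooth_on (chart_map M i ` chart_dom M i) (\<lambda>z. (lam (chart_inv M i z))\<^sup>2)"
    unfolding power2_eq_square by (intro smooth_on_mult A)
  then show ?thesis
    by (rule linear_frechet_derivative[OF smooth_on_differentiable]) (use x in auto)
qed

text \<open>Every coupling term pairs \<open>D\<close> of one horizontal component with the metric
  of \<open>N\<close> on two vertical ones; hence all of them vanish when the first two arguments
  are horizontal, and when all three are vertical.\<close>

lemma koszul_warped_product:
  assumes x: "x \<in> chart_dom M i" and y: "y \<in> chart_dom N j"
  defines "D \<equiv> frechet_derivative (\<lambda>z. (lam (chart_inv M i z))\<^sup>2) (at (chart_map M i x))"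
  shows "koszul WP (i, j) (x, y) (u, v) (u', v') (w, w') =
    koszul M i x u u' w + (lam x)\<^sup>2 * koszul N j y v v' w' +
    (D u * metric N j y v' w' + D u' * metric N j y v w' - D w * metric N j y v v')"
  unfolding koszul_def metric_deriv_warped_product[OF x y] D_def by (simp add: algebra_simps)

text \<open>Each coupling term contains a vertical component that is zero here. Geometrically, the
  slices \<open>M \<times> {y}\<close> are totally geodesic.\<close>

lemma christoffel_warped_product_horizontal:
  assumes x: "x \<in> chart_dom M i" and y: "y \<in> chart_dom N j"
  shows "christoffel WP (i, j) (x, y) (u, 0) (u', 0) = (christoffel M i x u u', 0)"
proof (rule christoffel_unique[OF riemannian_manifold_warped_product])
  note bil = inner_formD(1)[OF metric_inner_form[OF N y]]
  fix z :: "'e \<times> 'd"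
  obtain w w' where z: "z = (w, w')" by (cases z)
  show "2 * metric WP (i, j) (x, y) (christoffel M i x u u', 0) z = koszul WP (i, j) (x, y) (u, 0) (u', 0) z"
    unfolding z koszul_warped_product[OF x y]
    by (simp add: bilinear_lzero[OF bil] linear_0[OF koszul_linear(1)[OF N y]] christoffel_metric[OF M x])
qed (use x y in auto)

text \<open>Testing against vertical vectors \<open>(0, w')\<close> isolates the
  \<open>N\<close>-component, and the common factor \<open>lam\<^sup>2\<close> cancels. The
  \<open>M\<close>-component is \<open>- lam h(v, v') grad lam\<close>, in general nonzero.\<close>

lemma christoffel_warped_product_vertical:
  assumes x: "x \<in> chart_dom M i" and y: "y \<in> chart_dom N j"
  shows "snd (christoffel WP (i, j) (x, y) (0, v) (0, v')) = christoffel N j y v v'"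
proof (rule christoffel_unique[OF N y, symmetric])
  note bil = inner_formD(1)[OF metric_inner_form[OF M x]]
  fix w'
  obtain a b where ab: "christoffel WP (i, j) (x, y) (0, v) (0, v') = (a, b)" by fastforce
  have "2 * metric WP (i, j) (x, y) (christoffel WP (i, j) (x, y) (0, v) (0, v')) (0, w') =
      koszul WP (i, j) (x, y) (0, v) (0, v') (0, w')"
    by (rule christoffel_metric[OF riemannian_manifold_warped_product]) (use x y in auto)
  then have "(lam x)\<^sup>2 * (2 * metric N j y b w') = (lam x)\<^sup>2 * koszul N j y v v' w'"
    unfolding ab koszul_warped_product[OF x y]
    by (simp add: bilinear_rzero[OF bil] linear_0[OF koszul_linear(1)[OF M x]]
        linear_0[OF frechet_warping_linear[OF x]])
  then show "2 * metric N j y (snd (christoffel WP (i, j) (x, y) (0, v) (0, v'))) w' = koszul N j y v v' w'"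
    using lam_pos[of x] by (simp add: ab)
qed

text \<open>The factor \<open>1 / lam x\<close> offsets \<open>lam\<^sup>2\<close> in the metric.
  \<open>Basis\<close> of a product consists of pairs \<open>(a, 0)\<close> and
  \<open>(0, b)\<close>; as 0 is not a basis vector, the test \<open>b = 0\<close> tells the two
  kinds apart.\<close>

lemma orthonormal_basis_warped_product:
  assumes e: "orthonormal_basis (metric M i x) e" and h: "orthonormal_basis (metric N j y) h"
    and x: "x \<in> chart_dom M i" and y: "y \<in> chart_dom N j"
  shows "orthonormal_basis (metric WP (i, j) (x, y))
    (\<lambda>(a, b). if b = 0 then (e a, 0) else (0, (1 / lam x) *\<^sub>R h b))"
proof -
  note bM = inner_formD(1)[OF metric_inner_form[OF M x]] and bN = inner_formD(1)[OF metric_inner_form[OF N y]]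
  have e': "metric M i x (e b) (e b') = (if b = b' then 1 else 0)" if "b \<in> Basis" "b' \<in> Basis" for b b'
    using e that by (auto simp: orthonormal_basis_def)
  have h': "metric N j y (h b) (h b') = (if b = b' then 1 else 0)" if "b \<in> Basis" "b' \<in> Basis" for b b'
    using h that by (auto simp: orthonormal_basis_def)
  have "lam x \<noteq> 0" using lam_pos[of x] by simp
  then show ?thesis
    unfolding orthonormal_basis_def Basis_prod_def
    by (auto simp: e' h' bilinear_lzero[OF bM] bilinear_rzero[OF bM] bilinear_lzero[OF bN] bilinear_rzero[OF bN]
        bilinear_lmul[OF bN] bilinear_rmul[OF bN] power2_eq_square nonzero_Basis split: if_splits)
qed

lemma smooth_map_fst: "smooth_map WP M fst"
  unfolding smooth_map_def
proof (intro conjI allI)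
  show "continuous_on UNIV fst" by (intro continuous_intros)
  fix c :: "'i \<times> 'j" and i' :: 'i
  obtain i j where c: "c = (i, j)" by (cases c)
  let ?A = "chart_map M i ` (chart_dom M i \<inter> chart_dom M i')"
  let ?B = "chart_map N j ` chart_dom N j"
  have A: "open ?A" and B: "open ?B" by (intro open_chart_image N_smooth open_chart_overlap M_smooth)+
  have "chart_dom M i \<times> chart_dom N j \<inter> fst -` chart_dom M i' = (chart_dom M i \<inter> chart_dom M i') \<times> chart_dom N j" by auto
  then have S: "chart_map WP c ` (chart_dom WP c \<inter> fst -` chart_dom M i') = ?A \<times> ?B"
    by (simp add: c map_prod_image)
  have "smooth_on (?A \<times> ?B) (\<lambda>z. (chart_map M i' \<circ> chart_inv M i) (fst z))"
    by (rule smooth_on_compose_fst[OF open_Times[OF A B] A smooth_transition[OF M_smooth]]) auto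
  moreover have "(chart_map M i' \<circ> chart_inv M i) (fst z) = (chart_map M i' \<circ> fst \<circ> chart_inv WP c) z"
    if "z \<in> ?A \<times> ?B" for z
    using that chart_inv_warped_product[OF M_smooth N_smooth, of "fst z" i "snd z" j lam] by (auto simp: c)
  ultimately show "smooth_on (chart_map WP c ` (chart_dom WP c \<inter> fst -` chart_dom M i'))
      (chart_map M i' \<circ> fst \<circ> chart_inv WP c)"
    unfolding S using smooth_on_cong[OF open_Times[OF A B]] by (metis (no_types, lifting))
qed

end

section \<open>Curvature in coordinates\<close>

text \<open>Fields with constant coordinates commute, so the bracket term drops out, and the
  derivative of one along another is the Christoffel vector itself; the classical expression in
  \<open>\<partial>\<Gamma>\<close> and \<open>\<Gamma>\<Gamma>\<close> remains.\<close>

lemma curvature_coord: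
  assumes P: "riemannian_manifold P" and x: "x \<in> chart_dom P i"
  defines "G \<equiv> \<lambda>u v z. christoffel P i (chart_inv P i z) u v"
  shows "curvature P x u v w i =
    frechet_derivative (G (v i) (w i)) (at (chart_map P i x)) (u i) + christoffel P i x (u i) (christoffel P i x (v i) (w i))
    - (frechet_derivative (G (u i) (w i)) (at (chart_map P i x)) (v i) + christoffel P i x (v i) (christoffel P i x (u i) (w i)))"
proof -
  note sm = riemannian_smooth_manifold[OF P]
  let ?S = "chart_map P i ` chart_dom P i"
  have S: "open ?S" "chart_map P i x \<in> ?S" using open_chart_image[OF sm] x by auto
  have cf: "coordinate_field P i a y i = a" if "y \<in> chart_dom P i" for a y
    unfolding coordinate_field_def by (rule transition_deriv_same[OF sm that])
  have cong: "chart_deriv P i F y a = frechet_derivative H (at (chart_map P i y)) a"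
    if y: "y \<in> chart_dom P i" and H: "H differentiable (at (chart_map P i y))"
      and eq: "\<And>y. y \<in> chart_dom P i \<Longrightarrow> F y = H (chart_map P i y)" for F y a and H :: "'c \<Rightarrow> 'c"
    unfolding chart_deriv_def
    by (rule frechet_derivative_cong_open[OF S(1) _ H, symmetric])
      (use y eq in \<open>auto simp: chart_inv_chart_map[OF sm]\<close>)
  have const: "chart_deriv P i F y a = 0"
    if "y \<in> chart_dom P i" "\<And>y. y \<in> chart_dom P i \<Longrightarrow> F y = c" for F y a and c :: 'c
    using cong[of y "\<lambda>_. c" F a] that by simp
  have lc: "levi_civita P (coordinate_field P i a) (coordinate_field P i b) y i = christoffel P i y a b"
    if "y \<in> chart_dom P i" for a b y
    unfolding levi_civita_def using const[OF that, of "\<lambda>y. coordinate_field P i b y i" b] cf that by simp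
  have lclc: "levi_civita P (coordinate_field P i c) (levi_civita P (coordinate_field P i a) (coordinate_field P i b)) x i =
      frechet_derivative (G a b) (at (chart_map P i x)) c + christoffel P i x c (christoffel P i x a b)" for a b c
  proof -
    have "G a b differentiable (at (chart_map P i x))"
      unfolding G_def by (rule smooth_on_differentiable[OF smooth_christoffel[OF P] S(2)])
    then show ?thesis
      unfolding levi_civita_def[of P _ "levi_civita P _ _"] cf[OF x]
      using cong[OF x, of "G a b" "\<lambda>y. levi_civita P (coordinate_field P i a) (coordinate_field P i b) y i"]
      by (simp add: lc x G_def chart_inv_chart_map[OF sm])
  qed
  have br: "lie_bracket P (coordinate_field P i a) (coordinate_field P i b) x i = 0" for a b
    unfolding lie_bracket_def
    using const[OF x, of "\<lambda>y. coordinate_field P i b y i" b] const[OF x, of "\<lambda>y. coordinate_field P i a y i" a] cf by simp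
  have "levi_civita P (lie_bracket P (coordinate_field P i a) (coordinate_field P i b)) (coordinate_field P i c) x i = 0" for a b c
    unfolding levi_civita_def br
    using const[OF x, of "\<lambda>y. coordinate_field P i c y i" c] cf bilinear_lzero[OF bilinear_christoffel[OF P x]] by simp
  then show ?thesis unfolding curvature_def curvature_field_def lclc by simp
qed

section \<open>Maps into a product that fix the first factor\<close>

context
  fixes M :: "('i, 'a::{second_countable_topology, t2_space}, 'e::euclidean_space) rmanifold"
    and N :: "('j, 'b::{second_countable_topology, t2_space}, 'd::euclidean_space) rmanifold"
  assumes M: "riemannian_manifold M" and N: "riemannian_manifold N"
begin

lemma smooth_function_one: "smooth_function M (\<lambda>_. 1)"
  by (simp add: smooth_function_def o_def)

lemma riemannian_manifold_product: "riemannian_manifold (riemannian_product M N)"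
  unfolding riemannian_product_warped
  by (rule riemannian_manifold_warped_product[OF M N smooth_function_one]) simp

text \<open>For the warping function 1 the differential of \<open>lam\<^sup>2\<close> is zero, and
  with it the coupling in the Koszul form.\<close>

lemma christoffel_product:
  assumes x: "x \<in> chart_dom M i" and y: "y \<in> chart_dom N j"
  shows "christoffel (riemannian_product M N) (i, j) (x, y) (u, v) (u', v') =
    (christoffel M i x u u', christoffel N j y v v')"
proof (rule christoffel_unique[OF riemannian_manifold_product])
  fix z :: "'e \<times> 'd"
  obtain w w' where z: "z = (w, w')" by (cases z)
  have "koszul (riemannian_product M N) (i, j) (x, y) (u, v) (u', v') (w, w') =
      koszul M i x u u' w + koszul N j y v v' w'"
    unfolding riemannian_product_warped
    using koszul_warped_product[OF M N smooth_function_one _ x y, of u v u' v' w w'] by simp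
  then show "2 * metric (riemannian_product M N) (i, j) (x, y) (christoffel M i x u u', christoffel N j y v v') z =
      koszul (riemannian_product M N) (i, j) (x, y) (u, v) (u', v') z"
    unfolding z by (simp add: riemannian_product_warped christoffel_metric[OF M x, symmetric]
        christoffel_metric[OF N y, symmetric])
qed (use x y in \<open>auto simp: riemannian_product_warped\<close>)

text \<open>Each summand of the \<open>N\<close>-part contains the vertical component of
  \<open>u\<close>, as a direction or inside a Christoffel symbol, and that component is 0. The
  vertical components of \<open>v\<close> and \<open>w\<close> stay arbitrary because
  \<open>d\<Psi>\<close> of a frame vector may have one.\<close>

lemma curvature_product_horizontal:
  assumes x: "x \<in> chart_dom M i" and y: "y \<in> chart_dom N j"
    and u: "u (i, j) = (a i, 0)" and v: "fst (v (i, j)) = b i" and w: "fst (w (i, j)) = c i"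
  shows "curvature (riemannian_product M N) (x, y) u v w (i, j) = (curvature M x a b c i, 0)"
proof -
  let ?Q = "riemannian_product M N"
  note Q = riemannian_manifold_product
  note sM = riemannian_smooth_manifold[OF M] and sN = riemannian_smooth_manifold[OF N]
  obtain v' w' where v': "v (i, j) = (b i, v')" and w': "w (i, j) = (c i, w')"
    using v w by (metis prod.collapse)
  have xy: "(x, y) \<in> chart_dom ?Q (i, j)" using x y by (simp add: riemannian_product_warped)
  let ?A = "chart_map M i ` chart_dom M i"
  let ?B = "chart_map N j ` chart_dom N j"
  let ?z = "(chart_map M i x, chart_map N j y)"
  have AB: "open (?A \<times> ?B)" "?z \<in> ?A \<times> ?B"
    using x y by (auto intro!: open_Times open_chart_image sM sN)
  have dM: "(\<lambda>z. christoffel M i (chart_inv M i z) p q) differentiable (at (chart_map M i x))" for p q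
    by (rule smooth_on_differentiable[OF smooth_christoffel[OF M]]) (use x in auto)
  have dN: "(\<lambda>z. christoffel N j (chart_inv N j z) p q) differentiable (at (chart_map N j y))" for p q
    by (rule smooth_on_differentiable[OF smooth_christoffel[OF N]]) (use y in auto)
  have D: "frechet_derivative (\<lambda>z. christoffel ?Q (i, j) (chart_inv ?Q (i, j) z) (p, p') (q, q')) (at ?z) (r, r') =
      (frechet_derivative (\<lambda>z. christoffel M i (chart_inv M i z) p q) (at (chart_map M i x)) r,
       frechet_derivative (\<lambda>z. christoffel N j (chart_inv N j z) p' q') (at (chart_map N j y)) r')" for p p' q q' r r'
  proof -
    have dM': "(\<lambda>z. christoffel M i (chart_inv M i (fst z)) p q) differentiable (at ?z)"
      using differentiable_chain_at[of fst ?z "\<lambda>z. christoffel M i (chart_inv M i z) p q"] dM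
      by (simp add: o_def bounded_linear_imp_differentiable bounded_linear_fst)
    have dN': "(\<lambda>z. christoffel N j (chart_inv N j (snd z)) p' q') differentiable (at ?z)"
      using differentiable_chain_at[of snd ?z "\<lambda>z. christoffel N j (chart_inv N j z) p' q'"] dN
      by (simp add: o_def bounded_linear_imp_differentiable bounded_linear_snd)
    have "(\<lambda>z. (christoffel M i (chart_inv M i (fst z)) p q, christoffel N j (chart_inv N j (snd z)) p' q'))
        differentiable (at ?z)"
      using has_derivative_Pair dM' dN' unfolding differentiable_def by blast
    then have "frechet_derivative (\<lambda>z. (christoffel M i (chart_inv M i (fst z)) p q,
          christoffel N j (chart_inv N j (snd z)) p' q')) (at ?z) (r, r') =
        frechet_derivative (\<lambda>z. christoffel ?Q (i, j) (chart_inv ?Q (i, j) z) (p, p') (q, q')) (at ?z) (r, r')"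
      by (rule frechet_derivative_cong_open[OF AB])
        (auto simp: riemannian_product_warped chart_inv_warped_product[OF sM sN] chart_inv_chart_map[OF sM]
          chart_inv_chart_map[OF sN] christoffel_product[unfolded riemannian_product_warped])
    then show ?thesis
      by (simp add: frechet_derivative_Pair[OF dM' dN'] dM dN
          frechet_derivative_compose_fst[of "\<lambda>z. christoffel M i (chart_inv M i z) p q" ?z]
          frechet_derivative_compose_snd[of "\<lambda>z. christoffel N j (chart_inv N j z) p' q'" ?z])
  qed
  note bN = bilinear_christoffel[OF N y]
  have z: "chart_map ?Q (i, j) (x, y) = ?z" by (simp add: riemannian_product_warped)
  \<comment> \<open>The function is zero on the chart image but unspecified elsewhere, so it is
    compared with the zero function on that open set.\<close>
  have "frechet_derivative (\<lambda>z. christoffel N j (chart_inv N j z) 0 w') (at (chart_map N j y)) v' = 0"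
  proof -
    have "frechet_derivative (\<lambda>z. 0) (at (chart_map N j y)) v' =
        frechet_derivative (\<lambda>z. christoffel N j (chart_inv N j z) 0 w') (at (chart_map N j y)) v'"
      by (rule frechet_derivative_cong_open[OF open_chart_image[OF sN, of j]])
        (use y in \<open>auto simp: chart_inv_chart_map[OF sN] bilinear_lzero[OF bilinear_christoffel[OF N]]\<close>)
    then show ?thesis by simp
  qed
  then show ?thesis
    unfolding curvature_coord[OF Q xy] curvature_coord[OF M x] u v' w' z D christoffel_product[OF x y]
    by (simp add: frechet_derivative_zero[OF dN] bilinear_lzero[OF bN] bilinear_rzero[OF bN])
qed

end

section \<open>Tension and f-bi-tension of the product map\<close>

context
  fixes M :: "('i, 'a::{second_countable_topology, t2_space}, 'e::euclidean_space) rmanifold"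
    and N :: "('j, 'b::{second_countable_topology, t2_space}, 'd::euclidean_space) rmanifold"
    and lam :: "'a \<Rightarrow> real"
    and \<psi> :: "'b \<Rightarrow> 'b"
  assumes M: "riemannian_manifold M" and N: "riemannian_manifold N"
    and lam: "smooth_function M lam" and lam_pos: "\<And>x. 0 < lam x"
    and \<psi>: "smooth_map N N \<psi>"
begin

private abbreviation (input) "P \<equiv> warped_product lam M N"
private abbreviation (input) "Q \<equiv> riemannian_product M N"
private abbreviation (input) "\<Psi> \<equiv> map_prod id \<psi>"

private lemmas sM = riemannian_smooth_manifold[OF M]
private lemmas sN = riemannian_smooth_manifold[OF N]
private lemmas RP = riemannian_manifold_warped_product[OF M N lam lam_pos]
private lemmas RQ = riemannian_manifold_product[OF M N]
private lemmas sP = riemannian_smooth_manifold[OF RP]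
private lemmas sQ = riemannian_smooth_manifold[OF RQ]
private lemmas fst_smooth = smooth_map_fst[OF M N lam lam_pos]

text \<open>The first component is the coordinate form of \<open>fst\<close>, so the
  \<open>M\<close>-parts computed below are literally those of the projection.\<close>

lemma coord_map_product:
  assumes "z \<in> chart_map P (i, j) ` (chart_dom P (i, j) \<inter> \<Psi> -` chart_dom Q (k, l))"
  shows "coord_map P Q \<Psi> (i, j) (k, l) z = (coord_map P M fst (i, j) k z, coord_map N N \<psi> j l (snd z))"
  using assms by (auto simp: coord_map_def chart_inv_warped_product_chart_map[OF sM sN] chart_inv_chart_map[OF sN])

lemma overlap_product:
  "chart_dom P (i, j) \<inter> \<Psi> -` chart_dom Q (k, l) =
    (chart_dom M i \<inter> chart_dom M k) \<times> (chart_dom N j \<inter> \<psi> -` chart_dom N l)"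
  by auto

lemma open_overlap_product:
  "open (chart_map P (i, j) ` (chart_dom P (i, j) \<inter> \<Psi> -` chart_dom Q (k, l)))"
  unfolding overlap_product
  by (simp add: map_prod_image open_Times open_chart_overlap[OF sM] open_smooth_map_overlap(2)[OF sN sN \<psi>])

lemma smooth_coord_map_fst_overlap:
  "smooth_on (chart_map P (i, j) ` (chart_dom P (i, j) \<inter> \<Psi> -` chart_dom Q (k, l))) (coord_map P M fst (i, j) k)"
  unfolding coord_map_def by (rule smooth_on_subset[OF smooth_map_coord[OF fst_smooth]]) auto

lemma smooth_coord_map_snd_overlap:
  "smooth_on (chart_map P (i, j) ` (chart_dom P (i, j) \<inter> \<Psi> -` chart_dom Q (k, l))) (\<lambda>z. coord_map N N \<psi> j l (snd z))"
  by (rule smooth_on_compose_snd[OF open_overlap_product open_smooth_map_overlap(2)[OF sN sN \<psi>]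
        smooth_map_coord[OF \<psi>, folded coord_map_def]]) auto

lemma smooth_map_product: "smooth_map P Q \<Psi>"
  unfolding smooth_map_def
proof (intro conjI allI)
  have "continuous_on UNIV (\<lambda>p. (fst p, \<psi> (snd p)))"
    by (intro continuous_on_Pair continuous_on_compose2[OF smooth_map_continuous[OF \<psi>]] continuous_intros) auto
  then show "continuous_on UNIV \<Psi>" by (simp add: map_prod_def case_prod_unfold)
  fix c d :: "'i \<times> 'j"
  obtain i j k l where cd: "c = (i, j)" "d = (k, l)" by (cases c, cases d)
  let ?S = "chart_map P (i, j) ` (chart_dom P (i, j) \<inter> \<Psi> -` chart_dom Q (k, l))"
  have "smooth_on ?S (coord_map P Q \<Psi> (i, j) (k, l)) \<longleftrightarrow>
      smooth_on ?S (\<lambda>z. (coord_map P M fst (i, j) k z, coord_map N N \<psi> j l (snd z)))"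
    by (rule smooth_on_cong[OF open_overlap_product coord_map_product])
  then have "smooth_on ?S (coord_map P Q \<Psi> (i, j) (k, l))"
    using smooth_on_Pair[OF open_overlap_product smooth_coord_map_fst_overlap smooth_coord_map_snd_overlap]
    by (rule iffD2)
  then show "smooth_on (chart_map P c ` (chart_dom P c \<inter> \<Psi> -` chart_dom Q d)) (chart_map Q d \<circ> \<Psi> \<circ> chart_inv P c)"
    by (simp only: cd coord_map_def)
qed

lemma frechet_coord_map_product:
  assumes x: "x \<in> chart_dom M i" "x \<in> chart_dom M k" and y: "y \<in> chart_dom N j" "\<psi> y \<in> chart_dom N l"
  shows "frechet_derivative (coord_map P Q \<Psi> (i, j) (k, l)) (at (chart_map P (i, j) (x, y))) w =
    (frechet_derivative (coord_map P M fst (i, j) k) (at (chart_map P (i, j) (x, y))) w,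
     frechet_derivative (coord_map N N \<psi> j l) (at (chart_map N j y)) (snd w))"
proof -
  let ?S = "chart_map P (i, j) ` (chart_dom P (i, j) \<inter> \<Psi> -` chart_dom Q (k, l))"
  let ?z = "chart_map P (i, j) (x, y)"
  have S: "open ?S" "?z \<in> ?S"
    by (rule open_overlap_product) (use x y in auto)
  have d1: "coord_map P M fst (i, j) k differentiable (at ?z)"
    by (rule smooth_on_differentiable[OF smooth_coord_map_fst_overlap S(2)])
  have d2: "(\<lambda>z. coord_map N N \<psi> j l (snd z)) differentiable (at ?z)"
    by (rule smooth_on_differentiable[OF smooth_coord_map_snd_overlap S(2)])
  have d3: "coord_map N N \<psi> j l differentiable (at (snd ?z))"
    by (rule smooth_on_differentiable[OF smooth_map_coord[OF \<psi>, folded coord_map_def]]) (use y in auto)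
  have d: "coord_map P Q \<Psi> (i, j) (k, l) differentiable (at ?z)"
    by (rule smooth_on_differentiable[OF smooth_map_coord[OF smooth_map_product, folded coord_map_def] S(2)])
  have "frechet_derivative (coord_map P Q \<Psi> (i, j) (k, l)) (at ?z) w =
      frechet_derivative (\<lambda>z. (coord_map P M fst (i, j) k z, coord_map N N \<psi> j l (snd z))) (at ?z) w"
    by (rule frechet_derivative_cong_open[OF S d coord_map_product])
  also have "\<dots> = (frechet_derivative (coord_map P M fst (i, j) k) (at ?z) w,
      frechet_derivative (\<lambda>z. coord_map N N \<psi> j l (snd z)) (at ?z) w)"
    by (rule frechet_derivative_Pair[OF d1 d2])
  finally show ?thesis unfolding frechet_derivative_compose_snd[OF d3] by simp
qed

lemma hess_coord_map_product:
  assumes x: "x \<in> chart_dom M i" "x \<in> chart_dom M k" and y: "y \<in> chart_dom N j" "\<psi> y \<in> chart_dom N l"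
  shows "hess (coord_map P Q \<Psi> (i, j) (k, l)) (chart_map P (i, j) (x, y)) w w' =
    (hess (coord_map P M fst (i, j) k) (chart_map P (i, j) (x, y)) w w',
     hess (coord_map N N \<psi> j l) (chart_map N j y) (snd w) (snd w'))"
proof -
  let ?S = "chart_map P (i, j) ` (chart_dom P (i, j) \<inter> \<Psi> -` chart_dom Q (k, l))"
  let ?z = "chart_map P (i, j) (x, y)"
  have S: "open ?S" "?z \<in> ?S"
    by (rule open_overlap_product) (use x y in auto)
  have T: "snd ?z \<in> chart_map N j ` (chart_dom N j \<inter> \<psi> -` chart_dom N l)" using y by auto
  have "hess (coord_map P Q \<Psi> (i, j) (k, l)) ?z w w' =
      hess (\<lambda>z. (coord_map P M fst (i, j) k z, coord_map N N \<psi> j l (snd z))) ?z w w'"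
    by (rule hess_cong_open[OF S smooth_map_coord[OF smooth_map_product, folded coord_map_def] coord_map_product])
  also have "\<dots> = (hess (coord_map P M fst (i, j) k) ?z w w', hess (\<lambda>z. coord_map N N \<psi> j l (snd z)) ?z w w')"
    by (rule hess_Pair[OF S smooth_coord_map_fst_overlap smooth_coord_map_snd_overlap])
  finally show ?thesis
    unfolding hess_compose_snd[OF open_smooth_map_overlap(2)[OF sN sN \<psi>] T smooth_map_coord[OF \<psi>, folded coord_map_def]]
    by simp
qed

text \<open>The \<open>N\<close>-part is not yet that of \<open>\<psi>\<close>: its last term
  carries the connection of the warped metric, through the \<open>N\<close>-component of
  \<open>christoffel P\<close>. Horizontal and vertical arguments are therefore evaluated separately
  later.\<close>

lemma coord_second_fundamental_form_product:
  assumes x: "x \<in> chart_dom M i" "x \<in> chart_dom M k" and y: "y \<in> chart_dom N j" "\<psi> y \<in> chart_dom N l"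
  shows "coord_second_fundamental_form P Q \<Psi> (i, j) (k, l) (x, y) w w' =
    (coord_second_fundamental_form P M fst (i, j) k (x, y) w w',
     hess (coord_map N N \<psi> j l) (chart_map N j y) (snd w) (snd w') +
     christoffel N l (\<psi> y) (frechet_derivative (coord_map N N \<psi> j l) (at (chart_map N j y)) (snd w))
       (frechet_derivative (coord_map N N \<psi> j l) (at (chart_map N j y)) (snd w')) -
     frechet_derivative (coord_map N N \<psi> j l) (at (chart_map N j y)) (snd (christoffel P (i, j) (x, y) w w')))"
  unfolding coord_second_fundamental_form_def frechet_coord_map_product[OF x y] hess_coord_map_product[OF x y]
  by (simp add: christoffel_product[OF M N x(2) y(2)])

text \<open>The tension is the trace over any orthonormal basis, here one split into horizontal and vertical
  vectors. The \<open>N\<close>-part of the summands vanishes on horizontal vectors and is \<open>1 / lam\<^sup>2\<close> times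
  \<open>(\<nabla>d\<psi>)(v, v)\<close> on vertical ones, so it sums to a multiple of the tension of \<open>\<psi>\<close>.\<close>

lemma tension_field_product:
  assumes x: "x \<in> chart_dom M k" and y: "\<psi> y \<in> chart_dom N l"
    and harmonic: "tension_field N N \<psi> y l = 0"
  shows "tension_field P Q \<Psi> (x, y) (k, l) = (tension_field P M fst (x, y) k, 0)"
proof -
  obtain i j where i: "x \<in> chart_dom M i" and j: "y \<in> chart_dom N j"
    using chart_dom_cover[OF sM] chart_dom_cover[OF sN] by blast
  obtain e h where e: "orthonormal_basis (metric M i x) e" and h: "orthonormal_basis (metric N j y) h"
    using smooth_orthonormal_basis[OF M, of i] smooth_orthonormal_basis[OF N, of j] i j by metis
  let ?E = "\<lambda>(a, b). if b = 0 then (e a, 0) else (0, (1 / lam x) *\<^sub>R h b)"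
  note E = orthonormal_basis_warped_product[OF M N lam lam_pos e h i j]
  let ?B = "\<lambda>w. coord_second_fundamental_form P Q \<Psi> (i, j) (k, l) (x, y) w w"
  let ?f = "coord_second_fundamental_form N N \<psi> j l y"
  have ij: "(x, y) \<in> chart_dom P (i, j)" "\<Psi> (x, y) \<in> chart_dom Q (k, l)" using i j x y by auto
  have t: "tension_field P Q \<Psi> (x, y) (k, l) = (\<Sum>b\<in>Basis. ?B (?E b))"
    by (rule tension_field_coord[OF RP RQ smooth_map_product ij E])
  \<comment> \<open>Domain, chart and basis are the same for \<open>\<Psi>\<close> and
    \<open>fst\<close>, so the \<open>M\<close>-parts agree term by term.\<close>
  have "fst (\<Sum>b\<in>Basis. ?B (?E b)) = tension_field P M fst (x, y) k"
    unfolding tension_field_coord[OF RP M fst_smooth ij(1) _ E, of k, simplified, OF x]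
    by (simp add: fst_sum coord_second_fundamental_form_product[OF i x j y])
  moreover have "snd (\<Sum>b\<in>Basis. ?B (?E b)) = 0"
  proof -
    have lin: "linear (frechet_derivative (coord_map N N \<psi> j l) (at (chart_map N j y)))"
      by (rule linear_frechet_derivative[OF smooth_on_differentiable[OF smooth_map_coord[OF \<psi>, folded coord_map_def]]])
        (use j y in auto)
    have hs: "bilinear (hess (coord_map N N \<psi> j l) (chart_map N j y))"
      by (rule bilinear_hess[OF open_smooth_map_overlap(2)[OF sN sN \<psi>] _ smooth_map_coord[OF \<psi>, folded coord_map_def]])
        (use j y in auto)
    have hor: "snd (?B (u, 0)) = 0" for u
      unfolding coord_second_fundamental_form_product[OF i x j y]
        christoffel_warped_product_horizontal[OF M N lam lam_pos i j]
      by (simp add: linear_0[OF lin] bilinear_lzero[OF hs] bilinear_lzero[OF bilinear_christoffel[OF N y]])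
    have ver: "snd (?B (0, v)) = ?f v v" for v
      unfolding coord_second_fundamental_form_product[OF i x j y] snd_conv
        christoffel_warped_product_vertical[OF M N lam lam_pos i j]
      unfolding coord_second_fundamental_form_def ..
    have bf: "bilinear ?f"
      by (rule bilinear_coord_second_fundamental_form[OF N N \<psi> j y])
    have "snd (\<Sum>b\<in>Basis. ?B (?E b)) = (\<Sum>b\<in>Basis. ?f ((1 / lam x) *\<^sub>R h b) ((1 / lam x) *\<^sub>R h b))"
      unfolding sum_Basis_prod_eq by (simp add: snd_sum hor ver nonzero_Basis)
    also have "\<dots> = (1 / lam x) *\<^sub>R (1 / lam x) *\<^sub>R (\<Sum>b\<in>Basis. ?f (h b) (h b))"
      by (simp add: bilinear_lmul[OF bf] bilinear_rmul[OF bf] scaleR_sum_right)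
    also have "(\<Sum>b\<in>Basis. ?f (h b) (h b)) = 0"
      using tension_field_coord[OF N N \<psi> j y h] harmonic by simp
    finally show ?thesis by (simp only: scaleR_zero_right)
  qed
  ultimately show ?thesis unfolding t prod_eq_iff fst_conv snd_conv by (rule conjI)
qed

text \<open>The \<open>N\<close>-part consists of the derivative of a zero function and a
  Christoffel symbol with last argument 0, whatever the vertical component of \<open>X\<close>. The
  splitting of \<open>V'\<close> is assumed on all of \<open>W\<close> because \<open>V'\<close> is
  differentiated.\<close>

lemma pullback_conn_product:
  assumes W: "open W" "W \<subseteq> chart_dom P (i, j) \<inter> \<Psi> -` chart_dom Q (k, l)" "p \<in> W"
    and v: "tangent_vector P p (X p)"
    and V: "smooth_on (chart_map P (i, j) ` W) (\<lambda>z. V (chart_inv P (i, j) z) k)"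
    and eq: "\<And>q. q \<in> W \<Longrightarrow> V' q (k, l) = (V q k, 0)"
  shows "pullback_conn P Q \<Psi> X V' p (k, l) = (pullback_conn P M fst X V p k, 0)"
proof -
  let ?S = "chart_map P (i, j) ` W"
  have S: "open ?S" "chart_map P (i, j) p \<in> ?S"
    using W by (auto intro!: open_chart_map_image[OF sP] simp del: warped_product_simps)
  have inW: "chart_inv P (i, j) z \<in> W" if "z \<in> ?S" for z
  proof -
    from that obtain q where q: "q \<in> W" "z = chart_map P (i, j) q" by blast
    then show ?thesis using chart_inv_chart_map[OF sP, of q "(i, j)"] W(2) by auto
  qed
  have V': "smooth_on ?S (\<lambda>z. V' (chart_inv P (i, j) z) (k, l))"
    using smooth_on_Pair[OF S(1) V smooth_on_const[of _ "0::'d"]] eq[OF inW]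
    by (subst smooth_on_cong[OF S(1), where g = "\<lambda>z. (V (chart_inv P (i, j) z) k, 0)"]) auto
  have W': "W \<subseteq> chart_dom P (i, j) \<inter> fst -` chart_dom M k" using W(2) by auto
  obtain x y where p: "p = (x, y)" by (cases p)
  have xy: "x \<in> chart_dom M i" "x \<in> chart_dom M k" "y \<in> chart_dom N j" "\<psi> y \<in> chart_dom N l"
    using W(2,3) p by auto
  have fr: "frechet_derivative (\<lambda>z. V' (chart_inv P (i, j) z) (k, l)) (at (chart_map P (i, j) p)) w =
      (frechet_derivative (\<lambda>z. V (chart_inv P (i, j) z) k) (at (chart_map P (i, j) p)) w, 0)" for w
    using frechet_derivative_cong_open[OF S smooth_on_differentiable[OF V' S(2)] eq[OF inW], of w]
      frechet_derivative_Pair[OF smooth_on_differentiable[OF V S(2)], of "\<lambda>_. 0::'d" w] by simp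
  show ?thesis
    unfolding pullback_conn_coord[where X = X and V = V', OF sP sQ smooth_map_product W v V', unfolded fr]
      pullback_conn_coord[where X = X and V = V, OF sP sM fst_smooth W(1) W' W(3) v V] eq[OF W(3)]
    unfolding p frechet_coord_map_product[OF xy]
    by (simp add: christoffel_product[OF M N xy(2,4)] bilinear_rzero[OF bilinear_christoffel[OF N xy(4)]])
qed

text \<open>Harmonicity at every point makes the tension split on a neighbourhood and not merely at
  \<open>(x, y)\<close>; this permits the two differentiations in the rough Laplacian.\<close>

lemma f_bitension_field_product:
  assumes f: "smooth_function P f"
    and harmonic: "\<And>y l. \<psi> y \<in> chart_dom N l \<Longrightarrow> tension_field N N \<psi> y l = 0"
    and x: "x \<in> chart_dom M k" and y: "\<psi> y \<in> chart_dom N l"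
  shows "f_bitension_field P Q f \<Psi> (x, y) (k, l) = (f_bitension_field P M f fst (x, y) k, 0)"
proof -
  let ?p = "(x, y)"
  obtain i j where i: "x \<in> chart_dom M i" and j: "y \<in> chart_dom N j"
    using chart_dom_cover[OF sM] chart_dom_cover[OF sN] by blast
  obtain U where U: "?p \<in> U" "local_orthonormal_frame P U (frame_at P ?p)"
    by (rule frame_at_frame[OF RP])
  define \<epsilon> where "\<epsilon> = frame_at P ?p"
  have oU: "open U" and \<epsilon>: "\<And>b. b \<in> Basis \<Longrightarrow> smooth_vector_field P U (\<epsilon> b)"
    using local_orthonormal_frameD(1,2)[OF U(2)] by (auto simp: \<epsilon>_def)
  \<comment> \<open>One open set around \<open>(x, y)\<close> on which the frame is smooth and fixed
    charts of domain and target are available.\<close>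
  define W where "W = U \<inter> (chart_dom P (i, j) \<inter> \<Psi> -` chart_dom Q (k, l))"
  have W: "open W" "W \<subseteq> chart_dom P (i, j) \<inter> \<Psi> -` chart_dom Q (k, l)" "W \<subseteq> U" "?p \<in> W"
    unfolding W_def using oU open_smooth_map_overlap(1)[OF sP sQ smooth_map_product, of "(i, j)" "(k, l)"] U i j x y
    by auto
  have W': "W \<subseteq> chart_dom P (i, j) \<inter> fst -` chart_dom M k" using W(2) by auto
  have oS: "open (chart_map P (i, j) ` W)"
    by (rule open_chart_map_image[OF sP W(1)]) (use W(2) in blast)
  define V where "V q a = f q *\<^sub>R tension_field P M fst q a" for q a
  define V' where "V' q c = f q *\<^sub>R tension_field P Q \<Psi> q c" for q c
  have tens: "tension_field P Q \<Psi> q (k, l) = (tension_field P M fst q k, 0)" if "q \<in> W" for q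
    using tension_field_product[of "fst q" k "snd q" l] harmonic that W(2) by (cases q) auto
  have eqV: "V' q (k, l) = (V q k, 0)" if "q \<in> W" for q
    by (simp add: V_def V'_def tens[OF that])
  have smV: "smooth_on (chart_map P (i, j) ` W) (\<lambda>z. V (chart_inv P (i, j) z) k)"
    unfolding V_def
  proof (rule smooth_on_scaleR[OF oS])
    show "smooth_on (chart_map P (i, j) ` W) (\<lambda>z. f (chart_inv P (i, j) z))"
      using f W(2) unfolding smooth_function_def o_def by (blast intro: smooth_on_subset)
    show "smooth_on (chart_map P (i, j) ` W) (\<lambda>z. tension_field P M fst (chart_inv P (i, j) z) k)"
      by (rule smooth_on_subset[OF smooth_tension_field[OF RP M fst_smooth]]) (use W' in blast)
  qed
  have tan: "tangent_vector P q (\<epsilon> b q)" if "b \<in> Basis" "q \<in> W" for b q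
    using smooth_vector_fieldD(1)[OF \<epsilon>[OF that(1)]] that(2) W(3) by blast
  \<comment> \<open>The inner application is made at every point of \<open>W\<close> and supplies
    the field that the outer one differentiates at \<open>(x, y)\<close>.\<close>
  have second: "pullback_conn P Q \<Psi> (\<epsilon> b) (pullback_conn P Q \<Psi> (\<epsilon> b) V') ?p (k, l) =
      (pullback_conn P M fst (\<epsilon> b) (pullback_conn P M fst (\<epsilon> b) V) ?p k, 0)" if b: "b \<in> Basis" for b
  proof (rule pullback_conn_product[where X = "\<epsilon> b", OF W(1,2,4) tan[OF b W(4)]])
    show "smooth_on (chart_map P (i, j) ` W) (\<lambda>z. pullback_conn P M fst (\<epsilon> b) V (chart_inv P (i, j) z) k)"
      by (rule smooth_pullback_conn[where V = V, OF sP M fst_smooth W(1,3) W' \<epsilon>[OF b] smV])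
    show "pullback_conn P Q \<Psi> (\<epsilon> b) V' q (k, l) = (pullback_conn P M fst (\<epsilon> b) V q k, 0)" if "q \<in> W" for q
      by (rule pullback_conn_product[where X = "\<epsilon> b" and V = V and V' = V', OF W(1,2) that tan[OF b that] smV eqV])
  qed
  \<comment> \<open>Tangency of the direction \<open>\<nabla>\<^sub>\<epsilon> \<epsilon>\<close> at
    \<open>(x, y)\<close> comes from \<open>levi_civita_tangent\<close>, so this derivative too can
    be computed in the fixed chart.\<close>
  have first: "pullback_conn P Q \<Psi> (levi_civita P (\<epsilon> b) (\<epsilon> b)) V' ?p (k, l) =
      (pullback_conn P M fst (levi_civita P (\<epsilon> b) (\<epsilon> b)) V ?p k, 0)" if b: "b \<in> Basis" for b
    by (rule pullback_conn_product[where X = "levi_civita P (\<epsilon> b) (\<epsilon> b)" and V = V and V' = V', OF W(1,2,4) levi_civita_tangent[OF RP oU U(1) \<epsilon>[OF b] \<epsilon>[OF b]] smV eqV])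
  have lap: "rough_laplacian P Q \<Psi> V' ?p (k, l) = (rough_laplacian P M fst V ?p k, 0)"
    unfolding rough_laplacian_def Let_def \<epsilon>_def[symmetric]
    by (simp add: second first prod_eq_iff fst_sum snd_sum)
  have "\<Psi> ?p = (x, \<psi> y)" by simp
  have curv: "curvature Q (\<Psi> ?p) (tension_field P Q \<Psi> ?p) (differential P Q \<Psi> ?p (\<epsilon> b ?p))
        (differential P Q \<Psi> ?p (\<epsilon> b ?p)) (k, l) =
      (curvature M (fst ?p) (tension_field P M fst ?p) (differential P M fst ?p (\<epsilon> b ?p))
        (differential P M fst ?p (\<epsilon> b ?p)) k, 0)" if b: "b \<in> Basis" for b
  proof -
    have ij: "?p \<in> chart_dom P (i, j)" "\<Psi> ?p \<in> chart_dom Q (k, l)" "fst ?p \<in> chart_dom M k" using i j x y by auto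
    \<comment> \<open>The \<open>N\<close>-part of \<open>d\<Psi>(\<epsilon> b)\<close> is in
      general nonzero; the \<open>N\<close>-part of the curvature vanishes because of the tension in
      the first slot, and the \<open>M\<close>-part sees the \<open>M\<close>-part of the
      differential.\<close>
    have d: "fst (differential P Q \<Psi> ?p (\<epsilon> b ?p) (k, l)) = differential P M fst ?p (\<epsilon> b ?p) k"
      unfolding differential_coord[OF sP sQ smooth_map_product ij(1,2) tan[OF b W(4)]]
        differential_coord[OF sP sM fst_smooth ij(1,3) tan[OF b W(4)]]
        frechet_coord_map_product[OF i x j y] by simp
    show ?thesis
      unfolding \<open>\<Psi> ?p = (x, \<psi> y)\<close> fst_conv
      by (rule curvature_product_horizontal[OF M N x y]) (rule tens[OF W(4)] d)+
  qed
  have "(\<Sum>b\<in>Basis. curvature Q (\<Psi> ?p) (tension_field P Q \<Psi> ?p) (differential P Q \<Psi> ?p (\<epsilon> b ?p))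
        (differential P Q \<Psi> ?p (\<epsilon> b ?p)) (k, l)) =
      (\<Sum>b\<in>Basis. (curvature M (fst ?p) (tension_field P M fst ?p) (differential P M fst ?p (\<epsilon> b ?p))
        (differential P M fst ?p (\<epsilon> b ?p)) k, 0))"
    by (rule sum.cong[OF refl curv])
  then show ?thesis
    unfolding f_bitension_field_def Let_def \<epsilon>_def[symmetric] lap[unfolded V_def[abs_def] V'_def[abs_def]]
    by (simp only:) (simp add: prod_eq_iff fst_sum snd_sum)
qed

end

theorem proposition6p7:
  fixes M :: "('i, 'a::{second_countable_topology, t2_space}, 'e::euclidean_space) rmanifold"
    and N :: "('j, 'b::{second_countable_topology, t2_space}, 'd::euclidean_space) rmanifold"
    and lam :: "'a \<Rightarrow> real"
    and \<psi> :: "'b \<Rightarrow> 'b"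
    and f :: "'a \<times> 'b \<Rightarrow> real"
  assumes "riemannian_manifold M" and "riemannian_manifold N"
    and "smooth_function M lam" and "\<And>x. 0 < lam x"
    and "harmonic_map N N \<psi>"
    and "smooth_function (warped_product lam M N) f" and "\<And>p. 0 < f p"
  shows "\<forall>x y. tangent_eq (riemannian_product M N) (map_prod id \<psi> (x, y))
           (f_bitension_field (warped_product lam M N) (riemannian_product M N) f
              (map_prod id \<psi>) (x, y))
           (tangent_pair (f_bitension_field (warped_product lam M N) M f fst (x, y)) (\<lambda>_. 0))"
proof (intro allI)
  fix x y
  have \<psi>: "smooth_map N N \<psi>" "\<And>y l. \<psi> y \<in> chart_dom N l \<Longrightarrow> tension_field N N \<psi> y l = 0"
    using assms(5) unfolding harmonic_map_def by blast+
  show "tangent_eq (riemannian_product M N) (map_prod id \<psi> (x, y))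
           (f_bitension_field (warped_product lam M N) (riemannian_product M N) f
              (map_prod id \<psi>) (x, y))
           (tangent_pair (f_bitension_field (warped_product lam M N) M f fst (x, y)) (\<lambda>_. 0))"
    \<comment> \<open>A chart of the target containing \<open>(x, \<psi> y)\<close> is a pair of
      charts around \<open>x\<close> and \<open>\<psi> y\<close>, which are the two membership
      assumptions of \<open>f_bitension_field_product\<close>.\<close>
    unfolding tangent_eq_def tangent_pair_def
    using f_bitension_field_product[OF assms(1-4) \<psi>(1) assms(6) \<psi>(2)] by auto
qed

end
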